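(* There exists a finitely generated, recursively presented, conjugacy separable, 3-step solvable group with solvable word problem but unsolvable conjugacy problem.
   Context: A group $G$ is conjugacy separable if for any two non-conjugate elements $g_1,g_2\in G$ there is a homomorphism $\varphi$ from $G$ onto a finite group such that $\varphi(g_1)$ and $\varphi(g_2)$ are not conjugate. A group is recursively presented if it has a presentation with a finite (or computable) set of generators and a recursively enumerable set of relators. 3-step solvable means solvable of derived length 3. The word problem (respectively conjugacy problem) of a finitely generated group is the problem of deciding, given a word (respectively two words) in a fixed finite generating set and inverses, whether it represents the identity (respectively whether they represent conjugate elements); "solvable" means decidable by an algorithm. *)

theory Defs
  imports "HOL-Algebra.Solvable_Groups" "HOL-Library.Nat_Bijection"
begin

section \<open>Computability\<close>

text \<open>
  Kleene's partial recursive functions. Codes carry no arity: \<open>rec_eval e\<close> is a partial function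
  on argument lists of every length, and its restriction to lists of any fixed length \<open>k\<close> is a
  \<open>k\<close>-ary partial recursive function. An application with too few arguments is undefined.
\<close>

datatype recf =
    Zero_rec
  | Suc_rec
  | Proj_rec nat
  | Comp_rec recf "recf list"
  | Prim_rec recf recf
  | Mu_rec recf

inductive rec_eval :: "recf \<Rightarrow> nat list \<Rightarrow> nat \<Rightarrow> bool" where
  zero: "rec_eval Zero_rec xs 0"
| suc: "rec_eval Suc_rec (x # xs) (Suc x)"
| proj: "i < length xs \<Longrightarrow> rec_eval (Proj_rec i) xs (xs ! i)"
| comp: "list_all2 (\<lambda>g y. rec_eval g xs y) gs ys \<Longrightarrow> rec_eval f ys z
    \<Longrightarrow> rec_eval (Comp_rec f gs) xs z"
| prim_0: "rec_eval f xs z \<Longrightarrow> rec_eval (Prim_rec f g) (0 # xs) z"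
| prim_Suc: "rec_eval (Prim_rec f g) (n # xs) y \<Longrightarrow> rec_eval g (n # y # xs) z
    \<Longrightarrow> rec_eval (Prim_rec f g) (Suc n # xs) z"
| mu: "rec_eval f (n # xs) 0 \<Longrightarrow> (\<forall>m<n. \<exists>y. rec_eval f (m # xs) (Suc y))
    \<Longrightarrow> rec_eval (Mu_rec f) xs n"

inductive_cases rec_eval_elims:
  "rec_eval Zero_rec xs z"
  "rec_eval Suc_rec xs z"
  "rec_eval (Proj_rec i) xs z"
  "rec_eval (Comp_rec f gs) xs z"
  "rec_eval (Prim_rec f g) (0 # xs) z"
  "rec_eval (Prim_rec f g) (Suc n # xs) z"
  "rec_eval (Mu_rec f) xs z"

lemma rec_eval_deterministic:
  "rec_eval e xs y \<Longrightarrow> rec_eval e xs z \<Longrightarrow> y = z"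
proof (induction arbitrary: z rule: rec_eval.induct)
  case (zero xs)
  from zero.prems show ?case
    by (rule rec_eval_elims(1)) simp
next
  case (suc x xs)
  from suc.prems show ?case
    by (rule rec_eval_elims(2)) simp
next
  case (proj i xs)
  from proj.prems show ?case
    by (rule rec_eval_elims(3)) simp
next
  case (prim_0 f xs y g)
  from prim_0.prems have "rec_eval f xs z"
    by (rule rec_eval_elims(5))
  then show ?case
    by (rule prim_0.IH)
next
  case (comp xs gs ys f w)
  from comp.prems obtain vs where vs: "list_all2 (\<lambda>g y. rec_eval g xs y) gs vs" "rec_eval f vs z"
    by (rule rec_eval_elims(4))
  have "ys = vs"
  proof (rule nth_equalityI)
    show "length ys = length vs"
      using comp.IH(1) vs(1) by (simp add: list_all2_conv_all_nth)
  next
    fix i assume "i < length ys"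
    then show "ys ! i = vs ! i"
      using comp.IH(1) vs(1) by (simp add: list_all2_conv_all_nth)
  qed
  then show ?case
    using comp.IH(2) vs(2) by blast
next
  case (prim_Suc f g n xs y w)
  from prim_Suc.prems obtain a where a: "rec_eval (Prim_rec f g) (n # xs) a" "rec_eval g (n # a # xs) z"
    by (rule rec_eval_elims(6))
  then show ?case
    using prim_Suc.IH by blast
next
  case (mu f n xs)
  from mu.prems have z: "rec_eval f (z # xs) 0 \<and> (\<forall>m<z. \<exists>y. rec_eval f (m # xs) (Suc y))"
    by (rule rec_eval_elims(7)) blast
  have "\<not> z < n"
    using mu.IH(2) z by blast
  moreover have "\<not> n < z"
    using mu.IH(1) z by blast
  ultimately show ?case
    by simp
qed

definition decidable :: "nat set \<Rightarrow> bool" where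
  "decidable A \<longleftrightarrow> (\<exists>e. \<forall>n. rec_eval e [n] (if n \<in> A then 1 else 0))"

definition recursively_enumerable :: "nat set \<Rightarrow> bool" where
  "recursively_enumerable A \<longleftrightarrow> (\<exists>e. A = {n. \<exists>y. rec_eval e [n] y})"


section \<open>Words and presentations\<close>

text \<open>The letter \<open>(x, True)\<close> stands for the generator \<open>x\<close> and \<open>(x, False)\<close> for its inverse.\<close>

type_synonym gword = "(nat \<times> bool) list"

definition words_over :: "nat set \<Rightarrow> gword set" where
  "words_over X = lists (X \<times> UNIV)"

definition word_code :: "gword \<Rightarrow> nat" where
  "word_code w = list_encode (map (\<lambda>(x, b). 2 * x + of_bool b) w)"

text \<open>
  Equality of words in the group \<open>\<langle>X | R\<rangle>\<close>: the congruence on words over \<open>X\<close> generated by free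
  cancellation and by deleting relators.
\<close>

inductive_set pres_rel :: "nat set \<Rightarrow> gword set \<Rightarrow> (gword \<times> gword) set"
  for X :: "nat set" and R :: "gword set" where
  refl: "u \<in> words_over X \<Longrightarrow> (u, u) \<in> pres_rel X R"
| sym: "(u, v) \<in> pres_rel X R \<Longrightarrow> (v, u) \<in> pres_rel X R"
| trans: "(u, v) \<in> pres_rel X R \<Longrightarrow> (v, w) \<in> pres_rel X R \<Longrightarrow> (u, w) \<in> pres_rel X R"
| cancel: "u \<in> words_over X \<Longrightarrow> v \<in> words_over X \<Longrightarrow> x \<in> X
    \<Longrightarrow> (u @ [(x, b), (x, \<not> b)] @ v, u @ v) \<in> pres_rel X R"
| relator: "u \<in> words_over X \<Longrightarrow> v \<in> words_over X \<Longrightarrow> r \<in> R \<Longrightarrow> r \<in> words_over X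
    \<Longrightarrow> (u @ r @ v, u @ v) \<in> pres_rel X R"

definition presented_group :: "nat set \<Rightarrow> gword set \<Rightarrow> gword set monoid" where
  "presented_group X R =
     \<lparr>carrier = words_over X // pres_rel X R,
      mult = (\<lambda>A B. \<Union>u\<in>A. \<Union>v\<in>B. pres_rel X R `` {u @ v}),
      one = pres_rel X R `` {[]}\<rparr>"

definition recursively_presented :: "('a, 'b) monoid_scheme \<Rightarrow> bool" where
  "recursively_presented G \<longleftrightarrow>
     (\<exists>X R. decidable X \<and> R \<subseteq> words_over X \<and> recursively_enumerable (word_code ` R) \<and>
            G \<cong> presented_group X R)"


section \<open>Decision problems\<close>

definition generating_list :: "('a, 'b) monoid_scheme \<Rightarrow> 'a list \<Rightarrow> bool" where
  "generating_list G gs \<longleftrightarrow> set gs \<subseteq> carrier G \<and> generate G (set gs) = carrier G"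

definition finitely_generated :: "('a, 'b) monoid_scheme \<Rightarrow> bool" where
  "finitely_generated G \<longleftrightarrow> (\<exists>A. finite A \<and> A \<subseteq> carrier G \<and> generate G A = carrier G)"

fun word_value :: "('a, 'b) monoid_scheme \<Rightarrow> 'a list \<Rightarrow> gword \<Rightarrow> 'a" where
  "word_value G gs [] = \<one>\<^bsub>G\<^esub>"
| "word_value G gs ((i, b) # w) =
     (if b then gs ! i else inv\<^bsub>G\<^esub> (gs ! i)) \<otimes>\<^bsub>G\<^esub> word_value G gs w"

definition conjugate_in :: "('a, 'b) monoid_scheme \<Rightarrow> 'a \<Rightarrow> 'a \<Rightarrow> bool" where
  "conjugate_in G x y \<longleftrightarrow> (\<exists>h\<in>carrier G. y = h \<otimes>\<^bsub>G\<^esub> x \<otimes>\<^bsub>G\<^esub> inv\<^bsub>G\<^esub> h)"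

definition solvable_word_problem :: "('a, 'b) monoid_scheme \<Rightarrow> 'a list \<Rightarrow> bool" where
  "solvable_word_problem G gs \<longleftrightarrow>
     decidable {word_code w | w. w \<in> words_over {..<length gs} \<and> word_value G gs w = \<one>\<^bsub>G\<^esub>}"

definition solvable_conjugacy_problem :: "('a, 'b) monoid_scheme \<Rightarrow> 'a list \<Rightarrow> bool" where
  "solvable_conjugacy_problem G gs \<longleftrightarrow>
     decidable {prod_encode (word_code u, word_code v) | u v.
       u \<in> words_over {..<length gs} \<and> v \<in> words_over {..<length gs} \<and>
       conjugate_in G (word_value G gs u) (word_value G gs v)}"


section \<open>Conjugacy separability and derived length\<close>

text \<open>
  A formula cannot quantify over the type of the finite quotient; every finite group is isomorphic
  to one whose elements are natural numbers.
\<close>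

definition conjugacy_separable :: "('a, 'b) monoid_scheme \<Rightarrow> bool" where
  "conjugacy_separable G \<longleftrightarrow>
     (\<forall>x\<in>carrier G. \<forall>y\<in>carrier G. \<not> conjugate_in G x y \<longrightarrow>
        (\<exists>(H :: nat monoid) \<phi>. group H \<and> finite (carrier H) \<and> \<phi> \<in> epi G H \<and>
           \<not> conjugate_in H (\<phi> x) (\<phi> y)))"

text \<open>Meaningful only for solvable groups.\<close>

definition derived_length :: "('a, 'b) monoid_scheme \<Rightarrow> nat" where
  "derived_length G = (LEAST n. (derived G ^^ n) (carrier G) = {\<one>\<^bsub>G\<^esub>})"

end

theory Submission
  imports Defs "HOL-Library.Poly_Mapping" "HOL-Library.Z2" "HOL-Library.Countable_Set"
begin

text \<open>
  Let \<open>R\<close> be the ring of Laurent polynomials in \<open>t\<close> over the field with two elements. The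
  matrices with rows \<open>(1, f, z)\<close>, \<open>(0, t^k, g)\<close>, \<open>(0, 0, 1)\<close> with \<open>f, g, z\<close> in \<open>R\<close> form a
  group whose entries \<open>z\<close> are central. Killing the central monomials \<open>t^n\<close> with \<open>n\<close> in a set
  \<open>E\<close> of integers gives a group \<open>hall_group E\<close> of the kind introduced by P. Hall. The three
  elements with \<open>f = 1\<close>, with \<open>g = 1\<close> and with \<open>k = 1\<close> generate it, since commutators of the
  first two with shifted exponents produce all central monomials. Its derived subgroup
  satisfies \<open>k = 0\<close>, and the second one is central and nontrivial, so that the derived length
  is 3 (\<open>hall_derived\<close>). If \<open>E\<close> is decidable, a word is recognised as trivial by counting
  letters and pairs of letters modulo 2 (\<open>solvable_word_problem_hall\<close>), and the trivial words
  then form a recursively enumerable set of relators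
  (\<open>recursively_presented_if_solvable_word_problem\<close>).

  Conjugation in this central extension brings in ideals: the elements \<open>(0, f, 0, 0)\<close> and
  \<open>(0, f, 0, z)\<close>, written as \<open>(k, f, g, z)\<close>, are conjugate iff \<open>z\<close> lies in \<open>span E + f R\<close>. For
  \<open>f = t^(2^(i+1)) - 1\<close> and \<open>z = t^(2^i)\<close> this holds iff \<open>E\<close> contains a number that is
  divisible by exactly the \<open>i\<close>-th power of 2. Hence let \<open>E\<close> consist of 0 and the numbers
  \<open>2^i (4 m + 1)\<close> with \<open>(i, m)\<close> in \<open>D\<close>, where \<open>D\<close> is a decidable partial function with
  undecidable domain. Then conjugacy is undecidable (\<open>unsolvable_conjugacy_problem_hall\<close>).
  Such a \<open>D\<close> exists: if all projections of decidable sets were decidable, unbounded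
  quantifiers could be eliminated, so that the relation \<open>rec_eval\<close>, which asserts the
  existence of a finite derivation, would be decidable, and a diagonal argument refutes this
  (\<open>not_projection_closed\<close>).

  Conjugacy separability uses the finite quotients in which \<open>k\<close> is taken modulo \<open>q\<close>, \<open>f\<close> and
  \<open>g\<close> modulo \<open>t^q - 1\<close>, and \<open>z\<close> modulo an additive subgroup \<open>I\<close> that contains \<open>span E\<close> and the
  ideal of \<open>t^q - 1\<close> (\<open>hall_separated\<close>). Three facts make them sufficient. Central elements
  are separated, since \<open>E\<close> is closed in the profinite topology of the integers; this is where
  it matters that \<open>D\<close> is a partial function (\<open>exponents_closed\<close>). For \<open>k = 0\<close> and \<open>f\<close> or \<open>g\<close>
  nonzero, the central entries of the conjugates with given entries \<open>f'\<close> and \<open>g'\<close> form a coset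
  of \<open>span E + g R + f' R\<close>, and this subgroup contains some \<open>t^q - 1\<close>, so that it can itself
  be taken as \<open>I\<close> (\<open>dvd_T_minus_1\<close>). For \<open>k\<close> nonzero, a conjugating element is determined by
  its exponent of \<open>t\<close> up to the centre, and modulo \<open>t^q - 1\<close> it remains determined modulo
  \<open>t^Q - 1\<close> if \<open>q = 2 k Q\<close> (\<open>cofactor_dvd\<close>); so a value of \<open>Q\<close> that separates finitely many
  central elements suffices.
\<close>

section \<open>Computable functions\<close>

text \<open>
  The argument list serves as an environment: the variable number \<open>i\<close> is \<open>xs ! i\<close>, and a
  bounded operator prepends its bound variable. In this form the closure rules below can be
  applied backwards by \<open>intro\<close> to an arithmetical expression.
\<close>

definition computable :: "nat \<Rightarrow> (nat list \<Rightarrow> nat) \<Rightarrow> bool" where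
  "computable k F \<longleftrightarrow> (\<exists>e. \<forall>xs. length xs = k \<longrightarrow> rec_eval e xs (F xs))"

lemma computable_cong:
  assumes "\<And>xs. length xs = k \<Longrightarrow> F xs = G xs"
  shows "computable k F \<longleftrightarrow> computable k G"
  using assms unfolding computable_def by metis

lemma computable_zero: "computable k (\<lambda>xs. 0)"
  unfolding computable_def using rec_eval.zero by blast

lemma computable_nth: "i < k \<Longrightarrow> computable k (\<lambda>xs. xs ! i)"
  unfolding computable_def using rec_eval.proj by blast

lemma computable_compose:
  assumes F: "computable n F" and len: "length Gs = n" and G: "\<forall>G\<in>set Gs. computable k G"
  shows "computable k (\<lambda>xs. F (map (\<lambda>G. G xs) Gs))"
proof -
  obtain e where e: "\<And>xs. length xs = n \<Longrightarrow> rec_eval e xs (F xs)"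
    using F unfolding computable_def by blast
  obtain c where c: "\<And>G xs. G \<in> set Gs \<Longrightarrow> length xs = k \<Longrightarrow> rec_eval (c G) xs (G xs)"
    using G unfolding computable_def by metis
  have "rec_eval (Comp_rec e (map c Gs)) xs (F (map (\<lambda>G. G xs) Gs))" if "length xs = k" for xs
  proof (rule rec_eval.comp)
    show "list_all2 (\<lambda>g y. rec_eval g xs y) (map c Gs) (map (\<lambda>G. G xs) Gs)"
      using c that by (simp add: list_all2_conv_all_nth)
    show "rec_eval e (map (\<lambda>G. G xs) Gs) (F (map (\<lambda>G. G xs) Gs))"
      using e len by simp
  qed
  then show ?thesis unfolding computable_def by blast
qed

lemma computable_subst1:
  assumes "computable 1 (\<lambda>xs. f (xs ! 0))" "computable k A"
  shows "computable k (\<lambda>xs. f (A xs))"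
  using computable_compose[OF assms(1), of "[A]" k] assms(2) by simp

lemma computable_subst2:
  assumes "computable 2 (\<lambda>xs. f (xs ! 0) (xs ! 1))" "computable k A" "computable k B"
  shows "computable k (\<lambda>xs. f (A xs) (B xs))"
  using computable_compose[OF assms(1), of "[A, B]" k] assms(2-) by simp

lemma computable_subst3:
  assumes "computable 3 (\<lambda>xs. f (xs ! 0) (xs ! 1) (xs ! 2))"
    "computable k A" "computable k B" "computable k C"
  shows "computable k (\<lambda>xs. f (A xs) (B xs) (C xs))"
  using computable_compose[OF assms(1), of "[A, B, C]" k] assms(2-) by simp

lemma computable_Suc:
  assumes "computable k A"
  shows "computable k (\<lambda>xs. Suc (A xs))"
proof -
  have "rec_eval Suc_rec xs (Suc (xs ! 0))" if "length xs = 1" for xs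
    using that rec_eval.suc[of "hd xs" "tl xs"] by (cases xs) auto
  then have "computable 1 (\<lambda>xs. Suc (xs ! 0))" unfolding computable_def by blast
  from computable_subst1[OF this assms] show ?thesis .
qed

lemma computable_const: "computable k (\<lambda>xs. c)"
  by (induction c) (auto intro: computable_zero computable_Suc)

text \<open>
  Below bound variables, the environment of the enclosing expression is what remains after
  dropping the bound ones; three levels of nesting occur.
\<close>

lemma computable_drop: "j + i < k \<Longrightarrow> computable k (\<lambda>xs. drop j xs ! i)"
  by (subst computable_cong[where G = "\<lambda>xs. xs ! (j + i)"]) (auto intro: computable_nth)

lemma computable_drop_drop:
  "a + (b + i) < k \<Longrightarrow> computable k (\<lambda>xs. drop b (drop a xs) ! i)"
  by (subst computable_cong[where G = "\<lambda>xs. xs ! (a + (b + i))"]) (auto simp: ac_simps intro: computable_nth)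

lemma computable_drop_drop_drop:
  "a + (b + (c + i)) < k \<Longrightarrow> computable k (\<lambda>xs. drop c (drop b (drop a xs)) ! i)"
  by (subst computable_cong[where G = "\<lambda>xs. xs ! (a + (b + (c + i)))"]) (auto simp: ac_simps intro: computable_nth)

text \<open>
  The step function sees the counter and the value of the previous stage in front of the
  parameters, hence \<open>drop 2\<close>.
\<close>

lemma computable_rec_nat:
  assumes N: "computable k N" and F: "computable k F"
    and G: "computable (Suc (Suc k)) (\<lambda>ys. G (ys ! 0) (ys ! 1) (drop 2 ys))"
  shows "computable k (\<lambda>xs. rec_nat (F xs) (\<lambda>n y. G n y xs) (N xs))"
proof -
  obtain f where f: "\<And>xs. length xs = k \<Longrightarrow> rec_eval f xs (F xs)"
    using F unfolding computable_def by blast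
  obtain g where g: "\<And>n y xs. length xs = k \<Longrightarrow> rec_eval g (n # y # xs) (G n y xs)"
  proof -
    obtain g where g: "\<And>ys. length ys = Suc (Suc k) \<Longrightarrow> rec_eval g ys (G (ys ! 0) (ys ! 1) (drop 2 ys))"
      using G unfolding computable_def by blast
    show ?thesis
      using g[of "_ # _ # _"] by (intro that[of g]) simp
  qed
  have *: "rec_eval (Prim_rec f g) (n # xs) (rec_nat (F xs) (\<lambda>n y. G n y xs) n)"
    if "length xs = k" for n xs
    using that by (induction n) (auto intro: rec_eval.prim_0 rec_eval.prim_Suc f g)
  have P: "computable (Suc k) (\<lambda>ys. rec_nat (F (tl ys)) (\<lambda>n y. G n y (tl ys)) (hd ys))"
    unfolding computable_def
  proof (intro exI allI impI)
    fix xs :: "nat list" assume "length xs = Suc k"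
    then show "rec_eval (Prim_rec f g) xs (rec_nat (F (tl xs)) (\<lambda>n y. G n y (tl xs)) (hd xs))"
      using *[of "tl xs" "hd xs"] by (cases xs) auto
  qed
  have "computable k (\<lambda>xs. (\<lambda>ys. rec_nat (F (tl ys)) (\<lambda>n y. G n y (tl ys)) (hd ys))
          (map (\<lambda>G. G xs) (N # map (\<lambda>i xs. xs ! i) [0..<k])))"
    by (rule computable_compose[OF P]) (use N in \<open>auto intro: computable_nth\<close>)
  then show ?thesis
    by (rule iffD1[OF computable_cong, rotated])
       (simp add: comp_def, metis map_nth)
qed

lemma computable_add:
  assumes "computable k A" "computable k B"
  shows "computable k (\<lambda>xs. A xs + B xs)"
proof -
  have eq: "a + b = rec_nat b (\<lambda>n y. Suc y) a" for a b :: nat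
    by (induction a) auto
  show ?thesis
    unfolding eq by (intro computable_rec_nat computable_Suc assms computable_nth) simp
qed

lemma computable_mult:
  assumes "computable k A" "computable k B"
  shows "computable k (\<lambda>xs. A xs * B xs)"
proof -
  have eq: "a * b = rec_nat 0 (\<lambda>n y. y + b) a" for a b :: nat
    by (induction a) auto
  have "computable 2 (\<lambda>xs. xs ! 0 * xs ! 1)"
    unfolding eq by (intro computable_rec_nat computable_add computable_nth computable_const computable_drop; simp)
  from computable_subst2[OF this assms] show ?thesis .
qed

lemma computable_diff:
  assumes "computable k A" "computable k B"
  shows "computable k (\<lambda>xs. A xs - B xs)"
proof -
  have pred: "computable 1 (\<lambda>xs. xs ! 0 - 1)"
  proof -
    have eq: "a - 1 = rec_nat 0 (\<lambda>n y. n) a" for a :: nat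
      by (cases a) auto
    show ?thesis unfolding eq by (intro computable_rec_nat computable_nth computable_const; simp)
  qed
  \<comment> \<open>This equation cannot be unfolded as it stands, because its right-hand side
    is again a subtraction.\<close>
  have eq: "a - b = rec_nat a (\<lambda>n y. y - 1) b" for a b :: nat
    by (induction b) auto
  have "computable 2 (\<lambda>xs. rec_nat (xs ! 0) (\<lambda>n y. y - 1) (xs ! 1))"
    by (intro computable_rec_nat computable_nth computable_const computable_subst1[OF pred]; simp)
  then have "computable 2 (\<lambda>xs. xs ! 0 - xs ! 1)"
    unfolding eq[symmetric] .
  from computable_subst2[OF this assms] show ?thesis .
qed

lemma computable_sum:
  assumes "computable k B" and F: "computable (Suc k) (\<lambda>ys. F (ys ! 0) (drop 1 ys))"
  shows "computable k (\<lambda>xs. \<Sum>i<B xs. F i xs)"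
proof -
  have eq: "(\<Sum>i<b. F i xs) = rec_nat 0 (\<lambda>n y. y + F n xs) b" for b xs
    by (induction b) auto
  have "computable (Suc (Suc k)) (\<lambda>xs. (\<lambda>ys. F (ys ! 0) (drop 1 ys))
        (map (\<lambda>G. G xs) (map (\<lambda>i xs. xs ! i) (0 # [2..<Suc (Suc k)]))))"
    by (rule computable_compose[OF F]) (auto intro!: computable_nth simp del: upt_Suc)
  then have F2: "computable (Suc (Suc k)) (\<lambda>ys. F (ys ! 0) (drop 2 ys))"
  proof (rule iffD1[OF computable_cong, rotated])
    fix xs :: "nat list" assume "length xs = Suc (Suc k)"
    then have "map (\<lambda>i. xs ! i) [2..<Suc (Suc k)] = drop 2 xs"
      by (intro nth_equalityI) (auto simp del: upt_Suc)
    then show "F (map (\<lambda>G. G xs) (map (\<lambda>i xs. xs ! i) (0 # [2..<Suc (Suc k)])) ! 0)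
        (drop 1 (map (\<lambda>G. G xs) (map (\<lambda>i xs. xs ! i) (0 # [2..<Suc (Suc k)])))) = F (xs ! 0) (drop 2 xs)"
      by (simp add: comp_def)
  qed
  show ?thesis
    unfolding eq
    by (intro computable_rec_nat computable_add computable_nth computable_const F2 assms(1); simp)
qed

lemma computable_power:
  assumes "computable k A" "computable k B"
  shows "computable k (\<lambda>xs. A xs ^ B xs)"
proof -
  have eq: "a ^ b = rec_nat 1 (\<lambda>n y. a * y) b" for a b :: nat
    by (induction b) auto
  have "computable 2 (\<lambda>xs. xs ! 0 ^ xs ! 1)"
    unfolding eq by (intro computable_rec_nat computable_mult computable_nth computable_const computable_drop; simp)
  from computable_subst2[OF this assms] show ?thesis .
qed

definition computable_pred :: "nat \<Rightarrow> (nat list \<Rightarrow> bool) \<Rightarrow> bool" where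
  "computable_pred k P \<longleftrightarrow> computable k (\<lambda>xs. of_bool (P xs))"

lemma decidable_iff_computable_pred: "decidable A \<longleftrightarrow> computable_pred 1 (\<lambda>xs. xs ! 0 \<in> A)"
proof -
  have "decidable A \<longleftrightarrow> (\<exists>e. \<forall>xs. length xs = 1 \<longrightarrow> rec_eval e xs (if xs ! 0 \<in> A then 1 else 0))"
    unfolding decidable_def
    by (metis (no_types, lifting) One_nat_def length_0_conv length_Cons length_Suc_conv nth_Cons_0)
  then show ?thesis
    unfolding computable_pred_def computable_def of_bool_def by simp
qed

lemma computable_pred_mem:
  assumes "decidable D" "computable k A"
  shows "computable_pred k (\<lambda>xs. A xs \<in> D)"
  using computable_subst1[of "\<lambda>x. of_bool (x \<in> D)" k A] assms
  unfolding decidable_iff_computable_pred computable_pred_def by simp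

lemma computable_pred_not:
  assumes "computable_pred k P" shows "computable_pred k (\<lambda>xs. \<not> P xs)"
proof -
  have "of_bool (\<not> b) = (1 - of_bool b :: nat)" for b by simp
  then show ?thesis
    using assms unfolding computable_pred_def by (simp only: computable_diff computable_const)
qed

lemma computable_pred_conj:
  assumes "computable_pred k P" "computable_pred k Q" shows "computable_pred k (\<lambda>xs. P xs \<and> Q xs)"
  using assms unfolding computable_pred_def by (simp only: of_bool_conj computable_mult)

lemma computable_pred_disj:
  assumes "computable_pred k P" "computable_pred k Q" shows "computable_pred k (\<lambda>xs. P xs \<or> Q xs)"
proof -
  have "computable_pred k (\<lambda>xs. \<not> (\<not> P xs \<and> \<not> Q xs))"
    by (intro computable_pred_not computable_pred_conj assms)
  then show ?thesis by simp
qed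

lemma computable_pred_imp:
  assumes "computable_pred k P" "computable_pred k Q" shows "computable_pred k (\<lambda>xs. P xs \<longrightarrow> Q xs)"
proof -
  have "computable_pred k (\<lambda>xs. \<not> P xs \<or> Q xs)"
    by (intro computable_pred_not computable_pred_disj assms)
  then show ?thesis by simp
qed

lemma computable_pred_less:
  assumes "computable k A" "computable k B" shows "computable_pred k (\<lambda>xs. A xs < B xs)"
proof -
  have "of_bool (a < b) = 1 - (1 - (b - a))" for a b :: nat by auto
  then show ?thesis
    using assms unfolding computable_pred_def by (simp only: computable_diff computable_const)
qed

lemma computable_pred_le:
  assumes "computable k A" "computable k B" shows "computable_pred k (\<lambda>xs. A xs \<le> B xs)"
proof -
  have "computable_pred k (\<lambda>xs. \<not> B xs < A xs)"
    by (intro computable_pred_not computable_pred_less assms)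
  then show ?thesis by (simp add: not_less)
qed

lemma computable_pred_eq:
  assumes "computable k A" "computable k B" shows "computable_pred k (\<lambda>xs. A xs = B xs)"
proof -
  have "computable_pred k (\<lambda>xs. A xs \<le> B xs \<and> B xs \<le> A xs)"
    by (intro computable_pred_conj computable_pred_le assms)
  then show ?thesis by (simp add: order_eq_iff)
qed

lemma computable_of_bool: "computable_pred k P \<Longrightarrow> computable k (\<lambda>xs. of_bool (P xs))"
  unfolding computable_pred_def .

lemma computable_pred_all_less:
  assumes "computable k B" "computable_pred (Suc k) (\<lambda>ys. P (ys ! 0) (drop 1 ys))"
  shows "computable_pred k (\<lambda>xs. \<forall>i<B xs. P i xs)"
proof -
  have "(\<forall>i<b. P i xs) \<longleftrightarrow> (\<Sum>i<b. of_bool (\<not> P i xs)) = (0::nat)" for b xs by auto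
  moreover have "computable_pred k (\<lambda>xs. (\<Sum>i<B xs. of_bool (\<not> P i xs)) = (0::nat))"
    by (intro computable_pred_eq computable_sum computable_of_bool computable_pred_not computable_const assms)
  ultimately show ?thesis by simp
qed

lemma computable_pred_ex_less:
  assumes "computable k B" "computable_pred (Suc k) (\<lambda>ys. P (ys ! 0) (drop 1 ys))"
  shows "computable_pred k (\<lambda>xs. \<exists>i<B xs. P i xs)"
proof -
  have "computable_pred k (\<lambda>xs. \<not> (\<forall>i<B xs. \<not> P i xs))"
    by (intro computable_pred_not computable_pred_all_less assms)
  then show ?thesis by simp
qed

lemma computable_pred_even:
  assumes "computable k A" shows "computable_pred k (\<lambda>xs. even (A xs))"
proof -
  have eq: "(of_bool (even a) :: nat) = rec_nat 1 (\<lambda>n y. 1 - y) a" for a :: nat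
    by (induction a) auto
  have "computable k (\<lambda>xs. rec_nat 1 (\<lambda>n y. 1 - y) (A xs))"
    by (intro computable_rec_nat computable_diff computable_const computable_nth assms) auto
  then show ?thesis unfolding computable_pred_def eq .
qed

lemma computable_if:
  assumes "computable_pred k P" "computable k A" "computable k B"
  shows "computable k (\<lambda>xs. if P xs then A xs else B xs)"
proof -
  have "(if p then a else b) = of_bool p * a + of_bool (\<not> p) * b" for p and a b :: nat by simp
  then show ?thesis
    using assms by (simp only: computable_add computable_mult computable_of_bool computable_pred_not)
qed

lemmas computable_pred_intros =
  computable_pred_not computable_pred_conj computable_pred_disj computable_pred_imp
  computable_pred_less computable_pred_le computable_pred_eq computable_pred_all_less
  computable_pred_ex_less computable_pred_even

lemmas computable_intros =
  computable_nth computable_Suc computable_const computable_drop computable_drop_drop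
  computable_drop_drop_drop computable_rec_nat computable_add computable_mult computable_diff
  computable_sum computable_power computable_of_bool computable_if

text \<open>
  The search for an \<open>m\<close> with \<open>1 - chi n = 0\<close>, where \<open>chi\<close> is the characteristic function and
  \<open>m\<close> a dummy variable, stops at once on members and never on other inputs.
\<close>

lemma decidable_imp_recursively_enumerable:
  assumes "decidable A" shows "recursively_enumerable A"
proof -
  have "computable_pred 2 (\<lambda>xs. xs ! 1 \<notin> A)"
    by (intro computable_pred_not computable_pred_mem assms computable_nth) simp
  then obtain e where e: "\<And>m n. rec_eval e [m, n] (of_bool (n \<notin> A))"
    unfolding computable_pred_def computable_def
    by (metis (no_types, lifting) One_nat_def Suc_1 length_Cons list.size(3) nth_Cons_0 nth_Cons_Suc)
  have "A = {n. \<exists>y. rec_eval (Mu_rec e) [n] y}"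
  proof (intro subset_antisym subsetI CollectI)
    fix n assume "n \<in> A"
    then have "rec_eval (Mu_rec e) [n] 0" using e[of 0 n] by (intro rec_eval.mu) auto
    then show "\<exists>y. rec_eval (Mu_rec e) [n] y" ..
  next
    fix n assume "n \<in> {n. \<exists>y. rec_eval (Mu_rec e) [n] y}"
    then obtain y where "rec_eval (Mu_rec e) [n] y" by blast
    then have "rec_eval e [y, n] 0" by (rule rec_eval_elims(7)) auto
    from rec_eval_deterministic[OF this e] show "n \<in> A" by (auto split: if_splits)
  qed
  then show ?thesis unfolding recursively_enumerable_def by blast
qed


section \<open>Pairs and lists\<close>

lemma computable_prod_encode:
  assumes "computable k A" "computable k B" shows "computable k (\<lambda>xs. prod_encode (A xs, B xs))"
proof -
  have tri: "triangle n = (\<Sum>i<n. Suc i)" for n by (induction n) auto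
  have "computable 2 (\<lambda>xs. prod_encode (xs ! 0, xs ! 1))"
    unfolding prod_encode_def tri split_conv
    by (intro computable_intros; simp)
  from computable_subst2[OF this assms] show ?thesis .
qed

definition pfst :: "nat \<Rightarrow> nat" where "pfst z = fst (prod_decode z)"
definition psnd :: "nat \<Rightarrow> nat" where "psnd z = snd (prod_decode z)"

lemma pfst_encode [simp]: "pfst (prod_encode (x, y)) = x"
  and psnd_encode [simp]: "psnd (prod_encode (x, y)) = y"
  by (simp_all add: pfst_def psnd_def)

lemma prod_encode_pfst_psnd [simp]: "prod_encode (pfst z, psnd z) = z"
  by (simp add: pfst_def psnd_def)

lemma pfst_le: "pfst z \<le> z" and psnd_le: "psnd z \<le> z"
  by (metis le_prod_encode_1 prod_encode_pfst_psnd) (metis le_prod_encode_2 prod_encode_pfst_psnd)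

text \<open>
  A bounded search for a unique index can be written as a sum, which is a computable
  operation.
\<close>

lemma sum_select:
  fixes f :: "nat \<Rightarrow> nat"
  assumes "\<And>i. P i \<longleftrightarrow> i = j" "j < n"
  shows "(\<Sum>i<n. of_bool (P i) * f i) = f j"
proof -
  have "(\<Sum>i<n. of_bool (P i) * f i) = (\<Sum>i<n. if i = j then f i else 0)"
    by (rule sum.cong) (auto simp: assms)
  then show ?thesis using assms by simp
qed

lemma computable_pfst:
  assumes "computable k A" shows "computable k (\<lambda>xs. pfst (A xs))"
proof -
  have eq: "pfst z = (\<Sum>i<Suc z. of_bool (\<exists>j<Suc z. prod_encode (i, j) = z) * i)" for z
  proof (rule sum_select[symmetric])
    show "(\<exists>j<Suc z. prod_encode (i, j) = z) \<longleftrightarrow> i = pfst z" for i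
      by (metis le_imp_less_Suc pfst_encode prod_encode_pfst_psnd psnd_le)
  qed (use pfst_le[of z] in simp)
  have "computable 1 (\<lambda>xs. pfst (xs ! 0))"
    unfolding eq by (intro computable_intros computable_pred_intros computable_prod_encode; simp)
  from computable_subst1[OF this assms] show ?thesis .
qed

lemma computable_psnd:
  assumes "computable k A" shows "computable k (\<lambda>xs. psnd (A xs))"
proof -
  have eq: "psnd z = (\<Sum>i<Suc z. of_bool (\<exists>j<Suc z. prod_encode (j, i) = z) * i)" for z
  proof (rule sum_select[symmetric])
    show "(\<exists>j<Suc z. prod_encode (j, i) = z) \<longleftrightarrow> i = psnd z" for i
      by (metis le_imp_less_Suc psnd_encode prod_encode_pfst_psnd pfst_le)
  qed (use psnd_le[of z] in simp)
  have "computable 1 (\<lambda>xs. psnd (xs ! 0))"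
    unfolding eq by (intro computable_intros computable_pred_intros computable_prod_encode; simp)
  from computable_subst1[OF this assms] show ?thesis .
qed

definition llen :: "nat \<Rightarrow> nat" where "llen c = length (list_decode c)"

text \<open>
  Iterated tails of a coded list. The empty list has code 0, which is fixed because
  \<open>psnd (0 - 1) = 0\<close>.
\<close>

definition ldrop :: "nat \<Rightarrow> nat \<Rightarrow> nat" where "ldrop c i = rec_nat c (\<lambda>n y. psnd (y - 1)) i"

lemma psnd_0 [simp]: "psnd 0 = 0" using psnd_le[of 0] by simp

lemma list_encode_tl: "psnd (list_encode xs - 1) = list_encode (tl xs)"
  by (cases xs) auto

lemma ldrop_encode: "ldrop (list_encode xs) i = list_encode (drop i xs)"
  by (induction i) (auto simp: ldrop_def list_encode_tl[unfolded One_nat_def] drop_Suc tl_drop)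

lemma list_encode_eq_0_iff [simp]: "list_encode xs = 0 \<longleftrightarrow> xs = []"
  by (cases xs) auto

lemma length_le_list_encode: "length xs \<le> list_encode xs"
proof (induction xs)
  case (Cons x xs)
  then show ?case using le_prod_encode_2[of "list_encode xs" x] by simp
qed simp

lemma computable_ldrop:
  assumes "computable k A" "computable k B" shows "computable k (\<lambda>xs. ldrop (A xs) (B xs))"
proof -
  have "computable 2 (\<lambda>xs. ldrop (xs ! 0) (xs ! 1))" unfolding ldrop_def
    by (intro computable_intros computable_psnd; simp)
  from computable_subst2[OF this assms] show ?thesis .
qed

lemma llen_conv: "llen c = (\<Sum>i<c. of_bool (ldrop c i \<noteq> 0))"
proof -
  define xs where "xs = list_decode c"
  have c: "c = list_encode xs" by (simp add: xs_def)
  have "(\<Sum>i<c. of_bool (ldrop c i \<noteq> 0)) = (\<Sum>i<c. of_bool (i < length xs) :: nat)"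
    by (rule sum.cong) (auto simp: c ldrop_encode not_le)
  also have "\<dots> = card {i. i < c \<and> i < length xs}" by (simp add: of_bool_def sum.If_cases Int_def)
  also have "{i. i < c \<and> i < length xs} = {..<length xs}"
    using length_le_list_encode[of xs] by (auto simp: c)
  finally show ?thesis by (simp add: llen_def xs_def)
qed

lemma computable_llen:
  assumes "computable k A" shows "computable k (\<lambda>xs. llen (A xs))"
proof -
  have "computable 1 (\<lambda>xs. llen (xs ! 0))" unfolding llen_conv
    by (intro computable_intros computable_pred_intros computable_ldrop; simp)
  from computable_subst1[OF this assms] show ?thesis .
qed

definition lnth :: "nat \<Rightarrow> nat \<Rightarrow> nat" where "lnth c i = pfst (ldrop c i - 1)"

lemma llen_encode [simp]: "llen (list_encode xs) = length xs"
  by (simp add: llen_def)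

lemma lnth_encode [simp]: "i < length xs \<Longrightarrow> lnth (list_encode xs) i = xs ! i"
  by (simp add: lnth_def ldrop_encode Cons_nth_drop_Suc[symmetric])

lemma computable_lnth:
  assumes "computable k A" "computable k B" shows "computable k (\<lambda>xs. lnth (A xs) (B xs))"
  unfolding lnth_def by (intro computable_intros computable_pfst computable_ldrop assms)

lemmas computable_code_intros =
  computable_prod_encode computable_pfst computable_psnd computable_ldrop computable_llen computable_lnth


section \<open>An undecidable projection of a decidable set\<close>

text \<open>
  The assumption to be refuted. It allows unbounded quantifiers to be eliminated, so that
  every arithmetical predicate would be decidable.
\<close>

definition projection_closed :: bool where
  "projection_closed \<longleftrightarrow>
     (\<forall>D. decidable D \<longrightarrow> decidable {i. \<exists>m. prod_encode (i, m) \<in> D})"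

lemma computable_list_encode: "computable k list_encode"
proof -
  have *: "computable k (\<lambda>xs. list_encode (map (\<lambda>j. xs ! j) js))" if "set js \<subseteq> {..<k}" for js
    using that
    by (induction js)
       (auto intro!: computable_const computable_Suc computable_prod_encode computable_nth)
  have "computable k (\<lambda>xs. list_encode (map (\<lambda>j. xs ! j) [0..<k]))"
    by (rule *) auto
  then show ?thesis
    by (rule iffD1[OF computable_cong, rotated]) (metis map_nth)
qed

text \<open>
  The parameters are packed into the code of one list, which leaves a projection of a set of
  coded pairs.
\<close>

lemma computable_pred_ex:
  assumes closed: projection_closed
    and P: "computable_pred (Suc k) (\<lambda>ys. P (ys ! 0) (drop 1 ys))"
  shows "computable_pred k (\<lambda>xs. \<exists>i. P i xs)"
proof -
  define D where "D = {n. P (psnd n) (map (lnth (pfst n)) [0..<k])}"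
  have "computable 1 (\<lambda>xs. (\<lambda>ys. of_bool (P (ys ! 0) (drop 1 ys))) (map (\<lambda>G. G xs)
      ((\<lambda>xs. psnd (xs ! 0)) # map (\<lambda>j xs. lnth (pfst (xs ! 0)) j) [0..<k])))"
    by (rule computable_compose[OF P[unfolded computable_pred_def]])
       (auto intro!: computable_psnd computable_nth computable_lnth computable_pfst computable_const)
  then have "decidable D"
    unfolding decidable_iff_computable_pred computable_pred_def D_def
    by (simp add: comp_def)
  then have "decidable {c. \<exists>m. prod_encode (c, m) \<in> D}"
    using closed unfolding projection_closed_def by blast
  from computable_pred_mem[OF this computable_list_encode[of k]]
  have "computable_pred k (\<lambda>xs. \<exists>m. P m (map (lnth (list_encode xs)) [0..<k]))"
    by (simp add: D_def)
  moreover have "map (lnth (list_encode xs)) [0..<k] = xs" if "length xs = k" for xs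
    using that by (intro nth_equalityI) auto
  ultimately show ?thesis
    unfolding computable_pred_def by (subst computable_cong) auto
qed

fun recf_code :: "recf \<Rightarrow> nat" where
  "recf_code Zero_rec = prod_encode (0, 0)"
| "recf_code Suc_rec = prod_encode (1, 0)"
| "recf_code (Proj_rec i) = prod_encode (2, i)"
| "recf_code (Comp_rec f gs) = prod_encode (3, prod_encode (recf_code f, list_encode (map recf_code gs)))"
| "recf_code (Prim_rec f g) = prod_encode (4, prod_encode (recf_code f, recf_code g))"
| "recf_code (Mu_rec f) = prod_encode (5, recf_code f)"

text \<open>
  One application of an introduction rule of \<open>rec_eval\<close>, with codes in place of programs and
  lists; \<open>S\<close> is the set of judgements available as premises. The tag \<open>pfst c\<close> tells the
  constructor of the program \<open>c\<close>, and \<open>Suc (prod_encode (a, x))\<close> is the code of a list with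
  head \<open>a\<close> and coded tail \<open>x\<close>.
\<close>

definition eval_step :: "(nat \<Rightarrow> nat \<Rightarrow> nat \<Rightarrow> bool) \<Rightarrow> nat \<Rightarrow> nat \<Rightarrow> nat \<Rightarrow> bool" where
  "eval_step S c x y \<longleftrightarrow>
     (pfst c = 0 \<and> y = 0) \<or>
     (pfst c = 1 \<and> (\<exists>a z. x = Suc (prod_encode (a, z)) \<and> y = Suc a)) \<or>
     (pfst c = 2 \<and> psnd c < llen x \<and> y = lnth x (psnd c)) \<or>
     (pfst c = 3 \<and> (\<exists>v. llen v = llen (psnd (psnd c)) \<and>
        (\<forall>i<llen v. S (lnth (psnd (psnd c)) i) x (lnth v i)) \<and> S (pfst (psnd c)) v y)) \<or>
     (pfst c = 4 \<and> (\<exists>z. x = Suc (prod_encode (0, z)) \<and> S (pfst (psnd c)) z y)) \<or>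
     (pfst c = 4 \<and> (\<exists>n z v. x = Suc (prod_encode (Suc n, z)) \<and> S c (Suc (prod_encode (n, z))) v \<and>
        S (psnd (psnd c)) (Suc (prod_encode (n, Suc (prod_encode (v, z))))) y)) \<or>
     (pfst c = 5 \<and> S (psnd c) (Suc (prod_encode (y, x))) 0 \<and>
        (\<forall>m<y. \<exists>v. S (psnd c) (Suc (prod_encode (m, x))) (Suc v)))"

lemma eval_step_mono:
  assumes "eval_step S c x y" "\<And>c x y. S c x y \<Longrightarrow> T c x y"
  shows "eval_step T c x y"
  by (rule rev_mp[OF assms(1)], unfold eval_step_def)
     (intro disj_mono conj_mono ex_mono all_mono imp_mono imp_refl impI[OF assms(2)])

lemma eval_step_sound:
  assumes S: "\<And>e xs y. S (recf_code e) (list_encode xs) y \<Longrightarrow> rec_eval e xs y"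
    and step: "eval_step S (recf_code e) (list_encode xs) y"
  shows "rec_eval e xs y"
proof -
  have S': "rec_eval e (list_decode x) y" if "S (recf_code e) x y" for e x y
    using S[of e "list_decode x"] that by simp
  have cons: "(list_encode xs = Suc (prod_encode (a, z))) \<longleftrightarrow> xs = a # list_decode z" for xs a z
    by (metis list_encode.simps(2) list_encode_inverse list_decode_inverse)
  show ?thesis
  proof (cases e)
    case Zero_rec
    then show ?thesis using step by (auto simp: eval_step_def intro: rec_eval.zero)
  next
    case Suc_rec
    then show ?thesis using step by (auto simp: eval_step_def cons intro: rec_eval.suc)
  next
    case (Proj_rec i)
    then show ?thesis using step by (auto simp: eval_step_def intro: rec_eval.proj)
  next
    case (Comp_rec f gs)
    then obtain v where v: "llen v = length gs"
      "\<And>i. i < length gs \<Longrightarrow> S (recf_code (gs ! i)) (list_encode xs) (lnth v i)" "S (recf_code f) v y"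
      using step by (auto simp: eval_step_def)
    define ys where "ys = list_decode v"
    have "list_all2 (\<lambda>g y. rec_eval g xs y) gs ys"
      using v(1,2) S unfolding list_all2_conv_all_nth
      by (metis llen_encode lnth_encode list_decode_inverse ys_def)
    moreover have "rec_eval f ys y" using S' v(3) by (simp add: ys_def)
    ultimately show ?thesis unfolding Comp_rec by (rule rec_eval.comp)
  next
    case (Prim_rec f g)
    then consider z where "xs = 0 # list_decode z" "S (recf_code f) z y"
      | n z v where "xs = Suc n # list_decode z" "S (recf_code e) (Suc (prod_encode (n, z))) v"
          "S (recf_code g) (Suc (prod_encode (n, Suc (prod_encode (v, z))))) y"
      using step by (auto simp: eval_step_def cons)
    then show ?thesis
    proof cases
      case 1
      then show ?thesis using S' Prim_rec by (auto intro: rec_eval.prim_0)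
    next
      case 2
      then show ?thesis using S'[OF 2(2)] S'[OF 2(3)] Prim_rec by (auto intro: rec_eval.prim_Suc)
    qed
  next
    case (Mu_rec f)
    then have 0: "S (recf_code f) (Suc (prod_encode (y, list_encode xs))) 0"
      and 1: "\<forall>m<y. \<exists>v. S (recf_code f) (Suc (prod_encode (m, list_encode xs))) (Suc v)"
      using step by (auto simp: eval_step_def)
    show ?thesis unfolding Mu_rec
      by (rule rec_eval.mu) (use S'[OF 0] 1 S' in \<open>fastforce+\<close>)
  qed
qed

definition mem_triple :: "nat \<Rightarrow> nat \<Rightarrow> nat \<Rightarrow> nat \<Rightarrow> bool" where
  "mem_triple l c x y \<longleftrightarrow> (\<exists>p<llen l. lnth l p = prod_encode (c, prod_encode (x, y)))"

lemma mem_triple_encode: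
  "mem_triple (list_encode L) c x y \<longleftrightarrow> prod_encode (c, prod_encode (x, y)) \<in> set L"
  unfolding mem_triple_def by (auto simp: in_set_conv_nth)

text \<open>
  A coded list of judgements each of which follows in one step from later ones.
\<close>

definition derivation :: "nat \<Rightarrow> bool" where
  "derivation l \<longleftrightarrow> (\<forall>p<llen l. eval_step (mem_triple (ldrop l (Suc p)))
     (pfst (lnth l p)) (pfst (psnd (lnth l p))) (psnd (psnd (lnth l p))))"

lemma derivation_Nil: "derivation (list_encode [])"
  by (simp add: derivation_def llen_def)

lemma derivation_Cons:
  "derivation (list_encode (s # L)) \<longleftrightarrow>
     eval_step (mem_triple (list_encode L)) (pfst s) (pfst (psnd s)) (psnd (psnd s)) \<and>
     derivation (list_encode L)"
proof -
  have split: "(\<forall>p<Suc n. P p) \<longleftrightarrow> P 0 \<and> (\<forall>p<n. P (Suc p))" for P and n :: nat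
    by (auto simp: less_Suc_eq_0_disj)
  show ?thesis
    unfolding derivation_def llen_encode length_Cons split
    by (simp add: ldrop_encode del: list_encode.simps)
qed

lemma derivation_append:
  "derivation (list_encode L) \<Longrightarrow> derivation (list_encode M) \<Longrightarrow> derivation (list_encode (L @ M))"
proof (induction L)
  case (Cons s L)
  then show ?case
    unfolding append_Cons derivation_Cons
    by (auto elim!: eval_step_mono simp: mem_triple_encode simp del: list_encode.simps)
qed simp

definition derivable :: "nat \<Rightarrow> nat \<Rightarrow> nat \<Rightarrow> bool" where
  "derivable c x y \<longleftrightarrow> (\<exists>l. derivation l \<and> mem_triple l c x y)"

lemma derivable_iff_list: "derivable c x y \<longleftrightarrow>
    (\<exists>L. derivation (list_encode L) \<and> prod_encode (c, prod_encode (x, y)) \<in> set L)"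
  unfolding derivable_def mem_triple_encode[symmetric] by (metis list_decode_inverse)

lemma derivable_sound: "derivable (recf_code e) (list_encode xs) y \<Longrightarrow> rec_eval e xs y"
proof -
  have "rec_eval e xs y"
    if "derivation (list_encode L)" "mem_triple (list_encode L) (recf_code e) (list_encode xs) y"
    for L e xs y
    using that
  proof (induction L arbitrary: e xs y)
    case (Cons s L)
    from Cons.prems(1) have L: "derivation (list_encode L)"
      and step: "eval_step (mem_triple (list_encode L)) (pfst s) (pfst (psnd s)) (psnd (psnd s))"
      unfolding derivation_Cons by auto
    show ?case
    proof (cases "mem_triple (list_encode L) (recf_code e) (list_encode xs) y")
      case True
      then show ?thesis using Cons.IH L by blast
    next
      case False
      then have "s = prod_encode (recf_code e, prod_encode (list_encode xs, y))"
        using Cons.prems(2) by (simp add: mem_triple_encode del: list_encode.simps)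
      then show ?thesis
        using eval_step_sound[of "mem_triple (list_encode L)", OF Cons.IH[OF L]] step by simp
    qed
  qed (simp add: mem_triple_encode del: list_encode.simps)
  then show "derivable (recf_code e) (list_encode xs) y \<Longrightarrow> rec_eval e xs y"
    unfolding derivable_iff_list mem_triple_encode[symmetric] by blast
qed

text \<open>
  Derivations can be concatenated, so finitely many judgements have a common one.
\<close>

lemma derivable_common:
  assumes "finite F" "\<And>s. s \<in> F \<Longrightarrow> derivable (pfst s) (pfst (psnd s)) (psnd (psnd s))"
  shows "\<exists>L. derivation (list_encode L) \<and> F \<subseteq> set L"
  using assms
proof (induction F rule: finite_induct)
  case empty
  then show ?case using derivation_Nil by blast
next
  case (insert s F)
  obtain L where "derivation (list_encode L)" "F \<subseteq> set L" using insert by blast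
  moreover obtain M where "derivation (list_encode M)" "s \<in> set M"
    using insert.prems[of s] unfolding derivable_iff_list by auto
  ultimately have "derivation (list_encode (M @ L))" "insert s F \<subseteq> set (M @ L)"
    using derivation_append by auto
  then show ?case by blast
qed

lemma derivable_step:
  assumes F: "finite F" "\<And>c x y. (c, x, y) \<in> F \<Longrightarrow> derivable c x y"
    and step: "eval_step (\<lambda>c x y. (c, x, y) \<in> F) c x y"
  shows "derivable c x y"
proof -
  define code where "code = (\<lambda>(c, x, y). prod_encode (c, prod_encode (x, y)))"
  obtain L where L: "derivation (list_encode L)" "code ` F \<subseteq> set L"
    using derivable_common[of "code ` F"] F by (force simp: code_def)
  have "eval_step (mem_triple (list_encode L)) c x y"
    by (rule eval_step_mono[OF step]) (use L(2) in \<open>force simp: mem_triple_encode code_def\<close>)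
  then have "derivation (list_encode (prod_encode (c, prod_encode (x, y)) # L))"
    unfolding derivation_Cons using L(1) by simp
  then show ?thesis
    unfolding derivable_iff_list
    by (intro exI[of _ "prod_encode (c, prod_encode (x, y)) # L"]) (simp del: list_encode.simps)
qed

lemma derivable_complete: "rec_eval e xs y \<Longrightarrow> derivable (recf_code e) (list_encode xs) y"
proof (induction rule: rec_eval.induct)
  case (zero xs)
  show ?case by (rule derivable_step[of "{}"]) (auto simp: eval_step_def)
next
  case (suc x xs)
  show ?case by (rule derivable_step[of "{}"]) (auto simp: eval_step_def)
next
  case (proj i xs)
  then have "i < length xs" by simp
  show ?case
    by (rule derivable_step[of "{}"]) (use \<open>i < length xs\<close> in \<open>auto simp: eval_step_def\<close>)
next
  case (comp xs gs ys f z)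
  have len: "length ys = length gs" and
    gs: "\<And>i. i < length gs \<Longrightarrow> derivable (recf_code (gs ! i)) (list_encode xs) (ys ! i)"
    using comp.IH(1) by (auto simp: list_all2_conv_all_nth)
  show ?case
    by (rule derivable_step[of "insert (recf_code f, list_encode ys, z)
          ((\<lambda>i. (recf_code (gs ! i), list_encode xs, ys ! i)) ` {..<length gs})"])
       (use comp.IH(2) gs len in \<open>auto simp: eval_step_def intro!: exI[of _ "list_encode ys"]\<close>)
next
  case (prim_0 f xs z g)
  show ?case
    by (rule derivable_step[of "{(recf_code f, list_encode xs, z)}"])
       (use prim_0.IH in \<open>auto simp: eval_step_def\<close>)
next
  case (prim_Suc f g n xs y z)
  show ?case
    by (rule derivable_step[of "{(recf_code (Prim_rec f g), list_encode (n # xs), y),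
        (recf_code g, list_encode (n # y # xs), z)}"])
       (use prim_Suc.IH in \<open>auto simp: eval_step_def\<close>)
next
  case (mu f n xs)
  then obtain v where v: "\<And>m. m < n \<Longrightarrow> derivable (recf_code f) (list_encode (m # xs)) (Suc (v m))"
    by metis
  show ?case
    by (rule derivable_step[of "insert (recf_code f, list_encode (n # xs), 0)
          ((\<lambda>m. (recf_code f, list_encode (m # xs), Suc (v m))) ` {..<n})"])
       (use mu.IH(1) v in \<open>auto simp: eval_step_def\<close>)
qed

lemma derivable_iff: "derivable (recf_code e) (list_encode xs) y \<longleftrightarrow> rec_eval e xs y"
  using derivable_sound derivable_complete by blast

lemma computable_pred_subst4:
  assumes "computable_pred 4 (\<lambda>xs. P (xs ! 0) (xs ! 1) (xs ! 2) (xs ! 3))"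
    "computable k A" "computable k B" "computable k C" "computable k D"
  shows "computable_pred k (\<lambda>xs. P (A xs) (B xs) (C xs) (D xs))"
  using computable_compose[OF assms(1)[unfolded computable_pred_def], of "[A, B, C, D]" k] assms(2-)
  unfolding computable_pred_def by (simp add: eval_nat_numeral)

lemma computable_pred_mem_triple:
  assumes "computable k A" "computable k B" "computable k C" "computable k D"
  shows "computable_pred k (\<lambda>xs. mem_triple (A xs) (B xs) (C xs) (D xs))"
proof (rule computable_pred_subst4[OF _ assms])
  show "computable_pred 4 (\<lambda>xs. mem_triple (xs ! 0) (xs ! 1) (xs ! 2) (xs ! 3))"
    unfolding mem_triple_def
    by (intro computable_intros computable_pred_intros computable_code_intros; simp)
qed

lemma computable_pred_eval_step:
  assumes closed: projection_closed
  shows "computable_pred 4 (\<lambda>xs. eval_step (mem_triple (xs ! 0)) (xs ! 1) (xs ! 2) (xs ! 3))"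
  unfolding eval_step_def
  by (intro computable_intros computable_pred_intros computable_code_intros
      computable_pred_mem_triple computable_pred_ex[OF closed]; simp)

lemma computable_pred_derivable:
  assumes closed: projection_closed
  shows "computable_pred 3 (\<lambda>xs. derivable (xs ! 0) (xs ! 1) (xs ! 2))"
  unfolding derivable_def derivation_def
  by (intro computable_intros computable_pred_intros computable_code_intros
      computable_pred_mem_triple computable_pred_ex[OF closed]
      computable_pred_subst4[where P = "\<lambda>l. eval_step (mem_triple l)", OF computable_pred_eval_step[OF closed]]; simp)

text \<open>
  The formula that defines \<open>derivable\<close> is arithmetical, hence it would be decidable, and so
  would be the set of all \<open>n\<close> for which the program with code \<open>n\<close> does not return 1 on input
  \<open>n\<close>.
\<close>

theorem not_projection_closed: "\<not> projection_closed"
proof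
  assume closed: projection_closed
  define W where "W = {n. \<not> derivable n (list_encode [n]) 1}"
  have "computable 1 (\<lambda>xs. (\<lambda>xs. of_bool (derivable (xs ! 0) (xs ! 1) (xs ! 2)))
      (map (\<lambda>G. G xs) [\<lambda>xs. xs ! 0, \<lambda>xs. list_encode [xs ! 0], \<lambda>xs. 1]))"
    by (rule computable_compose[OF computable_pred_derivable[OF closed, unfolded computable_pred_def]])
       (auto intro!: computable_intros computable_code_intros)
  then have "computable_pred 1 (\<lambda>xs. \<not> derivable (xs ! 0) (list_encode [xs ! 0]) 1)"
    by (intro computable_pred_not) (simp add: computable_pred_def eval_nat_numeral)
  then have "decidable W" unfolding decidable_iff_computable_pred W_def by simp
  then obtain e where e: "\<And>n. rec_eval e [n] (if n \<in> W then 1 else 0)"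
    unfolding decidable_def by blast
  have "recf_code e \<in> W \<longleftrightarrow> \<not> rec_eval e [recf_code e] 1"
    using derivable_iff[of e "[recf_code e]" 1] by (simp add: W_def)
  then show False
    using e[of "recf_code e"] rec_eval_deterministic by (auto split: if_splits)
qed


section \<open>A closed set of exponents\<close>

text \<open>
  Keeping only the least \<open>m\<close> for each \<open>i\<close> makes a relation single-valued without changing its
  domain.
\<close>

lemma exists_undecidable_domain:
  "\<exists>D. decidable D \<and> (\<forall>i m m'. prod_encode (i, m) \<in> D \<longrightarrow> prod_encode (i, m') \<in> D \<longrightarrow> m = m') \<and>
     \<not> decidable {i. \<exists>m. prod_encode (i, m) \<in> D}"
proof -
  obtain E where E: "decidable E" "\<not> decidable {i. \<exists>m. prod_encode (i, m) \<in> E}"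
    using not_projection_closed unfolding projection_closed_def by blast
  define D where "D = {n. n \<in> E \<and> (\<forall>m<psnd n. prod_encode (pfst n, m) \<notin> E)}"
  have "decidable D"
    unfolding D_def decidable_iff_computable_pred mem_Collect_eq
    by (intro computable_pred_intros computable_pred_mem[OF E(1)] computable_intros
        computable_code_intros; simp)
  moreover have "m = m'" if "prod_encode (i, m) \<in> D" "prod_encode (i, m') \<in> D" for i m m'
    using that by (auto simp: D_def intro: linorder_cases[of m m'])
  moreover have "(\<exists>m. prod_encode (i, m) \<in> D) \<longleftrightarrow> (\<exists>m. prod_encode (i, m) \<in> E)" for i
  proof
    assume "\<exists>m. prod_encode (i, m) \<in> E"
    then have "prod_encode (i, LEAST m. prod_encode (i, m) \<in> E) \<in> D"
      by (auto simp: D_def intro: LeastI dest: not_less_Least)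
    then show "\<exists>m. prod_encode (i, m) \<in> D" ..
  qed (auto simp: D_def)
  ultimately show ?thesis using E(2) by auto
qed

text \<open>
  The index \<open>i\<close> is recovered from \<open>2 ^ i * (4 * m + 1)\<close> as the exponent of 2 in it. These
  numbers may accumulate at 0 in the profinite topology of the integers; therefore 0 belongs
  to the set.
\<close>

definition exponents :: "nat set \<Rightarrow> nat set" where
  "exponents D = insert 0 {2 ^ i * (4 * m + 1) | i m. prod_encode (i, m) \<in> D}"

lemma decidable_exponents:
  assumes "decidable D"
  shows "decidable (exponents D)"
proof -
  have bound: "i < 2 ^ i * (4 * m + 1) \<and> m < 2 ^ i * (4 * m + 1)" for i m :: nat
  proof
    have "i < 2 ^ i * 1" by simp
    also have "\<dots> \<le> 2 ^ i * (4 * m + 1)" by (rule mult_le_mono2) simp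
    finally show "i < 2 ^ i * (4 * m + 1)" .
    have "m < 1 * (4 * m + 1)" by simp
    also have "\<dots> \<le> 2 ^ i * (4 * m + 1)" by (rule mult_le_mono1) simp
    finally show "m < 2 ^ i * (4 * m + 1)" .
  qed
  have eq: "x \<in> exponents D \<longleftrightarrow>
      x = 0 \<or> (\<exists>i<x. \<exists>m<x. x = 2 ^ i * (4 * m + 1) \<and> prod_encode (i, m) \<in> D)" for x
    unfolding exponents_def using bound by blast
  show ?thesis
    unfolding decidable_iff_computable_pred eq
    by (intro computable_pred_intros computable_pred_mem[OF assms] computable_intros
        computable_code_intros; simp)
qed

lemma odd_part_unique:
  fixes u w :: int
  assumes "2 ^ i * u = 2 ^ j * w" "odd u" "odd w"
  shows "i = j"
proof -
  have *: "i \<le> j" if "2 ^ i * u = 2 ^ j * w" "odd u" "odd w" for i j and u w :: int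
  proof (rule ccontr)
    assume "\<not> i \<le> j"
    then obtain d where "i = j + Suc d" by (metis add_Suc_right less_imp_Suc_add not_le)
    then have "w = 2 * (2 ^ d * u)" using that(1) by (simp add: power_add algebra_simps)
    then show False using that(3) by simp
  qed
  show ?thesis using *[of i u j w] *[of j w i u] assms by simp
qed

lemma odd_part_exists:
  fixes x :: int
  assumes "x \<noteq> 0"
  obtains i u where "x = 2 ^ i * u" "odd u"
proof -
  have "\<exists>i u. x = 2 ^ i * u \<and> odd u"
    using assms
  proof (induction "nat \<bar>x\<bar>" arbitrary: x rule: less_induct)
    case less
    show ?case
    proof (cases "odd x")
      case True
      then show ?thesis by (intro exI[of _ 0] exI[of _ x]) simp
    next
      case False
      then obtain y where y: "x = 2 * y" by auto
      with less.prems have "nat \<bar>y\<bar> < nat \<bar>x\<bar>" "y \<noteq> 0" by auto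
      from less.hyps[OF this] obtain i u where "y = 2 ^ i * u" "odd u" by blast
      with y show ?thesis by (intro exI[of _ "Suc i"] exI[of _ u]) simp
    qed
  qed
  then show ?thesis using that by blast
qed

text \<open>
  A congruence modulo \<open>2 ^ Suc i\<close> determines whether \<open>i\<close> is the exact exponent of 2.
\<close>

lemma exponent_congruent:
  fixes y :: int
  assumes y: "y \<in> int ` exponents D" and dvd: "2 ^ Suc i dvd y - 2 ^ i * u" and u: "odd u"
  obtains m where "prod_encode (i, m) \<in> D" "y = 2 ^ i * (4 * int m + 1)"
proof -
  obtain s where "y - 2 ^ i * u = 2 ^ Suc i * s" using dvd by (elim dvdE)
  then have ys: "y = 2 ^ i * (u + 2 * s)" by (simp add: algebra_simps)
  have "u + 2 * s \<noteq> 0" using u by presburger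
  with ys have "y \<noteq> 0" by simp
  then obtain j m where jm: "prod_encode (j, m) \<in> D" "y = 2 ^ j * (4 * int m + 1)"
    using y by (auto simp: exponents_def distrib_left)
  then have "j = i"
    using odd_part_unique[of j "4 * int m + 1" i "u + 2 * s"] ys u by simp
  then show ?thesis using that jm by blast
qed

text \<open>
  The set of exponents is closed in the profinite topology: the numbers close to \<open>x\<close> contain
  the same power of 2 as \<open>x\<close>, and for each power of 2 the set has at most one member, which a
  further congruence excludes.
\<close>

lemma exponents_closed:
  fixes x :: int
  assumes fn: "\<forall>i m m'. prod_encode (i, m) \<in> D \<longrightarrow> prod_encode (i, m') \<in> D \<longrightarrow> m = m'"
    and x: "x \<notin> int ` exponents D"
  shows "\<exists>q>0. \<forall>y. q dvd y - x \<longrightarrow> y \<notin> int ` exponents D"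
proof -
  have "x \<noteq> 0" using x by (auto simp: exponents_def image_iff)
  then obtain i u where xu: "x = 2 ^ i * u" and u: "odd u" by (rule odd_part_exists)
  show ?thesis
  proof (cases "\<exists>m. prod_encode (i, m) \<in> D")
    case False
    then show ?thesis
      by (intro exI[of _ "2 ^ Suc i"]) (metis exponent_congruent u xu zero_less_numeral zero_less_power)
  next
    case True
    then obtain m where m: "prod_encode (i, m) \<in> D" by blast
    define v where "v = 2 ^ i * (4 * int m + 1)"
    have "v = int (2 ^ i * (4 * m + 1))" by (simp add: v_def distrib_left)
    then have "v \<in> int ` exponents D" using m unfolding exponents_def by blast
    with x have "v \<noteq> x" by auto
    define q where "q = 2 ^ Suc i * (\<bar>v - x\<bar> + 1)"
    have "y \<notin> int ` exponents D" if q: "q dvd y - x" for y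
    proof
      assume y: "y \<in> int ` exponents D"
      have "2 ^ Suc i dvd y - 2 ^ i * u"
        using q unfolding q_def xu by (rule dvd_mult_left)
      then obtain m' where "prod_encode (i, m') \<in> D" "y = 2 ^ i * (4 * int m' + 1)"
        using exponent_congruent[OF y] u by blast
      with fn m have "y = v" unfolding v_def by metis
      with q have "\<bar>v - x\<bar> + 1 dvd v - x" unfolding q_def by (auto dest: dvd_mult_right)
      then have "\<bar>v - x\<bar> + 1 \<le> \<bar>v - x\<bar>"
        using \<open>v \<noteq> x\<close> dvd_imp_le_int[of "v - x" "\<bar>v - x\<bar> + 1"] by simp
      then show False by simp
    qed
    moreover have "q > 0" by (simp add: q_def)
    ultimately show ?thesis by blast
  qed
qed


section \<open>Laurent polynomials over the field with two elements\<close>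

type_synonym laurent = "int \<Rightarrow>\<^sub>0 bit"

text \<open>
  The monomial \<open>t^n\<close>.
\<close>

definition T :: "int \<Rightarrow> laurent" where "T n = Poly_Mapping.single n 1"

abbreviation keys :: "laurent \<Rightarrow> int set" where "keys \<equiv> Poly_Mapping.keys"
abbreviation coeff :: "laurent \<Rightarrow> int \<Rightarrow> bit" where "coeff \<equiv> Poly_Mapping.lookup"

\<comment> \<open>Rewriting addition of bits to an exclusive disjunction would hide the ring
  structure.\<close>
declare add_bit_eq_xor [simp del] mult_bit_eq_and [simp del]

lemma T_0 [simp]: "T 0 = 1"
  by (simp add: T_def)

lemma T_add: "T (m + n) = T m * T n"
  by (simp add: T_def mult_single)

lemma T_mult_uminus [simp]: "T n * T (- n) = 1" "T (- n) * T n = 1"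
  by (simp_all flip: T_add)

lemma coeff_T: "coeff (T n) k = of_bool (k = n)"
  by (simp add: T_def lookup_single when_def)

lemma keys_T [simp]: "keys (T n) = {n}"
  by (simp add: T_def)

lemma T_neq_0 [simp]: "T n \<noteq> 0"
  by (metis T_mult_uminus(1) mult_zero_left zero_neq_one)

lemma bit_add_self [simp]: "(b :: bit) + b = 0"
  by (cases b) auto

lemma laurent_add_self [simp]: "(f :: laurent) + f = 0"
  by (rule poly_mapping_eqI) (simp only: lookup_add bit_add_self lookup_zero)

lemma laurent_two [simp]: "(2 :: laurent) = 0"
  by (metis laurent_add_self one_add_one)

lemma laurent_uminus: "- f = (f :: laurent)"
  by (simp add: minus_unique)

lemma laurent_minus: "f - g = f + (g :: laurent)"
  by (metis diff_conv_add_uminus laurent_uminus)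

lemma laurent_minus_commute: "f - g = g - (f :: laurent)"
  by (simp add: laurent_minus add.commute)

lemma coeff_eq_1_iff: "coeff f n = 1 \<longleftrightarrow> n \<in> keys f"
  by (cases "coeff f n") (auto simp: in_keys_iff)

lemma laurent_sum_keys: "f = (\<Sum>n\<in>keys f. T n)"
proof (rule poly_mapping_eqI)
  fix k
  have "coeff (\<Sum>n\<in>keys f. T n) k = (\<Sum>n\<in>keys f. if n = k then 1 else 0)"
    unfolding lookup_sum by (rule sum.cong) (auto simp: coeff_T)
  also have "\<dots> = (if k \<in> keys f then 1 else 0)" by simp
  also have "\<dots> = coeff f k" using coeff_eq_1_iff[of f k] by (simp add: in_keys_iff)
  finally show "coeff f k = coeff (\<Sum>n\<in>keys f. T n) k" by simp
qed

lemma laurent_induct [case_names 0 add]: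
  assumes "P 0" "\<And>f n. P f \<Longrightarrow> P (f + T n)"
  shows "P f"
proof -
  have "P (\<Sum>n\<in>A. T n)" if "finite A" for A
    using that
  proof (induction A)
    case (insert n A)
    then show ?case using assms(2)[of "sum T A" n] by (simp add: add.commute)
  qed (simp add: assms(1))
  from this[of "keys f"] show ?thesis using laurent_sum_keys[of f] by simp
qed

lemma laurent_eq_iff_keys: "f = g \<longleftrightarrow> keys f = keys g"
  by (metis laurent_sum_keys)

text \<open>
  The sum of the coefficients at the exponents in \<open>S\<close>. If \<open>S\<close> is a residue class modulo \<open>q\<close>,
  this functional vanishes on the multiples of \<open>t^q - 1\<close>, and it serves to show that a
  polynomial is not such a multiple.
\<close>

definition csum :: "int set \<Rightarrow> laurent \<Rightarrow> bit" where
  "csum S f = (\<Sum>n\<in>keys f. coeff f n * of_bool (n \<in> S))"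

lemma csum_superset:
  assumes "finite A" "keys f \<subseteq> A"
  shows "csum S f = (\<Sum>n\<in>A. coeff f n * of_bool (n \<in> S))"
  unfolding csum_def by (rule sum.mono_neutral_left) (use assms in \<open>auto simp: in_keys_iff\<close>)

lemma csum_add: "csum S (f + g) = csum S f + csum S g"
proof -
  let ?A = "keys f \<union> keys g"
  have eq: "csum S h = (\<Sum>n\<in>?A. coeff h n * of_bool (n \<in> S))" if "keys h \<subseteq> ?A" for h
    by (rule csum_superset) (use that in auto)
  have "csum S (f + g) = (\<Sum>n\<in>?A. coeff f n * of_bool (n \<in> S) + coeff g n * of_bool (n \<in> S))"
    unfolding eq[OF keys_add] lookup_add distrib_right ..
  also have "\<dots> = csum S f + csum S g"
    unfolding sum.distrib eq[of f, OF Un_upper1] eq[of g, OF Un_upper2] ..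
  finally show ?thesis .
qed

lemma csum_T: "csum S (T n) = of_bool (n \<in> S)"
  by (simp add: csum_def coeff_T)

lemma csum_0 [simp]: "csum S 0 = 0"
  by (simp add: csum_def)

lemma csum_periodic:
  assumes "\<And>n. n + q \<in> S \<longleftrightarrow> n \<in> S" "T q - 1 dvd f"
  shows "csum S f = 0"
proof -
  have "csum S (T q * g) = csum S g" for g
  proof (induction g rule: laurent_induct)
    case (add g n)
    then show ?case using assms(1)[of n]
      by (simp add: distrib_left csum_add csum_T add.commute flip: T_add)
  qed simp
  then have "csum S ((T q - 1) * g) = 0" for g
    by (simp add: laurent_minus distrib_right csum_add)
  then show ?thesis using assms(2) by (auto elim: dvdE)
qed

lemma csum_eq_0: "(\<And>n. n \<in> keys f \<Longrightarrow> n \<notin> S) \<Longrightarrow> csum S f = 0"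
  unfolding csum_def by (rule sum.neutral) auto

lemma csum_eq_1:
  assumes "d \<in> keys f" "\<And>n. n \<in> keys f \<Longrightarrow> n \<in> S \<longleftrightarrow> n = d"
  shows "csum S f = 1"
proof -
  have "csum S f = (\<Sum>n\<in>keys f. if n = d then coeff f n else 0)"
    unfolding csum_def by (rule sum.cong) (use assms in auto)
  also have "\<dots> = 1" using assms(1) by (simp add: coeff_eq_1_iff)
  finally show ?thesis .
qed

text \<open>
  For large \<open>q\<close> no other exponent of \<open>f\<close> is congruent to \<open>d\<close> modulo \<open>q\<close>.
\<close>

lemma residue_isolates:
  assumes d: "d \<in> keys f" and q: "q > (\<Sum>n\<in>keys f. \<bar>n - d\<bar>)"
  shows "csum {n. q dvd n - d} f = 1"
proof (rule csum_eq_1[OF d])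
  fix n assume n: "n \<in> keys f"
  have "\<bar>n - d\<bar> \<le> (\<Sum>n\<in>keys f. \<bar>n - d\<bar>)" by (rule member_le_sum) (use n in auto)
  with q have "\<bar>n - d\<bar> < q" by simp
  then show "n \<in> {n. q dvd n - d} \<longleftrightarrow> n = d"
    using dvd_imp_le_int[of "n - d" q] by auto
qed

lemma csum_residue_dvd:
  assumes "T q - 1 dvd f" shows "csum {n. q dvd n - d} f = 0"
proof (rule csum_periodic[OF _ assms])
  fix n
  have "n + q - d = (n - d) + q" by simp
  then show "n + q \<in> {n. q dvd n - d} \<longleftrightarrow> n \<in> {n. q dvd n - d}"
    by (simp only: mem_Collect_eq dvd_add_left_iff dvd_refl)
qed

lemma nonzero_not_dvd:
  assumes "f \<noteq> 0" shows "\<exists>N. \<forall>q>N. \<not> T q - 1 dvd f"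
proof -
  obtain d where "d \<in> keys f" using assms by (metis all_not_in_conv keys_eq_empty)
  then show ?thesis
    by (intro exI[of _ "\<Sum>n\<in>keys f. \<bar>n - d\<bar>"]) (metis residue_isolates csum_residue_dvd zero_neq_one)
qed

lemma T_minus_1_dvd:
  assumes "q dvd k" shows "T q - 1 dvd T k - 1"
proof -
  have nat: "T q - 1 dvd T (q * int s) - 1" for s
  proof (induction s)
    case (Suc s)
    have "T (q * int (Suc s)) - 1 = T (q * int s) * (T q - 1) + (T (q * int s) - 1)"
      by (simp add: distrib_left T_add algebra_simps)
    then show ?case using Suc by (metis dvd_add dvd_triv_right)
  qed simp
  obtain s where s: "k = q * s" using assms by (elim dvdE)
  show ?thesis
  proof (cases "s \<ge> 0")
    case True
    then show ?thesis using nat[of "nat s"] s by simp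
  next
    case False
    then have "- k = q * int (nat (- s))" using s by simp
    with nat[of "nat (- s)"] have "T q - 1 dvd T (- k) - 1" by metis
    moreover have "T k - 1 = - T k * (T (- k) - 1)"
      by (simp add: right_diff_distrib)
    ultimately show ?thesis by (metis dvd_mult)
  qed
qed

lemma T_minus_1_neq_0: "k \<noteq> 0 \<Longrightarrow> T k - 1 \<noteq> 0"
  by (metis T_0 eq_iff_diff_eq_0 keys_T singleton_inject)

lemma exists_reduced:
  assumes "q > 0" shows "\<exists>g. keys g \<subseteq> {0..<q} \<and> T q - 1 dvd f - g"
proof (induction f rule: laurent_induct)
  case 0
  then show ?case by (intro exI[of _ 0]) simp
next
  case (add f n)
  then obtain g where g: "keys g \<subseteq> {0..<q}" "T q - 1 dvd f - g" by blast
  have "q dvd n - n mod q" by (rule dvd_minus_mod)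
  then have "T q - 1 dvd T (n mod q) * (T (n - n mod q) - 1)"
    by (intro dvd_mult T_minus_1_dvd)
  also have "\<dots> = T n - T (n mod q)" by (simp add: right_diff_distrib flip: T_add)
  finally have "T q - 1 dvd (f - g) + (T n - T (n mod q))" using g(2) by (rule dvd_add[rotated])
  moreover have "keys (g + T (n mod q)) \<subseteq> {0..<q}"
    using keys_add[of g "T (n mod q)"] g(1) assms by auto
  ultimately show ?case by (intro exI[of _ "g + T (n mod q)"]) (simp add: algebra_simps)
qed

lemma finite_keys_subset: "finite A \<Longrightarrow> finite {f. keys f \<subseteq> A}"
  by (rule finite_imageD[of keys], rule finite_subset[of _ "Pow A"])
     (auto simp: inj_on_def laurent_eq_iff_keys)

definition residue_set :: "laurent \<Rightarrow> laurent \<Rightarrow> laurent set" where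
  "residue_set e f = {g. e dvd f - g}"

lemma residue_set_eq_iff: "residue_set e f = residue_set e g \<longleftrightarrow> e dvd f - g"
proof
  assume "residue_set e f = residue_set e g"
  moreover have "g \<in> residue_set e g" by (simp add: residue_set_def)
  ultimately show "e dvd f - g" by (metis mem_Collect_eq residue_set_def)
next
  assume *: "e dvd f - g"
  have "e dvd f - h \<longleftrightarrow> e dvd g - h" for h
  proof -
    have "f - h = (f - g) + (g - h)" by simp
    then show ?thesis using dvd_add_right_iff[OF *, of "g - h"] by metis
  qed
  then show "residue_set e f = residue_set e g" by (simp add: residue_set_def)
qed

lemma finite_residue_sets:
  assumes "q > 0" shows "finite (range (residue_set (T q - 1)))"
proof (rule finite_subset)
  show "range (residue_set (T q - 1)) \<subseteq> residue_set (T q - 1) ` {g. keys g \<subseteq> {0..<q}}"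
    using exists_reduced[OF assms] residue_set_eq_iff by blast
qed (simp add: finite_keys_subset)

text \<open>
  Modulo \<open>f\<close>, every high power of \<open>t\<close> is congruent to a polynomial whose exponents lie between
  the lowest exponent \<open>l\<close> and below the highest exponent \<open>u\<close> of \<open>f\<close>. There are only finitely
  many of these, so two powers of \<open>t\<close> are congruent, and \<open>t\<close> is a unit.
\<close>

lemma dvd_T_minus_1:
  assumes "f \<noteq> 0" shows "\<exists>q>0. f dvd T q - 1"
proof -
  have ne: "keys f \<noteq> {}" using assms by simp
  define l u where "l = Min (keys f)" and "u = Max (keys f)"
  have lu: "l \<in> keys f" "u \<in> keys f" "keys f \<subseteq> {l..u}"
    using ne by (auto simp: l_def u_def)
  have step: "\<exists>s. keys s \<subseteq> {l..<u} \<and> f dvd h - s" if h: "keys h \<subseteq> {l..u}" for h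
  proof (cases "u \<in> keys h")
    case True
    have "keys (h - f) \<subseteq> {l..u}" using keys_add[of h f] h lu(3) by (auto simp: laurent_minus)
    moreover have "coeff (h - f) u = 0"
      using True lu(2) coeff_eq_1_iff[of h u] coeff_eq_1_iff[of f u] by (simp add: lookup_minus)
    then have "u \<notin> keys (h - f)" by (simp add: in_keys_iff)
    moreover have "{l..<u} = {l..u} - {u}" by auto
    ultimately have "keys (h - f) \<subseteq> {l..<u}" by blast
    then show ?thesis by (intro exI[of _ "h - f"]) simp
  next
    case False
    moreover have "{l..<u} = {l..u} - {u}" by auto
    ultimately have "keys h \<subseteq> {l..<u}" using h by blast
    then show ?thesis by (intro exI[of _ h]) simp
  qed
  have "\<exists>r. keys r \<subseteq> {l..<u} \<and> f dvd T (l + int n) - r" for n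
  proof (induction n)
    case 0
    show ?case using step[of "T l"] lu by force
  next
    case (Suc n)
    then obtain r where r: "keys r \<subseteq> {l..<u}" "f dvd T (l + int n) - r" by blast
    have "keys (T 1 * r) \<subseteq> {l..u}"
      using keys_mult[of "T 1" r] r(1) by force
    then obtain s where s: "keys s \<subseteq> {l..<u}" "f dvd T 1 * r - s" using step by blast
    have "T (l + int (Suc n)) - s = T 1 * (T (l + int n) - r) + (T 1 * r - s)"
      by (simp add: algebra_simps flip: T_add)
    then show ?case using s r(2) by (metis dvd_add dvd_mult)
  qed
  then obtain r where r: "\<And>n. keys (r n) \<subseteq> {l..<u}" "\<And>n. f dvd T (l + int n) - r n" by metis
  have "\<not> inj r"
  proof
    assume "inj r"
    then have "infinite (range r)" by (simp add: finite_image_iff)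
    moreover have "range r \<subseteq> {g. keys g \<subseteq> {l..<u}}" using r(1) by auto
    ultimately show False using finite_keys_subset[of "{l..<u}"] finite_subset by auto
  qed
  then obtain a b where ab: "r a = r b" "a < b"
    by (metis injI linorder_neqE_nat)
  have "f dvd (T (l + int b) - r b) - (T (l + int a) - r a)" by (rule dvd_diff[OF r(2) r(2)])
  also have "\<dots> = T (l + int b) - T (l + int a)" using ab by simp
  finally have "f dvd T (- (l + int a)) * (T (l + int b) - T (l + int a))" by (rule dvd_mult)
  also have "\<dots> = T (int b - int a) - 1" by (simp add: right_diff_distrib flip: T_add)
  finally show ?thesis using ab(2) by (intro exI[of _ "int b - int a"]) auto
qed

lemma T_square_minus_1: "T (2 * n) - 1 = (T n - 1) * (T n - 1)"
proof -
  have "T (2 * n) = T n * T n" by (simp flip: T_add)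
  then show ?thesis by (simp add: laurent_minus distrib_left distrib_right add.assoc flip: mult_2_right)
qed

text \<open>
  In characteristic 2, \<open>t^(2kQ) - 1\<close> is the square of \<open>t^(kQ) - 1\<close>. Cancelling \<open>t^k - 1\<close>
  against one factor leaves the other one, which is a multiple of \<open>t^Q - 1\<close>.
\<close>

lemma cofactor_dvd:
  assumes "k \<noteq> 0" "T (2 * k * Q) - 1 dvd (T k - 1) * c"
  shows "T Q - 1 dvd c"
proof -
  obtain s where s: "(T k - 1) * c = (T (2 * k * Q) - 1) * s" using assms(2) by (elim dvdE)
  obtain a where a: "T (k * Q) - 1 = (T k - 1) * a" using T_minus_1_dvd[of k "k * Q"] by (auto elim: dvdE)
  obtain b where b: "T (k * Q) - 1 = (T Q - 1) * b" using T_minus_1_dvd[of Q "k * Q"] by (auto elim: dvdE)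
  have "(T k - 1) * c = (T (k * Q) - 1) * (T (k * Q) - 1) * s"
    unfolding s mult.assoc[of 2] T_square_minus_1 ..
  also have "\<dots> = ((T k - 1) * a) * ((T Q - 1) * b) * s" by (simp only: a[symmetric] b[symmetric])
  also have "\<dots> = (T k - 1) * ((T Q - 1) * (a * b * s))" by (simp only: ac_simps)
  finally have "(T k - 1) * c = (T k - 1) * ((T Q - 1) * (a * b * s))" .
  then have "c = (T Q - 1) * (a * b * s)" using T_minus_1_neq_0[OF assms(1)] by simp
  then show ?thesis by simp
qed

text \<open>
  The span of the monomials with exponents in \<open>K\<close>.
\<close>

definition supported_on :: "nat set \<Rightarrow> laurent set" where
  "supported_on K = {f. keys f \<subseteq> int ` K}"

text \<open>
  Closedness of the set of exponents carries over to its span: a residue class that isolates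
  an exponent of \<open>y\<close> outside the set from the other exponents of \<open>y\<close> and from the set gives a
  functional with value 1 on \<open>y\<close> and 0 on the span and on the multiples of \<open>t^q - 1\<close>.
\<close>

lemma supported_on_closed:
  assumes fn: "\<forall>i m m'. prod_encode (i, m) \<in> D \<longrightarrow> prod_encode (i, m') \<in> D \<longrightarrow> m = m'"
    and y: "y \<notin> supported_on (exponents D)"
  shows "\<exists>q>0. \<forall>z\<in>supported_on (exponents D). \<not> T q - 1 dvd y - z"
proof -
  obtain d where d: "d \<in> keys y" "d \<notin> int ` exponents D" using y by (auto simp: supported_on_def)
  obtain p where p: "p > 0" "\<And>n. p dvd n - d \<Longrightarrow> n \<notin> int ` exponents D"
    using exponents_closed[OF fn d(2)] by blast
  define N where "N = (\<Sum>n\<in>keys y. \<bar>n - d\<bar>)"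
  define q where "q = p * (N + 1)"
  have "N \<ge> 0" by (simp add: N_def sum_nonneg)
  have "q \<ge> 1 * (N + 1)" unfolding q_def by (rule mult_right_mono) (use p \<open>N \<ge> 0\<close> in auto)
  then have qN: "q > N" by simp
  have y1: "csum {n. q dvd n - d} y = 1"
    using residue_isolates[OF d(1)] qN by (simp add: N_def)
  have "\<not> T q - 1 dvd y - z" if z: "z \<in> supported_on (exponents D)" for z
  proof
    assume "T q - 1 dvd y - z"
    then have "csum {n. q dvd n - d} (y - z) = 0" by (rule csum_residue_dvd)
    moreover have "csum {n. q dvd n - d} z = 0"
    proof (rule csum_eq_0)
      fix n assume "n \<in> keys z"
      then have "n \<in> int ` exponents D" using z by (auto simp: supported_on_def)
      then show "n \<notin> {n. q dvd n - d}" using p(2) by (auto simp: q_def dest: dvd_mult_left)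
    qed
    ultimately show False using y1 by (simp add: laurent_minus csum_add)
  qed
  moreover have "q > 0" using qN \<open>N \<ge> 0\<close> by simp
  ultimately show ?thesis by blast
qed

text \<open>
  The functional of the residue class of \<open>2 ^ i\<close> modulo \<open>2 ^ Suc i\<close>, the numbers with exact
  exponent \<open>i\<close> of 2, decides the membership of \<open>t^(2^i)\<close>.
\<close>

lemma monomial_mem_iff:
  "(\<exists>z\<in>supported_on (exponents D). T (2 ^ Suc i) - 1 dvd T (2 ^ i) - z) \<longleftrightarrow>
    (\<exists>m. prod_encode (i, m) \<in> D)"
proof
  assume "\<exists>z\<in>supported_on (exponents D). T (2 ^ Suc i) - 1 dvd T (2 ^ i) - z"
  then obtain z where z: "z \<in> supported_on (exponents D)" "T (2 ^ Suc i) - 1 dvd T (2 ^ i) - z" by blast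
  let ?S = "{n. 2 ^ Suc i dvd n - 2 ^ i} :: int set"
  have "csum ?S (T (2 ^ i) - z) = 0" using z(2) by (rule csum_residue_dvd)
  moreover have "csum ?S (T (2 ^ i)) = 1" by (simp add: csum_T)
  ultimately have "csum ?S z \<noteq> 0"
    unfolding laurent_minus csum_add by (metis add.right_neutral zero_neq_one)
  then obtain n where n: "n \<in> keys z" "n \<in> ?S" using csum_eq_0[of z ?S] by blast
  then have "n \<in> int ` exponents D" using z(1) by (auto simp: supported_on_def)
  then show "\<exists>m. prod_encode (i, m) \<in> D"
    by (rule exponent_congruent[where u = 1 and i = i]) (use n in \<open>auto simp del: power_Suc\<close>)
next
  assume "\<exists>m. prod_encode (i, m) \<in> D"
  then obtain m where "prod_encode (i, m) \<in> D" by blast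
  then have "2 ^ i * (4 * m + 1) \<in> exponents D" by (auto simp: exponents_def)
  then have "int (2 ^ i * (4 * m + 1)) \<in> int ` exponents D" by (rule imageI)
  then have 1: "T (2 ^ i * (4 * int m + 1)) \<in> supported_on (exponents D)"
    by (simp add: supported_on_def distrib_left add.commute)
  have "2 ^ i * (4 * int m + 1) = 2 ^ i + 2 ^ Suc i * (2 * int m)" by (simp add: algebra_simps)
  then have "T (2 ^ i * (4 * int m + 1)) - T (2 ^ i) = T (2 ^ i) * (T (2 ^ Suc i * (2 * int m)) - 1)"
    by (simp add: right_diff_distrib flip: T_add)
  moreover have "T (2 ^ Suc i) - 1 dvd T (2 ^ Suc i * (2 * int m)) - 1" by (rule T_minus_1_dvd) simp
  ultimately have "T (2 ^ Suc i) - 1 dvd T (2 ^ i * (4 * int m + 1)) - T (2 ^ i)" by simp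
  then have "T (2 ^ Suc i) - 1 dvd T (2 ^ i) - T (2 ^ i * (4 * int m + 1))" by (subst laurent_minus_commute)
  with 1 show "\<exists>z\<in>supported_on (exponents D). T (2 ^ Suc i) - 1 dvd T (2 ^ i) - z" by blast
qed


section \<open>Homomorphic images, words and presentations\<close>

text \<open>
  Quotients are represented by maps whose fibres are the classes of a congruence. With values
  in the natural numbers this gives quotient groups on natural numbers without a detour
  through cosets.
\<close>

definition image_monoid :: "('a \<Rightarrow> 'b) \<Rightarrow> ('a, 'c) monoid_scheme \<Rightarrow> 'b monoid" where
  "image_monoid F G = \<lparr>carrier = F ` carrier G,
     mult = (\<lambda>x y. F (inv_into (carrier G) F x \<otimes>\<^bsub>G\<^esub> inv_into (carrier G) F y)),
     one = F \<one>\<^bsub>G\<^esub>\<rparr>"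

definition respects_mult :: "('a, 'c) monoid_scheme \<Rightarrow> ('a \<Rightarrow> 'b) \<Rightarrow> bool" where
  "respects_mult G F \<longleftrightarrow>
     (\<forall>x\<in>carrier G. \<forall>x'\<in>carrier G. \<forall>y\<in>carrier G. \<forall>y'\<in>carrier G.
        F x = F x' \<longrightarrow> F y = F y' \<longrightarrow> F (x \<otimes>\<^bsub>G\<^esub> y) = F (x' \<otimes>\<^bsub>G\<^esub> y'))"

lemma (in group) image_monoid_mult:
  assumes compat: "respects_mult G F"
    and "x \<in> carrier G" "y \<in> carrier G"
  shows "F x \<otimes>\<^bsub>image_monoid F G\<^esub> F y = F (x \<otimes> y)"
proof -
  let ?r = "inv_into (carrier G) F"
  have "?r (F x) \<in> carrier G" "F (?r (F x)) = F x" "?r (F y) \<in> carrier G" "F (?r (F y)) = F y"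
    using assms(2,3) by (auto intro: inv_into_into f_inv_into_f)
  then have "F (?r (F x) \<otimes> ?r (F y)) = F (x \<otimes> y)"
    using compat assms(2,3) unfolding respects_mult_def by blast
  then show ?thesis by (simp add: image_monoid_def)
qed

lemma (in group) image_monoid:
  assumes compat: "respects_mult G F"
  shows "group (image_monoid F G)" "F \<in> epi G (image_monoid F G)"
proof -
  note mult = image_monoid_mult[OF compat]
  have carrier: "carrier (image_monoid F G) = F ` carrier G" and one: "\<one>\<^bsub>image_monoid F G\<^esub> = F \<one>"
    by (simp_all add: image_monoid_def)
  show "group (image_monoid F G)"
  proof (rule groupI)
    fix x y z
    assume "x \<in> carrier (image_monoid F G)" "y \<in> carrier (image_monoid F G)" "z \<in> carrier (image_monoid F G)"
    then show "x \<otimes>\<^bsub>image_monoid F G\<^esub> y \<otimes>\<^bsub>image_monoid F G\<^esub> z =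
        x \<otimes>\<^bsub>image_monoid F G\<^esub> (y \<otimes>\<^bsub>image_monoid F G\<^esub> z)"
      unfolding carrier by (auto simp: mult m_assoc)
  next
    fix x assume "x \<in> carrier (image_monoid F G)"
    then obtain x' where "x = F x'" "x' \<in> carrier G" unfolding carrier by blast
    then show "\<exists>y\<in>carrier (image_monoid F G). y \<otimes>\<^bsub>image_monoid F G\<^esub> x = \<one>\<^bsub>image_monoid F G\<^esub>"
      unfolding carrier one by (intro bexI[of _ "F (inv x')"]) (auto simp: mult)
  qed (auto simp: carrier one mult)
  show "F \<in> epi G (image_monoid F G)"
    by (auto simp: epi_def hom_def carrier mult)
qed

text \<open>
  An equation between two products is easier to evaluate in coordinates than one with
  inverses.
\<close>

lemma (in group) conjugate_in_iff:
  assumes "x \<in> carrier G" "y \<in> carrier G"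
  shows "conjugate_in G x y \<longleftrightarrow> (\<exists>h\<in>carrier G. y \<otimes> h = h \<otimes> x)"
  unfolding conjugate_in_def using assms
  by (metis inv_solve_right m_closed)

lemma (in group) word_value_closed:
  assumes "set gs \<subseteq> carrier G" "w \<in> words_over {..<length gs}"
  shows "word_value G gs w \<in> carrier G"
  using assms(2)
proof (induction w)
  case (Cons l w)
  then have l: "fst l < length gs" and "word_value G gs w \<in> carrier G"
    by (auto simp: words_over_def)
  moreover have "gs ! fst l \<in> carrier G" using l assms(1) by (metis nth_mem subsetD)
  ultimately show ?case by (cases l) auto
qed simp

lemma words_over_append:
  "u @ v \<in> words_over X \<longleftrightarrow> u \<in> words_over X \<and> v \<in> words_over X"
  by (auto simp: words_over_def)

lemma words_over_Cons:
  "l # v \<in> words_over X \<longleftrightarrow> fst l \<in> X \<and> v \<in> words_over X"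
  by (cases l) (auto simp: words_over_def)

lemma words_over_Nil: "[] \<in> words_over X"
  by (simp add: words_over_def)

lemma (in group) word_value_append:
  assumes "set gs \<subseteq> carrier G" "u \<in> words_over {..<length gs}" "v \<in> words_over {..<length gs}"
  shows "word_value G gs (u @ v) = word_value G gs u \<otimes> word_value G gs v"
  using assms(2)
proof (induction u)
  case Nil
  then show ?case using word_value_closed[OF assms(1,3)] by simp
next
  case (Cons l u)
  then have l: "fst l < length gs" and u: "u \<in> words_over {..<length gs}"
    by (auto simp: words_over_Cons)
  moreover have "gs ! fst l \<in> carrier G" using l assms(1) by (metis nth_mem subsetD)
  ultimately show ?case
    using Cons.IH word_value_closed[OF assms(1,3)] word_value_closed[OF assms(1) u]
    by (cases l) (auto simp: m_assoc)
qed

definition inverse_word :: "gword \<Rightarrow> gword" where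
  "inverse_word w = rev (map (\<lambda>(x, b). (x, \<not> b)) w)"

lemma inverse_word_over: "w \<in> words_over X \<Longrightarrow> inverse_word w \<in> words_over X"
  by (auto simp: words_over_def inverse_word_def)

lemma (in group) word_value_inverse:
  assumes "set gs \<subseteq> carrier G" "w \<in> words_over {..<length gs}"
  shows "word_value G gs (inverse_word w) = inv (word_value G gs w)"
  using assms(2)
proof (induction w)
  case Nil
  then show ?case by (simp add: inverse_word_def)
next
  case (Cons l w)
  obtain x b where l: "l = (x, b)" by (cases l)
  from Cons.prems have x: "x < length gs" and w: "w \<in> words_over {..<length gs}"
    by (auto simp: words_over_Cons l)
  have gx: "gs ! x \<in> carrier G" using x assms(1) by (metis nth_mem subsetD)
  have "word_value G gs (inverse_word (l # w)) =
      word_value G gs (inverse_word w) \<otimes> word_value G gs [(x, \<not> b)]"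
    using word_value_append[OF assms(1) inverse_word_over[OF w], of "[(x, \<not> b)]"] x
    by (simp add: l inverse_word_def words_over_Cons words_over_Nil)
  then show ?case
    using Cons.IH[OF w] word_value_closed[OF assms(1) w] gx
    by (auto simp: l inv_mult_group)
qed

lemma (in group) word_value_surj:
  assumes gen: "generating_list G gs"
  shows "word_value G gs ` words_over {..<length gs} = carrier G"
proof
  have sub: "set gs \<subseteq> carrier G" using gen by (simp add: generating_list_def)
  show "word_value G gs ` words_over {..<length gs} \<subseteq> carrier G"
    using word_value_closed[OF sub] by blast
  show "carrier G \<subseteq> word_value G gs ` words_over {..<length gs}"
  proof
    fix x assume "x \<in> carrier G"
    then have "x \<in> generate G (set gs)" using gen by (simp add: generating_list_def)
    then show "x \<in> word_value G gs ` words_over {..<length gs}"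
    proof induction
      case one
      then show ?case by (rule image_eqI[of _ _ "[]"]) (auto simp: words_over_Nil)
    next
      case (incl h)
      then obtain i where "i < length gs" "h = gs ! i" by (auto simp: in_set_conv_nth)
      moreover have "h \<in> carrier G" using incl sub by blast
      ultimately show ?case
        by (intro image_eqI[of _ _ "[(i, True)]"]) (auto simp: words_over_Cons words_over_Nil)
    next
      case (inv h)
      then obtain i where "i < length gs" "h = gs ! i" by (auto simp: in_set_conv_nth)
      moreover have "h \<in> carrier G" using inv sub by blast
      ultimately show ?case
        by (intro image_eqI[of _ _ "[(i, False)]"]) (auto simp: words_over_Cons words_over_Nil)
    next
      case (eng h1 h2)
      then obtain u v where "u \<in> words_over {..<length gs}" "v \<in> words_over {..<length gs}"
        "h1 = word_value G gs u" "h2 = word_value G gs v" by blast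
      then show ?case using word_value_append[OF sub]
        by (intro image_eqI[of _ _ "u @ v"]) (auto simp: words_over_append)
    qed
  qed
qed

text \<open>
  If \<open>u\<close> and \<open>v\<close> have the same value and \<open>v'\<close> is the inverse word of \<open>v\<close>, then \<open>u v'\<close> and
  \<open>v' v\<close> are relators, and \<open>u\<close>, \<open>u v' v\<close>, \<open>v\<close> are related in turn.
\<close>

lemma (in group) pres_rel_trivial_words:
  assumes sub: "set gs \<subseteq> carrier G"
    and X: "X = {..<length gs}" and R: "R = {w \<in> words_over X. word_value G gs w = \<one>}"
  shows "(u, v) \<in> pres_rel X R \<longleftrightarrow>
    u \<in> words_over X \<and> v \<in> words_over X \<and> word_value G gs u = word_value G gs v"
proof
  note val = word_value_append[OF sub, folded X] and closed = word_value_closed[OF sub, folded X]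
  assume "(u, v) \<in> pres_rel X R"
  then show "u \<in> words_over X \<and> v \<in> words_over X \<and> word_value G gs u = word_value G gs v"
  proof induction
    case (cancel u v x b)
    then have "gs ! x \<in> carrier G" using sub X by (auto intro: nth_mem)
    then have "word_value G gs [(x, b), (x, \<not> b)] = \<one>" by simp
    moreover have "[(x, b), (x, \<not> b)] \<in> words_over X" using cancel by (simp add: words_over_Cons words_over_Nil)
    ultimately show ?case using cancel val closed by (simp add: words_over_append del: append_Cons)
  next
    case (relator u v r)
    then show ?case using val closed by (simp add: words_over_append R)
  qed auto
next
  note val = word_value_append[OF sub, folded X] and closed = word_value_closed[OF sub, folded X]
  assume uv: "u \<in> words_over X \<and> v \<in> words_over X \<and> word_value G gs u = word_value G gs v"
  let ?i = "inverse_word v"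
  have i: "?i \<in> words_over X" using uv inverse_word_over by blast
  have vi: "word_value G gs ?i = inv (word_value G gs v)"
    using word_value_inverse[OF sub] uv X by blast
  have "?i @ v \<in> R" "u @ ?i \<in> R" using uv i vi val closed by (auto simp: R words_over_append)
  then have "(u @ (?i @ v) @ [], u @ []) \<in> pres_rel X R" "([] @ (u @ ?i) @ v, [] @ v) \<in> pres_rel X R"
    using uv i by (auto intro!: pres_rel.relator simp: words_over_append words_over_Nil simp del: append_Nil append_Nil2 append_assoc)
  then show "(u, v) \<in> pres_rel X R" by (auto intro: pres_rel.sym pres_rel.trans)
qed

lemma decidable_lessThan: "decidable {..<n}"
  unfolding decidable_iff_computable_pred lessThan_iff
  by (intro computable_pred_intros computable_intros) simp

text \<open>
  All trivial words are taken as relators. An element corresponds to the set \<open>f x\<close> of the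
  words that represent it.
\<close>

theorem (in group) recursively_presented_if_solvable_word_problem:
  assumes gen: "generating_list G gs" and wp: "solvable_word_problem G gs"
  shows "recursively_presented G"
proof -
  define X where "X = {..<length gs}"
  define R where "R = {w \<in> words_over X. word_value G gs w = \<one>}"
  define P where "P = presented_group X R"
  define f where "f x = {w \<in> words_over X. word_value G gs w = x}" for x
  have sub: "set gs \<subseteq> carrier G" using gen by (simp add: generating_list_def)
  note rel = pres_rel_trivial_words[OF sub X_def R_def]
  note val = word_value_append[OF sub, folded X_def] and closed = word_value_closed[OF sub, folded X_def]
  have word: "\<exists>w\<in>words_over X. word_value G gs w = x" if "x \<in> carrier G" for x
    using that word_value_surj[OF gen] unfolding X_def[symmetric] by (metis imageE)
  have cls: "pres_rel X R `` {u} = f (word_value G gs u)" if "u \<in> words_over X" for u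
    using that by (auto simp: rel f_def)
  have carrier: "carrier P = f ` carrier G"
  proof -
    have "carrier P = (\<lambda>u. f (word_value G gs u)) ` words_over X"
      unfolding P_def presented_group_def quotient_def using cls by auto
    also have "\<dots> = f ` word_value G gs ` words_over X" by (simp only: image_image)
    finally show ?thesis using word_value_surj[OF gen] by (simp add: X_def)
  qed
  have inj: "inj_on f (carrier G)"
  proof (rule inj_onI)
    fix x y assume "x \<in> carrier G" "f x = f y"
    moreover obtain w where "w \<in> words_over X" "word_value G gs w = x" using word \<open>x \<in> carrier G\<close> by blast
    ultimately show "x = y" unfolding f_def by blast
  qed
  have hom: "f (x \<otimes> y) = f x \<otimes>\<^bsub>P\<^esub> f y" if xy: "x \<in> carrier G" "y \<in> carrier G" for x y
  proof -
    obtain u0 v0 where "u0 \<in> f x" "v0 \<in> f y" using word xy unfolding f_def by blast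
    moreover have "pres_rel X R `` {u @ v} = f (x \<otimes> y)" if "u \<in> f x" "v \<in> f y" for u v
      using that cls[of "u @ v"] val[of u v] by (simp add: f_def words_over_append)
    ultimately have "(\<Union>u\<in>f x. \<Union>v\<in>f y. pres_rel X R `` {u @ v}) = f (x \<otimes> y)" by auto
    then show ?thesis by (simp add: P_def presented_group_def)
  qed
  have "f \<in> iso G P"
    unfolding iso_def bij_betw_def hom_def using carrier inj hom by auto
  then have "G \<cong> P" unfolding is_iso_def by blast
  moreover have "recursively_enumerable (word_code ` R)"
  proof (rule decidable_imp_recursively_enumerable)
    have "word_code ` R = {word_code w | w. w \<in> words_over {..<length gs} \<and> word_value G gs w = \<one>}"
      by (auto simp: R_def X_def)
    then show "decidable (word_code ` R)" using wp unfolding solvable_word_problem_def by simp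
  qed
  moreover have "decidable X" unfolding X_def by (rule decidable_lessThan)
  moreover have "R \<subseteq> words_over X" by (auto simp: R_def)
  ultimately show ?thesis unfolding recursively_presented_def P_def by blast
qed

lemma epi_compose: "f \<in> epi G H \<Longrightarrow> g \<in> epi H K \<Longrightarrow> g \<circ> f \<in> epi G K"
  using hom_compose[of f G H g K] by (auto simp: epi_def simp flip: image_image)

text \<open>
  A finitely generated group is countable, and all properties in question are invariant under
  isomorphism.
\<close>

theorem (in group) isomorphic_nat_group:
  assumes gen: "generating_list G gs"
  obtains H :: "nat monoid" and hs where "group H" "generating_list H hs"
    "solvable_word_problem H hs \<longleftrightarrow> solvable_word_problem G gs"
    "solvable_conjugacy_problem H hs \<longleftrightarrow> solvable_conjugacy_problem G gs"
    "conjugacy_separable G \<Longrightarrow> conjugacy_separable H"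
    "solvable G \<Longrightarrow> solvable H" "derived_length H = derived_length G"
proof -
  have sub: "set gs \<subseteq> carrier G" using gen by (simp add: generating_list_def)
  have "countable (carrier G)"
    using word_value_surj[OF gen] by (metis countableI_type countable_image)
  then have inj: "inj_on (to_nat_on (carrier G)) (carrier G)" by (rule inj_on_to_nat_on)
  define F where "F = to_nat_on (carrier G)"
  define H where "H = image_monoid F G"
  note inj = inj[folded F_def]
  have compat: "respects_mult G F"
    unfolding respects_mult_def using inj by (metis inj_onD)
  have H: "group H" and F: "F \<in> epi G H"
    unfolding H_def by (rule image_monoid[OF compat])+
  interpret H: group H by (rule H)
  interpret F: group_hom G H F
    using F by (auto intro!: group_hom.intro group_axioms H simp: group_hom_axioms_def epi_def)
  have carrier: "carrier H = F ` carrier G" using F by (auto simp: epi_def)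
  have F_eq: "F x = F y \<longleftrightarrow> x = y" if "x \<in> carrier G" "y \<in> carrier G" for x y
    using that inj by (metis inj_onD)
  have F_one: "F x = \<one>\<^bsub>H\<^esub> \<longleftrightarrow> x = \<one>" if "x \<in> carrier G" for x
    using F_eq[of x \<one>] that by simp
  have conj: "conjugate_in H (F x) (F y) \<longleftrightarrow> conjugate_in G x y"
    if xy: "x \<in> carrier G" "y \<in> carrier G" for x y
  proof -
    have "F y \<otimes>\<^bsub>H\<^esub> F h = F h \<otimes>\<^bsub>H\<^esub> F x \<longleftrightarrow> y \<otimes> h = h \<otimes> x" if "h \<in> carrier G" for h
      using F_eq[of "y \<otimes> h" "h \<otimes> x"] xy that by simp
    then show ?thesis
      using xy by (simp add: conjugate_in_iff H.conjugate_in_iff carrier)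
  qed
  define hs where "hs = map F gs"
  have len: "length hs = length gs" by (simp add: hs_def)
  have val: "word_value H hs w = F (word_value G gs w)" if "w \<in> words_over {..<length gs}" for w
    using that
  proof (induction w)
    case (Cons l w)
    then have l: "fst l < length gs" and w: "w \<in> words_over {..<length gs}" by (auto simp: words_over_Cons)
    then have "gs ! fst l \<in> carrier G" using sub by (metis nth_mem subsetD)
    then show ?case using Cons.IH[OF w] word_value_closed[OF sub w] l by (cases l) (auto simp: hs_def)
  qed simp
  have "generate H (F ` set gs) = F ` generate G (set gs)"
    by (rule F.generate_img[OF sub])
  then have gen_H: "generating_list H hs"
    using gen carrier by (auto simp: generating_list_def hs_def)
  have wp: "solvable_word_problem H hs \<longleftrightarrow> solvable_word_problem G gs"
  proof -
    have "word_value H hs w = \<one>\<^bsub>H\<^esub> \<longleftrightarrow> word_value G gs w = \<one>" if "w \<in> words_over {..<length gs}" for w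
      using val[OF that] F_one word_value_closed[OF sub that] by simp
    then have "{word_code w | w. w \<in> words_over {..<length hs} \<and> word_value H hs w = \<one>\<^bsub>H\<^esub>} =
      {word_code w | w. w \<in> words_over {..<length gs} \<and> word_value G gs w = \<one>}"
      unfolding len by blast
    then show ?thesis unfolding solvable_word_problem_def by simp
  qed
  have cp: "solvable_conjugacy_problem H hs \<longleftrightarrow> solvable_conjugacy_problem G gs"
  proof -
    have "conjugate_in H (word_value H hs u) (word_value H hs v) \<longleftrightarrow>
        conjugate_in G (word_value G gs u) (word_value G gs v)"
      if "u \<in> words_over {..<length gs}" "v \<in> words_over {..<length gs}" for u v
      using val that conj word_value_closed[OF sub] by simp
    then have "{prod_encode (word_code u, word_code v) | u v.
       u \<in> words_over {..<length hs} \<and> v \<in> words_over {..<length hs} \<and>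
       conjugate_in H (word_value H hs u) (word_value H hs v)} =
      {prod_encode (word_code u, word_code v) | u v.
       u \<in> words_over {..<length gs} \<and> v \<in> words_over {..<length gs} \<and>
       conjugate_in G (word_value G gs u) (word_value G gs v)}"
      unfolding len by blast
    then show ?thesis unfolding solvable_conjugacy_problem_def by simp
  qed
  have cs: "conjugacy_separable H" if cs: "conjugacy_separable G"
    unfolding conjugacy_separable_def
  proof (intro ballI impI)
    fix x' y' assume "x' \<in> carrier H" "y' \<in> carrier H" and nc: "\<not> conjugate_in H x' y'"
    then obtain x y where xy: "x' = F x" "y' = F y" "x \<in> carrier G" "y \<in> carrier G"
      unfolding carrier by blast
    with nc conj have "\<not> conjugate_in G x y" by blast
    then obtain K :: "nat monoid" and \<phi> where K: "group K" "finite (carrier K)" "\<phi> \<in> epi G K"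
      "\<not> conjugate_in K (\<phi> x) (\<phi> y)"
      using cs xy(3,4) unfolding conjugacy_separable_def by blast
    let ?g = "inv_into (carrier G) F"
    have "F \<in> iso G H" using F inj by (auto simp: iso_def epi_def bij_betw_def)
    then have "?g \<in> iso H G" by (rule iso_set_sym)
    then have "?g \<in> epi H G" by (auto simp: iso_def epi_def bij_betw_def)
    then have "\<phi> \<circ> ?g \<in> epi H K" using K(3) by (rule epi_compose)
    moreover have "?g x' = x" "?g y' = y" using xy inj by (auto simp: inv_into_f_f)
    ultimately show "\<exists>(K :: nat monoid) \<phi>. group K \<and> finite (carrier K) \<and> \<phi> \<in> epi H K \<and>
        \<not> conjugate_in K (\<phi> x') (\<phi> y')"
      using K by (intro exI[of _ K] exI[of _ "\<phi> \<circ> ?g"]) simp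
  qed
  have dl: "derived_length H = derived_length G"
  proof -
    have "(derived H ^^ n) (carrier H) = {\<one>\<^bsub>H\<^esub>} \<longleftrightarrow> (derived G ^^ n) (carrier G) = {\<one>}" for n
    proof -
      have "(derived H ^^ n) (carrier H) = F ` ((derived G ^^ n) (carrier G))"
        unfolding carrier by (rule F.exp_of_derived_img) simp
      moreover have "(derived G ^^ n) (carrier G) \<subseteq> carrier G" by (rule exp_of_derived_in_carrier) simp
      then have "F ` ((derived G ^^ n) (carrier G)) = F ` {\<one>} \<longleftrightarrow> (derived G ^^ n) (carrier G) = {\<one>}"
        by (intro inj_on_image_eq_iff[OF inj]) auto
      ultimately show ?thesis by simp
    qed
    then show ?thesis by (simp add: derived_length_def)
  qed
  show ?thesis
    by (rule that[OF H gen_H wp cp cs F.surj_hom_imp_solvable[OF carrier[symmetric]] dl])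
qed

text \<open>
  Here \<open>F\<close> is a finite quotient map with arbitrary values, which an enumeration of its image
  turns into natural numbers.
\<close>

theorem (in group) conjugacy_separable_if_finite_images:
  assumes "\<And>x y. x \<in> carrier G \<Longrightarrow> y \<in> carrier G \<Longrightarrow> \<not> conjugate_in G x y \<Longrightarrow>
    \<exists>F :: 'a \<Rightarrow> 'c. finite (F ` carrier G) \<and>
      respects_mult G F \<and> (\<forall>h\<in>carrier G. F (y \<otimes> h) \<noteq> F (h \<otimes> x))"
  shows "conjugacy_separable G"
  unfolding conjugacy_separable_def
proof (intro ballI impI)
  fix x y assume xy: "x \<in> carrier G" "y \<in> carrier G" and "\<not> conjugate_in G x y"
  then obtain E :: "'a \<Rightarrow> 'c" where fin: "finite (E ` carrier G)"
    and compat: "respects_mult G E"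
    and sep: "\<And>h. h \<in> carrier G \<Longrightarrow> E (y \<otimes> h) \<noteq> E (h \<otimes> x)"
    using assms[OF xy] by metis
  have inj: "inj_on (to_nat_on (E ` carrier G)) (E ` carrier G)"
    using fin by (simp add: inj_on_to_nat_on countable_finite)
  define F where "F = to_nat_on (E ` carrier G) \<circ> E"
  have F_eq: "F x = F y \<longleftrightarrow> E x = E y" if "x \<in> carrier G" "y \<in> carrier G" for x y
    using that inj unfolding F_def by (auto dest: inj_onD)
  have compat': "respects_mult G F"
    using compat F_eq unfolding respects_mult_def by (metis m_closed)
  let ?H = "image_monoid F G"
  have H: "group ?H" and F: "F \<in> epi G ?H"
    by (rule image_monoid[OF compat'])+
  interpret H: group ?H by (rule H)
  have carrier: "carrier ?H = F ` carrier G" by (simp add: image_monoid_def)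
  then have "finite (carrier ?H)" using fin by (simp only: F_def image_comp[symmetric] finite_imageI)
  moreover have "\<not> conjugate_in ?H (F x) (F y)"
  proof
    assume "conjugate_in ?H (F x) (F y)"
    then obtain h where h: "h \<in> carrier G" "F y \<otimes>\<^bsub>?H\<^esub> F h = F h \<otimes>\<^bsub>?H\<^esub> F x"
      using xy by (auto simp: H.conjugate_in_iff carrier)
    then have "F (y \<otimes> h) = F (h \<otimes> x)"
      using xy by (simp add: image_monoid_mult[OF compat'])
    with sep[OF h(1)] show False using F_eq xy h(1) by simp
  qed
  ultimately show "\<exists>(H :: nat monoid) \<phi>. group H \<and> finite (carrier H) \<and> \<phi> \<in> epi G H \<and>
      \<not> conjugate_in H (\<phi> x) (\<phi> y)"
    using H F by blast
qed


section \<open>Hall groups\<close>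

text \<open>
  The normal form modulo the monomials with exponents in \<open>E\<close>.
\<close>

definition trunc :: "nat set \<Rightarrow> laurent \<Rightarrow> laurent" where
  "trunc E z = Poly_Mapping.mapp (\<lambda>k c. if k \<in> int ` E then 0 else c) z"

lemma coeff_trunc: "coeff (trunc E z) k = (if k \<in> int ` E then 0 else coeff z k)"
  by (simp add: trunc_def lookup_mapp when_def in_keys_iff)

lemma trunc_add: "trunc E (x + y) = trunc E x + trunc E y"
  by (rule poly_mapping_eqI) (simp add: coeff_trunc lookup_add)

lemma trunc_trunc [simp]: "trunc E (trunc E x) = trunc E x"
  by (rule poly_mapping_eqI) (simp add: coeff_trunc)

lemma trunc_0 [simp]: "trunc E 0 = 0"
  by (rule poly_mapping_eqI) (simp add: coeff_trunc)

lemma trunc_eq_0_iff: "trunc E x = 0 \<longleftrightarrow> x \<in> supported_on E"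
proof -
  have "trunc E x = 0 \<longleftrightarrow> (\<forall>k. k \<notin> int ` E \<longrightarrow> coeff x k = 0)"
    by (auto simp: poly_mapping_eq_iff fun_eq_iff coeff_trunc)
  also have "\<dots> \<longleftrightarrow> x \<in> supported_on E"
    by (auto simp: supported_on_def in_keys_iff subset_iff)
  finally show ?thesis .
qed

lemma trunc_diff: "trunc E (x - y) = trunc E x - trunc E y"
  by (simp add: laurent_minus trunc_add)

lemma trunc_eq_iff: "trunc E x = trunc E y \<longleftrightarrow> x - y \<in> supported_on E"
  unfolding trunc_eq_0_iff[symmetric] trunc_diff by simp

lemma trunc_minus_supported: "trunc E x - x \<in> supported_on E"
  by (simp flip: trunc_eq_iff)

lemma supported_on_0 [simp]: "0 \<in> supported_on E"
  by (simp add: supported_on_def)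

lemma supported_on_diff: "x \<in> supported_on E \<Longrightarrow> y \<in> supported_on E \<Longrightarrow> x - y \<in> supported_on E"
  by (simp add: trunc_diff flip: trunc_eq_0_iff)

type_synonym hall = "int \<times> laurent \<times> laurent \<times> laurent"

text \<open>
  The tuple \<open>(k, f, g, z)\<close> stands for the matrix with rows \<open>(1, f, z)\<close>, \<open>(0, t^k, g)\<close>,
  \<open>(0, 0, 1)\<close>, with \<open>z\<close> taken modulo the monomials with exponents in \<open>E\<close>.
\<close>

definition hall_group :: "nat set \<Rightarrow> hall monoid" where
  "hall_group E = \<lparr>carrier = {(k, f, g, z). trunc E z = z},
     mult = (\<lambda>(k, f, g, z) (k', f', g', z').
       (k + k', f' + f * T k', g + T k * g', trunc E (z + z' + f * g'))),
     one = (0, 0, 0, 0)\<rparr>"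

lemma hall_carrier: "(k, f, g, z) \<in> carrier (hall_group E) \<longleftrightarrow> trunc E z = z"
  by (simp add: hall_group_def)

lemma hall_mult: "(k, f, g, z) \<otimes>\<^bsub>hall_group E\<^esub> (k', f', g', z') =
    (k + k', f' + f * T k', g + T k * g', trunc E (z + z' + f * g'))"
  by (simp add: hall_group_def)

lemma hall_one: "\<one>\<^bsub>hall_group E\<^esub> = (0, 0, 0, 0)"
  by (simp add: hall_group_def)

lemmas hall_simps = hall_carrier hall_mult hall_one

lemma hall_mult_T: "T k * T k' = T (k + k')" "T k * (T k' * f) = T (k + k') * f"
  by (simp_all add: T_add mult.assoc)

lemma group_hall: "group (hall_group E)"
proof (rule groupI)
  fix x y w assume "x \<in> carrier (hall_group E)" "y \<in> carrier (hall_group E)" "w \<in> carrier (hall_group E)"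
  show "x \<otimes>\<^bsub>hall_group E\<^esub> y \<otimes>\<^bsub>hall_group E\<^esub> w = x \<otimes>\<^bsub>hall_group E\<^esub> (y \<otimes>\<^bsub>hall_group E\<^esub> w)"
    by (cases x, cases y, cases w)
       (simp add: hall_mult trunc_add T_add algebra_simps)
next
  fix x assume "x \<in> carrier (hall_group E)"
  then obtain k f g z where x: "x = (k, f, g, z)" "trunc E z = z" by (cases x) (auto simp: hall_carrier)
  have "(- k, - f * T (- k), - T (- k) * g, trunc E (f * T (- k) * g - z)) \<otimes>\<^bsub>hall_group E\<^esub> x =
      \<one>\<^bsub>hall_group E\<^esub>"
    by (simp add: x hall_simps trunc_add trunc_diff mult.assoc)
  then show "\<exists>y\<in>carrier (hall_group E). y \<otimes>\<^bsub>hall_group E\<^esub> x = \<one>\<^bsub>hall_group E\<^esub>"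
    by (rule bexI) (simp add: hall_carrier)
qed (auto simp: hall_simps hall_group_def)

definition hall_generators :: "hall list" where
  "hall_generators = [(0, 1, 0, 0), (0, 0, 1, 0), (1, 0, 0, 0)]"

lemma hall_generators_nth:
  "hall_generators ! 0 = (0, 1, 0, 0)" "hall_generators ! Suc 0 = (0, 0, 1, 0)"
  "hall_generators ! 2 = (1, 0, 0, 0)"
  by (simp_all add: hall_generators_def)

text \<open>
  Conjugates by powers of \<open>t\<close> of the first two generators give all monomials in the entries
  \<open>f\<close> and \<open>g\<close>. The central entry \<open>f\<close> is the quotient of the two products of \<open>(0, f, 0, 0)\<close> and
  \<open>(0, 0, 1, 0)\<close>.
\<close>

lemma generating_list_hall: "generating_list (hall_group E) hall_generators"
proof -
  interpret group "hall_group E" by (rule group_hall)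
  define S where "S = generate (hall_group E) (set hall_generators)"
  have sub: "set hall_generators \<subseteq> carrier (hall_group E)"
    by (simp add: hall_generators_def hall_carrier)
  have S: "subgroup S (hall_group E)" unfolding S_def by (rule generate_is_subgroup[OF sub])
  have mult: "x \<otimes>\<^bsub>hall_group E\<^esub> y \<in> S" if "x \<in> S" "y \<in> S" for x y
    using subgroup.m_closed[OF S that] .
  have a: "(0, 1, 0, 0) \<in> S" and b: "(0, 0, 1, 0) \<in> S" and t: "(1, 0, 0, 0) \<in> S"
    unfolding S_def by (rule generate.incl; simp add: hall_generators_def)+
  have "inv\<^bsub>hall_group E\<^esub> (1, 0, 0, 0) = (- 1, 0, 0, 0)"
    by (rule inv_equality) (simp_all add: hall_simps)
  then have t': "(- 1, 0, 0, 0) \<in> S"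
    using subgroup.m_inv_closed[OF S t] by simp
  have "(int n, 0, 0, 0) \<in> S \<and> (- int n, 0, 0, 0) \<in> S" for n
  proof (induction n)
    case 0
    then show ?case using subgroup.one_closed[OF S] by (simp add: hall_one)
  next
    case (Suc n)
    then show ?case using mult[OF t, of "(int n, 0, 0, 0)"] mult[OF t', of "(- int n, 0, 0, 0)"]
      by (simp add: hall_mult)
  qed
  then have k: "(k, 0, 0, 0) \<in> S" for k by (cases k rule: int_cases2) auto
  have f: "(0, f, 0, 0) \<in> S" for f
  proof (induction f rule: laurent_induct)
    case (add f n)
    then show ?case
      using mult[OF mult[OF mult[OF k[of "- n"] a] k[of n]] add] by (simp add: hall_mult)
  qed (rule k)
  have g: "(0, 0, g, 0) \<in> S" for g
  proof (induction g rule: laurent_induct)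
    case (add g n)
    then show ?case
      using mult[OF add mult[OF mult[OF k[of n] b] k[of "- n"]]] by (simp add: hall_mult)
  qed (rule k)
  have z: "(0, 0, 0, trunc E f) \<in> S" for f
  proof -
    let ?p = "(0, f, 1, 0)" and ?w = "(0, f, 1, trunc E f)" and ?c = "(0, 0, 0, trunc E f)"
    have p: "?p \<in> S" using mult[OF b f[of f]] by (simp add: hall_mult)
    have w: "?w \<in> S" using mult[OF f[of f] b] by (simp add: hall_mult)
    have "?w = ?p \<otimes>\<^bsub>hall_group E\<^esub> ?c" by (simp add: hall_mult)
    then have "?c = inv\<^bsub>hall_group E\<^esub> ?p \<otimes>\<^bsub>hall_group E\<^esub> ?w"
      by (subst inv_solve_left) (simp_all add: hall_carrier)
    then show ?thesis
      using mult[OF subgroup.m_inv_closed[OF S p] w] by (simp only:)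
  qed
  have "(k, f, g, w) \<in> S" if "trunc E w = w" for k f g w
    using mult[OF mult[OF mult[OF g[of g] k[of k]] f[of f]] z[of w]] that by (simp add: hall_mult)
  then have "carrier (hall_group E) \<subseteq> S" by (auto simp: hall_group_def)
  then have "S = carrier (hall_group E)" using subgroup.subset[OF S] by blast
  then show ?thesis using sub by (simp add: generating_list_def S_def)
qed


section \<open>The derived series\<close>

text \<open>
  Commutators have \<open>k = 0\<close>, and commutators of elements with \<open>k = 0\<close> are central. A commutator
  of two commutators has the central entry \<open>(t^n - t^(n+1)) (t - 1) = t^n + t^(n+2)\<close>, where
  \<open>t^n\<close> is not killed.
\<close>

lemma hall_derived:
  assumes E: "n \<notin> E"
  shows "solvable (hall_group E)" "derived_length (hall_group E) = 3"
proof -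
  let ?G = "hall_group E"
  interpret group ?G by (rule group_hall)
  \<comment> \<open>Commutators are computed by comparing the two products, without inverses.\<close>
  let ?comm = "\<lambda>x y. x \<otimes>\<^bsub>?G\<^esub> y \<otimes>\<^bsub>?G\<^esub> inv\<^bsub>?G\<^esub> x \<otimes>\<^bsub>?G\<^esub> inv\<^bsub>?G\<^esub> y"
  have comm: "?comm x y = c \<longleftrightarrow> x \<otimes>\<^bsub>?G\<^esub> y = c \<otimes>\<^bsub>?G\<^esub> (y \<otimes>\<^bsub>?G\<^esub> x)"
    if "x \<in> carrier ?G" "y \<in> carrier ?G" "c \<in> carrier ?G" for x y c
  proof -
    have "?comm x y =
        (x \<otimes>\<^bsub>?G\<^esub> y) \<otimes>\<^bsub>?G\<^esub> inv\<^bsub>?G\<^esub> (y \<otimes>\<^bsub>?G\<^esub> x)"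
      using that by (simp only: inv_mult_group m_assoc m_closed inv_closed)
    then show ?thesis
      using inv_solve_right[of c "x \<otimes>\<^bsub>?G\<^esub> y" "y \<otimes>\<^bsub>?G\<^esub> x"] that m_closed by auto
  qed
  define N :: "hall set" where "N = {(k, f, g, z). k = 0 \<and> trunc E z = z}"
  define C :: "hall set" where "C = {(k, f, g, z). k = 0 \<and> f = 0 \<and> g = 0 \<and> trunc E z = z}"
  have inv0: "inv\<^bsub>?G\<^esub> (0, f, g, z) = (0, - f, - g, trunc E (f * g - z))" if "trunc E z = z" for f g z
    by (rule inv_equality) (use that in \<open>simp_all add: hall_simps trunc_add trunc_diff\<close>)
  have ex_trunc: "\<exists>w. trunc E w = w" by (rule exI[of _ 0]) simp
  have N: "subgroup N ?G"
    by (rule subgroupI) (auto simp: N_def hall_simps inv0 ex_trunc)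
  have C: "subgroup C ?G"
    by (rule subgroupI) (auto simp: C_def hall_simps inv0 ex_trunc trunc_diff trunc_add)
  have incl: "derived ?G H \<subseteq> K"
    if "subgroup K ?G" "\<And>x y. x \<in> H \<Longrightarrow> y \<in> H \<Longrightarrow> ?comm x y \<in> K" for H K
    unfolding derived_def by (rule generate_subgroup_incl[OF _ that(1)]) (use that(2) in blast)
  have 1: "derived ?G (carrier ?G) \<subseteq> N"
  proof (rule incl[OF N])
    fix x y assume xy: "x \<in> carrier ?G" "y \<in> carrier ?G"
    obtain k f g z where c: "?comm x y = (k, f, g, z)" by (metis prod_cases4)
    have cc: "(k, f, g, z) \<in> carrier ?G" using xy unfolding c[symmetric] by simp
    have "k = 0"
      using comm[OF xy cc] c by (cases x, cases y) (simp add: hall_mult)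
    then show "?comm x y \<in> N" unfolding c using cc by (simp add: N_def hall_carrier)
  qed
  have 2: "derived ?G N \<subseteq> C"
  proof (rule incl[OF C])
    fix x y assume "x \<in> N" "y \<in> N"
    then obtain f1 g1 z1 f2 g2 z2 where x: "x = (0, f1, g1, z1)" and y: "y = (0, f2, g2, z2)"
      and xy: "x \<in> carrier ?G" "y \<in> carrier ?G"
      by (auto simp: N_def hall_carrier)
    obtain k f g z where c: "?comm x y = (k, f, g, z)" by (metis prod_cases4)
    have cc: "(k, f, g, z) \<in> carrier ?G" using xy unfolding c[symmetric] by simp
    have "k = 0 \<and> f = 0 \<and> g = 0"
      using comm[OF xy cc] c unfolding x y by (auto simp: hall_mult)
    then show "?comm x y \<in> C" unfolding c using cc by (simp add: C_def hall_carrier)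
  qed
  have 3: "derived ?G C \<subseteq> {\<one>\<^bsub>?G\<^esub>}"
  proof (rule incl[OF triv_subgroup])
    fix x y assume C: "x \<in> C" "y \<in> C"
    then have xy: "x \<in> carrier ?G" "y \<in> carrier ?G"
      by (auto simp: C_def hall_carrier)
    have "x \<otimes>\<^bsub>?G\<^esub> y = \<one>\<^bsub>?G\<^esub> \<otimes>\<^bsub>?G\<^esub> (y \<otimes>\<^bsub>?G\<^esub> x)"
      using C by (auto simp: C_def hall_simps add.commute)
    then show "?comm x y \<in> {\<one>\<^bsub>?G\<^esub>}"
      using comm[OF xy one_closed] by simp
  qed
  let ?D = "\<lambda>n. (derived ?G ^^ n) (carrier ?G)"
  have sub: "\<one>\<^bsub>?G\<^esub> \<in> ?D n" for n
    using exp_of_derived_is_subgroup[OF subgroup_self] by (rule subgroup.one_closed)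
  have "?D 3 = derived ?G (derived ?G (derived ?G (carrier ?G)))" by (simp add: numeral_3_eq_3)
  also have "\<dots> \<subseteq> derived ?G (derived ?G N)" by (intro mono_derived 1)
  also have "\<dots> \<subseteq> derived ?G C" by (intro mono_derived 2)
  also note 3
  finally have "?D 3 \<subseteq> {\<one>\<^bsub>?G\<^esub>}" .
  then have D3: "?D 3 = {\<one>\<^bsub>?G\<^esub>}" using sub[of 3] by blast
  then show "solvable ?G" unfolding solvable_iff_trivial_derived_seq by blast
  have inc: "?comm x y \<in> derived ?G H" if "x \<in> H" "y \<in> H" for x y H
    unfolding derived_def by (rule generate.incl) (use that in blast)
  have commI: "c \<in> derived ?G H"
    if "x \<otimes>\<^bsub>?G\<^esub> y = c \<otimes>\<^bsub>?G\<^esub> (y \<otimes>\<^bsub>?G\<^esub> x)" "x \<in> H" "y \<in> H"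
      "H \<subseteq> carrier ?G" "c \<in> carrier ?G" for x y c H
  proof -
    have "x \<in> carrier ?G" "y \<in> carrier ?G" using that by blast+
    then have "?comm x y = c" using comm[of x y c] that by blast
    then show ?thesis using inc[OF that(2,3)] by simp
  qed
  let ?f = "T (int n) - T (int n + 1)" and ?g = "T 1 - 1"
  have f: "(0, ?f, 0, 0) \<in> derived ?G (carrier ?G)"
    by (rule commI[of "(1, 0, 0, 0)" "(0, T (int n + 1), 0, 0)"])
       (simp_all add: hall_simps left_diff_distrib hall_mult_T)
  have g: "(0, 0, ?g, 0) \<in> derived ?G (carrier ?G)"
    by (rule commI[of "(1, 0, 0, 0)" "(0, 0, 1, 0)"]) (simp_all add: hall_simps)
  have "(0, 0, 0, trunc E (?f * ?g)) \<in> derived ?G (derived ?G (carrier ?G))"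
    by (rule commI[OF _ f g]) (simp_all add: hall_simps derived_in_carrier)
  then have mem: "(0, 0, 0, trunc E (?f * ?g)) \<in> ?D 2" by (simp add: numeral_2_eq_2)
  have "?f * ?g = T (int n) + T (int n + 2)"
    by (simp add: algebra_simps laurent_minus hall_mult_T flip: mult_2)
  then have "coeff (?f * ?g) (int n) = 1" by (simp add: lookup_add coeff_T)
  then have "trunc E (?f * ?g) \<noteq> 0"
    using E coeff_trunc[of E "?f * ?g" "int n"] by (auto simp: image_iff)
  then have D2: "?D 2 \<noteq> {\<one>\<^bsub>?G\<^esub>}" using mem by (auto simp: hall_one)
  have "?D m \<noteq> {\<one>\<^bsub>?G\<^esub>}" if "m < 3" for m
  proof
    assume m: "?D m = {\<one>\<^bsub>?G\<^esub>}"
    have triv: "derived ?G {\<one>\<^bsub>?G\<^esub>} \<subseteq> {\<one>\<^bsub>?G\<^esub>}" by (rule derived_incl[OF _ triv_subgroup]) simp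
    have "?D (k + m) \<subseteq> {\<one>\<^bsub>?G\<^esub>}" for k
    proof (induction k)
      case (Suc k)
      have "?D (Suc k + m) = derived ?G (?D (k + m))" by simp
      also have "\<dots> \<subseteq> derived ?G {\<one>\<^bsub>?G\<^esub>}" by (rule mono_derived[OF Suc])
      also note triv
      finally show ?case .
    qed (simp add: m)
    from this[of "2 - m"] have "?D 2 \<subseteq> {\<one>\<^bsub>?G\<^esub>}" using that by simp
    then show False using D2 sub[of 2] by blast
  qed
  then show "derived_length ?G = 3"
    unfolding derived_length_def using D3 by (intro Least_equality) (auto simp: not_less[symmetric])
qed


section \<open>Conjugacy separability\<close>

text \<open>
  Comparison of the entries of \<open>y h\<close> and \<open>h x\<close> for \<open>h = (j, m, m', w)\<close>.
\<close>

lemma hall_conjugate_iff: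
  assumes "trunc E z = z" "trunc E z' = z'"
  shows "conjugate_in (hall_group E) (k, f, g, z) (k', f', g', z') \<longleftrightarrow>
    k' = k \<and> (\<exists>j m m'. f' * T j - f = m * (T k - 1) \<and> g' - T j * g = m' * (1 - T k) \<and>
      z' + f' * m' - z - m * g \<in> supported_on E)"
proof -
  interpret group "hall_group E" by (rule group_hall)
  have eq: "(k', f', g', z') \<otimes>\<^bsub>hall_group E\<^esub> (j, m, m', w) =
      (j, m, m', w) \<otimes>\<^bsub>hall_group E\<^esub> (k, f, g, z) \<longleftrightarrow>
    k' = k \<and> f' * T j - f = m * (T k - 1) \<and> g' - T j * g = m' * (1 - T k) \<and>
      z' + f' * m' - z - m * g \<in> supported_on E" for j m m' w
  proof -
    have d: "(z' + w + f' * m') - (w + z + m * g) = z' + f' * m' - z - m * g" by simp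
    have f: "m + f' * T j = f + m * T k \<longleftrightarrow> f' * T j - f = m * (T k - 1)"
      by (auto simp: algebra_simps)
    have g: "g' + T k * m' = m' + T j * g \<longleftrightarrow> g' - T j * g = m' * (1 - T k)"
      by (auto simp: algebra_simps)
    show ?thesis
      unfolding hall_mult prod.inject trunc_eq_iff d f[symmetric] g[symmetric] by auto
  qed
  have ex: "(\<exists>h\<in>carrier (hall_group E). P h) \<longleftrightarrow> (\<exists>j m m' w. trunc E w = w \<and> P (j, m, m', w))" for P
    by (auto simp: hall_group_def)
  have "\<exists>w. trunc E w = w" by (rule exI[of _ 0]) simp
  then show ?thesis
    by (subst conjugate_in_iff) (auto simp: hall_carrier assms ex eq)
qed

text \<open>
  The conditions under which \<open>k\<close> modulo \<open>q\<close>, \<open>f\<close> and \<open>g\<close> modulo \<open>t^q - 1\<close>, and \<open>z\<close> modulo \<open>I\<close>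
  define a finite quotient of the group.
\<close>

definition quotient_data :: "nat set \<Rightarrow> int \<Rightarrow> laurent set \<Rightarrow> bool" where
  "quotient_data E q I \<longleftrightarrow> q > 0 \<and> (\<forall>x\<in>I. \<forall>y\<in>I. x - y \<in> I) \<and> supported_on E \<subseteq> I \<and>
     (\<forall>x. T q - 1 dvd x \<longrightarrow> x \<in> I)"

lemma quotient_data_UNIV: "q > 0 \<Longrightarrow> quotient_data E q UNIV"
  by (simp add: quotient_data_def)

lemma quotient_data_ideal:
  assumes "q > 0" "\<And>x y. x \<in> J \<Longrightarrow> y \<in> J \<Longrightarrow> x - y \<in> J" "\<And>x. T q - 1 dvd x \<Longrightarrow> x \<in> J"
  shows "quotient_data E q {y. \<exists>s\<in>supported_on E. y - s \<in> J}"
  unfolding quotient_data_def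
proof (intro conjI ballI allI impI)
  fix x y assume "x \<in> {y. \<exists>s\<in>supported_on E. y - s \<in> J}" "y \<in> {y. \<exists>s\<in>supported_on E. y - s \<in> J}"
  then obtain s s' where s: "s \<in> supported_on E" "s' \<in> supported_on E"
    and J: "x - s \<in> J" "y - s' \<in> J" by blast
  have "(x - s) - (y - s') = (x - y) - (s - s')" by simp
  with assms(2)[OF J] have "(x - y) - (s - s') \<in> J" by simp
  moreover have "s - s' \<in> supported_on E" using s by (rule supported_on_diff)
  ultimately have "s - s' \<in> supported_on E" "(x - y) - (s - s') \<in> J" by auto
  then show "x - y \<in> {y. \<exists>s\<in>supported_on E. y - s \<in> J}" by blast
next
  show "supported_on E \<subseteq> {y. \<exists>s\<in>supported_on E. y - s \<in> J}"
    using assms(3)[of 0] by force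
next
  fix x assume "T q - 1 dvd x"
  then show "x \<in> {y. \<exists>s\<in>supported_on E. y - s \<in> J}"
    using assms(3)[of x] by (intro CollectI bexI[of _ 0]) auto
qed (rule assms(1))

lemma T_diff_dvd: "q dvd k - k' \<Longrightarrow> T q - 1 dvd T k - T k'"
proof -
  assume "q dvd k - k'"
  then have "T q - 1 dvd T k' * (T (k - k') - 1)" by (intro dvd_mult T_minus_1_dvd)
  also have "\<dots> = T k - T k'" by (simp add: right_diff_distrib flip: T_add)
  finally show ?thesis .
qed

text \<open>
  If the entries of two factors change by multiples of \<open>t^q - 1\<close> or, in the centre, by
  elements of \<open>I\<close>, then so do those of the product, because \<open>I\<close> contains the ideal of
  \<open>t^q - 1\<close>. The assumption excludes solutions of the equations of \<open>hall_conjugate_iff\<close> in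
  this quotient.
\<close>

lemma hall_separated:
  assumes data: "quotient_data E q I"
    and nc: "\<And>j m m'. q dvd k' - k \<Longrightarrow> T q - 1 dvd (f' * T j - f) - m * (T k - 1) \<Longrightarrow>
      T q - 1 dvd (g' - T j * g) - m' * (1 - T k) \<Longrightarrow> z' + f' * m' - z - m * g \<in> I \<Longrightarrow> False"
  shows "\<exists>F :: hall \<Rightarrow> int \<times> laurent set \<times> laurent set \<times> laurent set.
    finite (F ` carrier (hall_group E)) \<and> respects_mult (hall_group E) F \<and>
    (\<forall>h\<in>carrier (hall_group E). F ((k', f', g', z') \<otimes>\<^bsub>hall_group E\<^esub> h) \<noteq>
       F (h \<otimes>\<^bsub>hall_group E\<^esub> (k, f, g, z)))"
proof -
  let ?e = "T q - 1"
  have q: "q > 0" and I_diff: "\<And>x y. x \<in> I \<Longrightarrow> y \<in> I \<Longrightarrow> x - y \<in> I"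
    and I_supp: "\<And>x. x \<in> supported_on E \<Longrightarrow> x \<in> I" and I_e: "\<And>x. ?e dvd x \<Longrightarrow> x \<in> I"
    using data by (auto simp: quotient_data_def)
  have I_add: "x + y \<in> I" if "x \<in> I" "y \<in> I" for x y
    using I_diff[OF that] by (simp add: laurent_minus)
  have [simp]: "0 \<in> I" by (rule I_supp) simp
  define cI where "cI z = {w. z - w \<in> I}" for z
  have cI: "cI z = cI w \<longleftrightarrow> z - w \<in> I" for z w
  proof
    have "w \<in> cI w" by (simp add: cI_def)
    then show "cI z = cI w \<Longrightarrow> z - w \<in> I" by (metis cI_def mem_Collect_eq)
    assume zw: "z - w \<in> I"
    have "z - v \<in> I \<longleftrightarrow> w - v \<in> I" for v
      using I_diff[of "z - v" "z - w"] I_add[OF zw, of "w - v"] zw by auto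
    then show "cI z = cI w" by (simp add: cI_def)
  qed
  have cI_trunc: "trunc E x - trunc E y \<in> I" if "x - y \<in> I" for x y
  proof -
    have eq: "trunc E x - trunc E y = (trunc E x - x) + (x - y) - (trunc E y - y)" by simp
    show ?thesis
      unfolding eq by (intro I_diff I_add I_supp trunc_minus_supported that)
  qed
  have cI_trunc': "x - y \<in> I" if "trunc E x - trunc E y \<in> I" for x y
  proof -
    have eq: "x - y = (trunc E x - trunc E y) - (trunc E x - x) + (trunc E y - y)" by simp
    show ?thesis
      by (subst eq) (intro I_diff I_add I_supp trunc_minus_supported that)
  qed
  define F :: "hall \<Rightarrow> _" where
    "F = (\<lambda>(k, f, g, z). (k mod q, residue_set ?e f, residue_set ?e g, cI z))"
  have F_eq: "F (k1, f1, g1, z1) = F (k2, f2, g2, z2) \<longleftrightarrow>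
      q dvd k1 - k2 \<and> ?e dvd f1 - f2 \<and> ?e dvd g1 - g2 \<and> z1 - z2 \<in> I" for k1 f1 g1 z1 k2 f2 g2 z2
    by (simp add: F_def residue_set_eq_iff cI mod_eq_dvd_iff)
  have fin: "finite (F ` carrier (hall_group E))"
  proof (rule finite_subset)
    show "F ` carrier (hall_group E) \<subseteq>
        {0..<q} \<times> range (residue_set ?e) \<times> range (residue_set ?e) \<times> range cI"
      using q by (auto simp: F_def)
    have "range cI \<subseteq> cI ` {g. keys g \<subseteq> {0..<q}}"
    proof (rule image_subsetI)
      fix z
      obtain g where "keys g \<subseteq> {0..<q}" "?e dvd z - g" using exists_reduced[OF q] by blast
      then show "cI z \<in> cI ` {g. keys g \<subseteq> {0..<q}}"
        using cI[of z g] I_e by (intro image_eqI[of _ _ g]) auto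
    qed
    then have "finite (range cI)"
      by (rule finite_subset) (simp add: finite_keys_subset)
    then show "finite ({0..<q} \<times> range (residue_set ?e) \<times> range (residue_set ?e) \<times> range cI)"
      using finite_residue_sets[OF q] by simp
  qed
  have "F (x1 \<otimes>\<^bsub>hall_group E\<^esub> x2) = F (y1 \<otimes>\<^bsub>hall_group E\<^esub> y2)"
    if eq: "F x1 = F y1" "F x2 = F y2" for x1 x2 y1 y2
  proof -
    obtain k1 f1 g1 z1 where x1: "x1 = (k1, f1, g1, z1)" by (cases x1)
    obtain k2 f2 g2 z2 where x2: "x2 = (k2, f2, g2, z2)" by (cases x2)
    obtain l1 a1 b1 c1 where y1: "y1 = (l1, a1, b1, c1)" by (cases y1)
    obtain l2 a2 b2 c2 where y2: "y2 = (l2, a2, b2, c2)" by (cases y2)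
    have 1: "q dvd k1 - l1" "?e dvd f1 - a1" "?e dvd g1 - b1" "z1 - c1 \<in> I"
      and 2: "q dvd k2 - l2" "?e dvd f2 - a2" "?e dvd g2 - b2" "z2 - c2 \<in> I"
      using eq unfolding x1 x2 y1 y2 F_eq by auto
    have "k1 + k2 - (l1 + l2) = (k1 - l1) + (k2 - l2)" by simp
    then have k: "q dvd k1 + k2 - (l1 + l2)" using dvd_add[OF 1(1) 2(1)] by (simp only:)
    have "(f2 + f1 * T k2) - (a2 + a1 * T l2) = (f2 - a2) + ((f1 - a1) * T k2 + a1 * (T k2 - T l2))"
      by (simp add: algebra_simps)
    then have f: "?e dvd (f2 + f1 * T k2) - (a2 + a1 * T l2)"
      using dvd_add[OF 2(2) dvd_add[OF dvd_mult2[OF 1(2), of "T k2"] dvd_mult[OF T_diff_dvd[OF 2(1)], of a1]]]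
      by (simp only:)
    have "(g1 + T k1 * g2) - (b1 + T l1 * b2) = (g1 - b1) + (T k1 * (g2 - b2) + (T k1 - T l1) * b2)"
      by (simp add: algebra_simps)
    then have g: "?e dvd (g1 + T k1 * g2) - (b1 + T l1 * b2)"
      using dvd_add[OF 1(3) dvd_add[OF dvd_mult[OF 2(3), of "T k1"] dvd_mult2[OF T_diff_dvd[OF 1(1)], of b2]]]
      by (simp only:)
    have "?e dvd (f1 - a1) * g2 + a1 * (g2 - b2)"
      by (rule dvd_add[OF dvd_mult2[OF 1(2)] dvd_mult[OF 2(3)]])
    moreover have "(z1 + z2 + f1 * g2) - (c1 + c2 + a1 * b2) =
        (z1 - c1) + ((z2 - c2) + ((f1 - a1) * g2 + a1 * (g2 - b2)))"
      by (simp add: algebra_simps)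
    ultimately have "(z1 + z2 + f1 * g2) - (c1 + c2 + a1 * b2) \<in> I"
      using I_add[OF 1(4) I_add[OF 2(4) I_e]] by (simp only:)
    then show ?thesis
      unfolding x1 x2 y1 y2 hall_mult F_eq by (intro conjI k f g cI_trunc)
  qed
  then have "respects_mult (hall_group E) F" unfolding respects_mult_def by blast
  moreover have "F ((k', f', g', z') \<otimes>\<^bsub>hall_group E\<^esub> h) \<noteq> F (h \<otimes>\<^bsub>hall_group E\<^esub> (k, f, g, z))" for h
  proof
    obtain j m m' w where h: "h = (j, m, m', w)" by (cases h)
    assume "F ((k', f', g', z') \<otimes>\<^bsub>hall_group E\<^esub> h) = F (h \<otimes>\<^bsub>hall_group E\<^esub> (k, f, g, z))"
    then have k: "q dvd k' + j - (j + k)" and f: "?e dvd (m + f' * T j) - (f + m * T k)"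
      and g: "?e dvd (g' + T k' * m') - (m' + T j * g)"
      and z: "(z' + w + f' * m') - (w + z + m * g) \<in> I"
      unfolding h hall_mult F_eq by (auto dest: cI_trunc')
    have k: "q dvd k' - k" using k by (simp add: algebra_simps)
    have "(f' * T j - f) - m * (T k - 1) = (m + f' * T j) - (f + m * T k)" by (simp add: algebra_simps)
    with f have f: "?e dvd (f' * T j - f) - m * (T k - 1)" by (simp only:)
    have "(g' - T j * g) - m' * (1 - T k) = ((g' + T k' * m') - (m' + T j * g)) - (T k' - T k) * m'"
      by (simp add: algebra_simps)
    then have g: "?e dvd (g' - T j * g) - m' * (1 - T k)"
      using dvd_diff[OF g dvd_mult2[OF T_diff_dvd[OF k], of m']] by (simp only:)
    have "(z' + w + f' * m') - (w + z + m * g) = z' + f' * m' - z - m * g" by simp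
    with z have "z' + f' * m' - z - m * g \<in> I" by (simp only:)
    with nc[OF k f g] show False by blast
  qed
  ultimately show ?thesis using fin by blast
qed

text \<open>
  The equations of \<open>hall_conjugate_iff\<close> have no solution in the quotient given by \<open>q\<close> and \<open>I\<close>.
\<close>

definition separates :: "int \<Rightarrow> laurent set \<Rightarrow> hall \<Rightarrow> hall \<Rightarrow> bool" where
  "separates q I = (\<lambda>(k, f, g, z) (k', f', g', z'). \<forall>j m m'. q dvd k' - k \<longrightarrow>
     T q - 1 dvd (f' * T j - f) - m * (T k - 1) \<longrightarrow>
     T q - 1 dvd (g' - T j * g) - m' * (1 - T k) \<longrightarrow> z' + f' * m' - z - m * g \<notin> I)"

lemma eventually_not_dvd:
  assumes "f \<noteq> 0" shows "\<forall>\<^sub>F q in at_top. \<not> T q - 1 dvd f"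
  using nonzero_not_dvd[OF assms] by (simp add: eventually_at_top_dense)

text \<open>
  If \<open>f\<close> and a shift of \<open>f'\<close> agree modulo \<open>t^q - 1\<close> for large \<open>q\<close>, an exponent \<open>d\<close> that is
  isolated in \<open>f\<close> must come from an exponent of \<open>f'\<close>. So modulo \<open>q\<close> there are only finitely
  many possible shifts, and they do not depend on \<open>q\<close>.
\<close>

lemma finite_shifts:
  assumes "f \<noteq> 0"
  shows "\<exists>J. finite J \<and> (\<forall>\<^sub>F q in at_top. \<forall>j. T q - 1 dvd f' * T j - f \<longrightarrow> (\<exists>i\<in>J. q dvd j - i))"
proof -
  obtain d where d: "d \<in> keys f" using assms by (metis all_not_in_conv keys_eq_empty)
  let ?J = "(\<lambda>i. d - i) ` keys f'"
  have "\<exists>i\<in>?J. q dvd j - i" if q: "q > (\<Sum>n\<in>keys f. \<bar>n - d\<bar>)" and dvd: "T q - 1 dvd f' * T j - f" for q j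
  proof -
    let ?S = "{n. q dvd n - d}"
    have "csum ?S (f' * T j - f) = 0" using dvd by (rule csum_residue_dvd)
    moreover have "csum ?S f = 1" using d q by (rule residue_isolates)
    ultimately have "csum ?S (f' * T j) \<noteq> 0"
      unfolding laurent_minus csum_add by (metis add.left_neutral zero_neq_one)
    then obtain n where n: "n \<in> keys (f' * T j)" "q dvd n - d" using csum_eq_0[of "f' * T j" ?S] by blast
    then obtain a where a: "a \<in> keys f'" "n = a + j" using keys_mult[of f' "T j"] by auto
    then have "n - d = j - (d - a)" by simp
    with n(2) have "q dvd j - (d - a)" by (simp only:)
    then show ?thesis using a(1) by blast
  qed
  then have "\<forall>\<^sub>F q in at_top. \<forall>j. T q - 1 dvd f' * T j - f \<longrightarrow> (\<exists>i\<in>?J. q dvd j - i)"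
    unfolding eventually_at_top_dense by blast
  then show ?thesis by (intro exI[of _ ?J]) simp
qed

lemma finite_common_shifts:
  assumes ne: "\<not> (f = 0 \<and> g = 0 \<and> f' = 0 \<and> g' = 0)"
  shows "\<exists>J. finite J \<and> (\<forall>\<^sub>F q in at_top. \<forall>j.
    T q - 1 dvd f' * T j - f \<longrightarrow> T q - 1 dvd g' - T j * g \<longrightarrow> (\<exists>i\<in>J. q dvd j - i))"
proof -
  have unit: "e dvd h" if "e dvd h * T j" for e h :: laurent and j
  proof -
    have "h = (h * T j) * T (- j)" by (simp add: mult.assoc)
    then show ?thesis using that by (metis dvd_mult2)
  qed
  consider "f \<noteq> 0" | "g' \<noteq> 0" | "f = 0" "g' = 0" "f' \<noteq> 0" | "f = 0" "g' = 0" "g \<noteq> 0"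
    using ne by blast
  then show ?thesis
  proof cases
    case 1
    from finite_shifts[OF this, of f'] show ?thesis
      by (elim exE conjE, intro exI conjI) (auto elim: eventually_mono)
  next
    case 2
    from finite_shifts[OF this, of g] obtain J where J: "finite J"
      "\<forall>\<^sub>F q in at_top. \<forall>j. T q - 1 dvd g * T j - g' \<longrightarrow> (\<exists>i\<in>J. q dvd j - i)" by blast
    have "g * T j - g' = g' - T j * g" for j by (subst laurent_minus_commute) (simp add: mult.commute)
    with J show ?thesis by (intro exI[of _ J]) (auto elim: eventually_mono)
  next
    case 3
    from eventually_not_dvd[OF 3(3)] show ?thesis
      by (intro exI[of _ "{}"]) (auto elim!: eventually_mono dest: unit simp: 3)
  next
    case 4
    have "T q - 1 dvd g" if "T q - 1 dvd T j * g" for q j using unit[of _ g j] that by (simp add: mult.commute)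
    with eventually_not_dvd[OF 4(3)] show ?thesis
      by (intro exI[of _ "{}"]) (auto elim!: eventually_mono simp: 4)
  qed
qed

text \<open>
  For each of the finitely many candidate shifts, one of the differences is nonzero and is not
  divisible by \<open>t^q - 1\<close> for large \<open>q\<close>.
\<close>

lemma shift_inequivalent_mod:
  assumes no: "\<And>j. f' * T j = f \<Longrightarrow> g' = T j * g \<Longrightarrow> False"
  shows "\<exists>q>0. \<forall>j. T q - 1 dvd f' * T j - f \<longrightarrow> \<not> T q - 1 dvd g' - T j * g"
proof -
  have "\<not> (f = 0 \<and> g = 0 \<and> f' = 0 \<and> g' = 0)" using no[of 0] by auto
  from finite_common_shifts[OF this] obtain J where J: "finite J"
    "\<forall>\<^sub>F q in at_top. \<forall>j. T q - 1 dvd f' * T j - f \<longrightarrow> T q - 1 dvd g' - T j * g \<longrightarrow> (\<exists>i\<in>J. q dvd j - i)"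
    by blast
  have "\<forall>\<^sub>F q in at_top. \<not> (T q - 1 dvd f' * T i - f \<and> T q - 1 dvd g' - T i * g)" for i
  proof (cases "f' * T i - f = 0")
    case True
    then have "g' - T i * g \<noteq> 0" using no[of i] by auto
    from eventually_not_dvd[OF this] show ?thesis by (rule eventually_mono) simp
  next
    case False
    from eventually_not_dvd[OF this] show ?thesis by (rule eventually_mono) simp
  qed
  then have "\<forall>\<^sub>F q in at_top. \<forall>i\<in>J. \<not> (T q - 1 dvd f' * T i - f \<and> T q - 1 dvd g' - T i * g)"
    using J(1) by (simp add: eventually_ball_finite)
  from eventually_conj[OF eventually_gt_at_top[of 0] eventually_conj[OF J(2) this]]
  obtain q where q: "q > 0"
    and shift: "\<And>j. T q - 1 dvd f' * T j - f \<Longrightarrow> T q - 1 dvd g' - T j * g \<Longrightarrow> \<exists>i\<in>J. q dvd j - i"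
    and bad: "\<And>i. i \<in> J \<Longrightarrow> \<not> (T q - 1 dvd f' * T i - f \<and> T q - 1 dvd g' - T i * g)"
    by (auto dest!: eventually_happens)
  have False if f: "T q - 1 dvd f' * T j - f" and g: "T q - 1 dvd g' - T j * g" for j
  proof -
    obtain i where i: "i \<in> J" "q dvd j - i" using shift[OF f g] by blast
    have d: "T q - 1 dvd T j - T i" by (rule T_diff_dvd[OF i(2)])
    have "f' * T i - f = (f' * T j - f) - f' * (T j - T i)" by (simp add: algebra_simps)
    then have "T q - 1 dvd f' * T i - f" using dvd_diff[OF f dvd_mult[OF d, of f']] by (simp only:)
    moreover have "g' - T i * g = (g' - T j * g) + (T j - T i) * g" by (simp add: algebra_simps)
    then have "T q - 1 dvd g' - T i * g" using dvd_add[OF g dvd_mult2[OF d, of g]] by (simp only:)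
    ultimately show False using bad[OF i(1)] by blast
  qed
  then show ?thesis using q by blast
qed

text \<open>
  The case \<open>k = 0\<close> with \<open>f\<close>, \<open>g\<close> and \<open>f'\<close>, \<open>g'\<close> equal up to a shift: the central entries must
  differ by an element of \<open>span E + g R + f' R\<close>. If \<open>f'\<close> or \<open>g\<close> is nonzero, this subgroup
  contains a polynomial \<open>t^q - 1\<close>, so it can be used to form a quotient.
\<close>

lemma quotient_separating_centre:
  assumes closed: "\<And>y. y \<notin> supported_on E \<Longrightarrow> \<exists>q>0. \<forall>s\<in>supported_on E. \<not> T q - 1 dvd y - s"
    and no: "\<And>m m'. z' + f' * m' - z - m * g \<notin> supported_on E"
  shows "\<exists>q I. quotient_data E q I \<and> (\<forall>m m'. z' + f' * m' - z - m * g \<notin> I)"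
proof (cases "f' = 0 \<and> g = 0")
  case True
  then have "z' - z \<notin> supported_on E" using no[of 0 0] by simp
  from closed[OF this] obtain q where q: "q > 0" "\<And>s. s \<in> supported_on E \<Longrightarrow> \<not> T q - 1 dvd z' - z - s" by blast
  have "quotient_data E q {y. \<exists>s\<in>supported_on E. y - s \<in> {x. T q - 1 dvd x}}"
    by (rule quotient_data_ideal) (use q in auto)
  then show ?thesis using q(2) True by (intro exI conjI) auto
next
  case False
  let ?J = "{m * g + f' * m' | m m'. True}"
  have J: "m * g \<in> ?J" "f' * m \<in> ?J" for m
    by (metis (mono_tags, lifting) mem_Collect_eq add.right_neutral mult_zero_right,
        metis (mono_tags, lifting) mem_Collect_eq add.left_neutral mult_zero_left)
  obtain q where q: "q > 0" "f' dvd T q - 1 \<or> g dvd T q - 1"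
    using False dvd_T_minus_1 by metis
  have "quotient_data E q {y. \<exists>s\<in>supported_on E. y - s \<in> ?J}"
  proof (rule quotient_data_ideal[OF q(1)])
    fix x y assume "x \<in> ?J" "y \<in> ?J"
    then obtain m m' n n' where "x = m * g + f' * m'" "y = n * g + f' * n'" by blast
    then have "x - y = (m - n) * g + f' * (m' - n')" by (simp add: algebra_simps)
    then show "x - y \<in> ?J" by blast
  next
    fix x assume "T q - 1 dvd x"
    then consider m where "x = f' * m" | m where "x = m * g"
      using q(2) by (metis dvd_trans dvdE mult.commute)
    then show "x \<in> ?J" using J by cases auto
  qed
  moreover have "z' + f' * m' - z - m * g \<notin> {y. \<exists>s\<in>supported_on E. y - s \<in> ?J}" for m m'
  proof
    assume "z' + f' * m' - z - m * g \<in> {y. \<exists>s\<in>supported_on E. y - s \<in> ?J}"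
    then obtain s n n' where s: "s \<in> supported_on E" "z' + f' * m' - z - m * g - s = n * g + f' * n'" by blast
    then have "s = z' + f' * (m' - n') - z - (m + n) * g" by (simp add: algebra_simps)
    then show False using no[of "m' - n'" "m + n"] s(1) by simp
  qed
  ultimately show ?thesis by blast
qed

text \<open>
  The case of a nonzero exponent \<open>k\<close>. For a given shift \<open>j\<close> there is at most one pair
  \<open>(m, m')\<close> that solves the first two equations, because \<open>t^k - 1\<close> is not a zero divisor, and
  replacing \<open>j\<close> by a number congruent modulo \<open>k\<close> does not change the central difference that
  results. This leaves finitely many central differences outside the span, to be separated
  simultaneously by one modulus.
\<close>

lemma quotient_separating_cosets:
  assumes closed: "\<And>y. y \<notin> supported_on E \<Longrightarrow> \<exists>q>0. \<forall>s\<in>supported_on E. \<not> T q - 1 dvd y - s"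
    and k: "k \<noteq> 0"
    and no: "\<And>j m m'. f' * T j - f = m * (T k - 1) \<Longrightarrow> g' - T j * g = m' * (1 - T k) \<Longrightarrow>
      z' + f' * m' - z - m * g \<notin> supported_on E"
  shows "\<exists>q I. quotient_data E q I \<and> separates q I (k, f, g, z) (k, f', g', z')"
proof -
  have Tk: "T k - 1 \<noteq> 0" using T_minus_1_neq_0[OF k] .
  have "\<exists>q>0. \<forall>m m'. f' * T j - f = m * (T k - 1) \<longrightarrow> g' - T j * g = m' * (1 - T k) \<longrightarrow>
      (\<forall>s\<in>supported_on E. \<not> T q - 1 dvd z' + f' * m' - z - m * g - s)" for j
  proof (cases "\<exists>m m'. f' * T j - f = m * (T k - 1) \<and> g' - T j * g = m' * (1 - T k)")
    case True
    then obtain m m' where m: "f' * T j - f = m * (T k - 1)" "g' - T j * g = m' * (1 - T k)" by blast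
    have unique: "n = m \<and> n' = m'" if "f' * T j - f = n * (T k - 1)" "g' - T j * g = n' * (1 - T k)" for n n'
    proof -
      have "n * (T k - 1) = m * (T k - 1)" "n' * (T k - 1) = m' * (T k - 1)"
        using m that laurent_minus_commute[of 1 "T k"] by metis+
      then show ?thesis using Tk by simp
    qed
    from closed[OF no[OF m]] show ?thesis using unique by metis
  next
    case False
    then show ?thesis by (intro exI[of _ 1]) auto
  qed
  then obtain p where p: "\<And>j. p j > 0"
    "\<And>j m m' s. f' * T j - f = m * (T k - 1) \<Longrightarrow> g' - T j * g = m' * (1 - T k) \<Longrightarrow>
      s \<in> supported_on E \<Longrightarrow> \<not> T (p j) - 1 dvd z' + f' * m' - z - m * g - s"
    by metis
  \<comment> \<open>The sign makes \<open>k * Q\<close> and thus \<open>q\<close> positive.\<close>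
  define Q where "Q = sgn k * (\<Prod>j\<in>{0..<\<bar>k\<bar>}. p j)"
  define q where "q = 2 * k * Q"
  have "k * sgn k = \<bar>k\<bar>" by (simp add: abs_sgn)
  then have "q = 2 * \<bar>k\<bar> * (\<Prod>j\<in>{0..<\<bar>k\<bar>}. p j)" by (simp add: q_def Q_def mult.assoc[symmetric])
  moreover have "(\<Prod>j\<in>{0..<\<bar>k\<bar>}. p j) > 0" by (rule prod_pos) (simp add: p)
  ultimately have "q > 0" using k by simp
  have pQ: "p j dvd Q" if "j \<in> {0..<\<bar>k\<bar>}" for j
    unfolding Q_def by (intro dvd_mult dvd_prodI) (use that in auto)
  have kq: "k dvd q" and Qq: "Q dvd q" by (auto simp: q_def)
  let ?e = "T q - 1"
  let ?I = "{y. \<exists>s\<in>supported_on E. y - s \<in> {x. ?e dvd x}}"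
  have data: "quotient_data E q ?I"
    by (rule quotient_data_ideal) (use \<open>q > 0\<close> in auto)
  have "separates q ?I (k, f, g, z) (k, f', g', z')"
    unfolding separates_def prod.case
  proof (intro allI impI notI)
    fix j m m'
    assume f: "?e dvd (f' * T j - f) - m * (T k - 1)" and g: "?e dvd (g' - T j * g) - m' * (1 - T k)"
      and "z' + f' * m' - z - m * g \<in> ?I"
    then obtain s where s: "s \<in> supported_on E" "?e dvd z' + f' * m' - z - m * g - s" by blast
    define i where "i = j mod \<bar>k\<bar>"
    have i: "i \<in> {0..<\<bar>k\<bar>}" using k by (simp add: i_def)
    have "k dvd j - i" unfolding i_def using dvd_minus_mod[of "\<bar>k\<bar>" j] by (simp only: abs_dvd_iff)
    then obtain c where "T j - T i = (T k - 1) * c" using T_diff_dvd by (metis dvdE)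
    then have c: "T j = T i + (T k - 1) * c" by (simp add: algebra_simps)
    \<comment> \<open>The solution for the shift \<open>j\<close> is turned into one for its residue \<open>i\<close>
      modulo \<open>k\<close>, with the same central difference.\<close>
    define n n' where "n = m - f' * c" and "n' = m' - c * g"
    have "(f' * T j - f) - m * (T k - 1) = (f' * T i - f) - n * (T k - 1)"
      unfolding c n_def by (simp add: algebra_simps)
    with f have f: "?e dvd (f' * T i - f) - n * (T k - 1)" by (simp only:)
    have "(g' - T j * g) - m' * (1 - T k) = (g' - T i * g) - n' * (1 - T k)"
      unfolding c n'_def by (simp add: algebra_simps)
    with g have g: "?e dvd (g' - T i * g) - n' * (1 - T k)" by (simp only:)
    have "z' + f' * m' - z - m * g - s = z' + f' * n' - z - n * g - s"
      unfolding n_def n'_def by (simp add: algebra_simps)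
    with s have E: "?e dvd z' + f' * n' - z - n * g - s" by (simp only:)
    have ke: "T k - 1 dvd ?e" by (rule T_minus_1_dvd[OF kq])
    have ke': "1 - T k dvd ?e" using ke by (subst laurent_minus_commute)
    \<comment> \<open>A solution modulo \<open>t^q - 1\<close> forces an exact one, to which it is
      congruent modulo \<open>t^Q - 1\<close>.\<close>
    have "T k - 1 dvd (f' * T i - f)"
      using dvd_add[OF dvd_trans[OF ke f] dvd_triv_right[of "T k - 1" n]] by simp
    then obtain a where a: "f' * T i - f = a * (T k - 1)" by (metis dvdE mult.commute)
    have "1 - T k dvd (g' - T i * g)"
      using dvd_add[OF dvd_trans[OF ke' g] dvd_triv_right[of "1 - T k" n']] by simp
    then obtain a' where a': "g' - T i * g = a' * (1 - T k)" by (metis dvdE mult.commute)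
    have "?e dvd (T k - 1) * (a - n)"
      using f unfolding a by (simp add: algebra_simps)
    then have an: "T Q - 1 dvd a - n" unfolding q_def by (rule cofactor_dvd[OF k])
    have "?e dvd (1 - T k) * (a' - n')"
      using g unfolding a' by (simp add: algebra_simps)
    then have "?e dvd (T k - 1) * (a' - n')" by (subst laurent_minus_commute)
    then have an': "T Q - 1 dvd a' - n'" unfolding q_def by (rule cofactor_dvd[OF k])
    have "z' + f' * a' - z - a * g - s = (z' + f' * n' - z - n * g - s) + (f' * (a' - n') - (a - n) * g)"
      by (simp add: algebra_simps)
    moreover have QE: "T Q - 1 dvd z' + f' * n' - z - n * g - s"
      using T_minus_1_dvd[OF Qq] E by (rule dvd_trans)
    ultimately have "T Q - 1 dvd z' + f' * a' - z - a * g - s"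
      using dvd_add[OF QE dvd_diff[OF dvd_mult[OF an', of f'] dvd_mult2[OF an, of g]]] by (simp only:)
    then have "T (p i) - 1 dvd z' + f' * a' - z - a * g - s"
      by (rule dvd_trans[OF T_minus_1_dvd[OF pQ[OF i]]])
    then show False using p(2)[OF a a' s(1)] by blast
  qed
  with data show ?thesis by blast
qed

theorem conjugacy_separable_hall:
  assumes closed: "\<And>y. y \<notin> supported_on E \<Longrightarrow> \<exists>q>0. \<forall>s\<in>supported_on E. \<not> T q - 1 dvd y - s"
  shows "conjugacy_separable (hall_group E)"
proof (rule group.conjugacy_separable_if_finite_images[OF group_hall])
  fix x y assume x: "x \<in> carrier (hall_group E)" and y: "y \<in> carrier (hall_group E)"
    and nc: "\<not> conjugate_in (hall_group E) x y"
  obtain k f g z where xe: "x = (k, f, g, z)" by (cases x)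
  obtain k' f' g' z' where ye: "y = (k', f', g', z')" by (cases y)
  have nc: "\<not> (k' = k \<and> (\<exists>j m m'. f' * T j - f = m * (T k - 1) \<and> g' - T j * g = m' * (1 - T k) \<and>
      z' + f' * m' - z - m * g \<in> supported_on E))"
    using nc x y unfolding xe ye by (simp add: hall_conjugate_iff hall_carrier)
  have "\<exists>q I. quotient_data E q I \<and> separates q I x y"
  proof (cases "k' = k")
    case False
    have "\<not> \<bar>k' - k\<bar> + 1 dvd k' - k"
      using False dvd_imp_le_int[of "k' - k" "\<bar>k' - k\<bar> + 1"] by auto
    then show ?thesis
      by (intro exI[of _ "\<bar>k' - k\<bar> + 1"] exI[of _ UNIV])
         (auto simp: xe ye separates_def intro: quotient_data_UNIV)
  next
    case True
    show ?thesis
    proof (cases "k = 0")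
      case False
      then show ?thesis
        using quotient_separating_cosets[OF closed False, of f' f g' g z' z] nc unfolding xe ye True by blast
    next
      case k: True
      show ?thesis
      proof (cases "\<exists>j. f' * T j = f \<and> g' = T j * g")
        case False
        then obtain q where "q > 0" "\<forall>j. T q - 1 dvd f' * T j - f \<longrightarrow> \<not> T q - 1 dvd g' - T j * g"
          using shift_inequivalent_mod[of f' f g' g] by blast
        then show ?thesis
          by (intro exI[of _ q] exI[of _ UNIV]) (auto simp: xe ye k separates_def intro: quotient_data_UNIV)
      next
        case shift: True
        have "z' + f' * m' - z - m * g \<notin> supported_on E" for m m'
          using nc shift \<open>k' = k\<close> k by auto
        then show ?thesis
          using quotient_separating_centre[OF closed, of z' f' z g] unfolding xe ye k separates_def by auto
      qed
    qed
  qed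
  then obtain q I where "quotient_data E q I" "separates q I (k, f, g, z) (k', f', g', z')"
    unfolding xe ye by blast
  then show "\<exists>F :: hall \<Rightarrow> int \<times> laurent set \<times> laurent set \<times> laurent set.
      finite (F ` carrier (hall_group E)) \<and> respects_mult (hall_group E) F \<and>
      (\<forall>h\<in>carrier (hall_group E). F (y \<otimes>\<^bsub>hall_group E\<^esub> h) \<noteq> F (h \<otimes>\<^bsub>hall_group E\<^esub> x))"
    unfolding xe ye separates_def prod.case by (intro hall_separated) blast+
qed


section \<open>The word problem\<close>

definition t_exponent :: "nat \<times> bool \<Rightarrow> int" where
  "t_exponent l = (if fst l = 2 then (if snd l then 1 else - 1) else 0)"

text \<open>
  The exponent sum of \<open>t\<close> in the first \<open>n\<close> letters. In terms of these positions the entries of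
  the value of a word are explicit sums over its letters (\<open>word_f\<close>, \<open>word_g\<close>) and over pairs
  of a letter \<open>a\<close> and a later letter \<open>b\<close> (\<open>word_z\<close>), where \<open>a\<close>, \<open>b\<close>, \<open>t\<close> are the generators
  number 0, 1, 2.
\<close>

definition position :: "gword \<Rightarrow> nat \<Rightarrow> int" where
  "position w n = (\<Sum>i<n. t_exponent (w ! i))"

lemma position_0 [simp]: "position w 0 = 0"
  by (simp add: position_def)

lemma position_Cons_Suc [simp]: "position (l # w) (Suc n) = t_exponent l + position w n"
  by (simp add: position_def sum.lessThan_Suc_shift del: sum.lessThan_Suc)

definition word_f :: "gword \<Rightarrow> laurent" where
  "word_f w = (\<Sum>n<length w. if fst (w ! n) = 0 then T (position w (length w) - position w n) else 0)"

definition word_g :: "gword \<Rightarrow> laurent" where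
  "word_g w = (\<Sum>m<length w. if fst (w ! m) = 1 then T (position w m) else 0)"

definition word_z :: "gword \<Rightarrow> laurent" where
  "word_z w = (\<Sum>m<length w. \<Sum>n<m.
     if fst (w ! n) = 0 \<and> fst (w ! m) = 1 then T (position w m - position w n) else 0)"

lemma word_f_Cons: "fst l = 0 \<longrightarrow> t_exponent l = 0 \<Longrightarrow>
    word_f (l # w) = (if fst l = 0 then T (position w (length w)) else 0) + word_f w"
  unfolding word_f_def length_Cons sum.lessThan_Suc_shift
  by (auto intro!: sum.cong arg_cong2[where f = "(+)"])

lemma word_g_Cons: "word_g (l # w) = (if fst l = 1 then 1 else 0) + T (t_exponent l) * word_g w"
  unfolding word_g_def length_Cons sum.lessThan_Suc_shift
  by (auto simp: sum_distrib_left T_add intro!: sum.cong arg_cong2[where f = "(+)"])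

lemma word_z_Cons: "fst l = 0 \<longrightarrow> t_exponent l = 0 \<Longrightarrow>
    word_z (l # w) = (if fst l = 0 then word_g w else 0) + word_z w"
proof -
  assume l: "fst l = 0 \<longrightarrow> t_exponent l = 0"
  have "word_z (l # w) = (\<Sum>m<length w. (if fst l = 0 \<and> fst (w ! m) = 1 then T (t_exponent l + position w m) else 0) +
      (\<Sum>n<m. if fst (w ! n) = 0 \<and> fst (w ! m) = 1 then T (position w m - position w n) else 0))"
    unfolding word_z_def length_Cons sum.lessThan_Suc_shift by (simp cong: if_cong)
  also have "\<dots> = (\<Sum>m<length w. if fst l = 0 \<and> fst (w ! m) = 1 then T (t_exponent l + position w m) else 0) + word_z w"
    unfolding sum.distrib word_z_def ..
  also have "(\<Sum>m<length w. if fst l = 0 \<and> fst (w ! m) = 1 then T (t_exponent l + position w m) else 0) =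
      (if fst l = 0 then word_g w else 0)"
    using l by (auto simp: word_g_def intro!: sum.cong sum.neutral)
  finally show ?thesis .
qed

lemma hall_inv_generators:
  "inv\<^bsub>hall_group E\<^esub> (0, 1, 0, 0) = (0, 1, 0, 0)"
  "inv\<^bsub>hall_group E\<^esub> (0, 0, 1, 0) = (0, 0, 1, 0)"
  "inv\<^bsub>hall_group E\<^esub> (1, 0, 0, 0) = (- 1, 0, 0, 0)"
proof -
  interpret group "hall_group E" by (rule group_hall)
  show "inv\<^bsub>hall_group E\<^esub> (0, 1, 0, 0) = (0, 1, 0, 0)"
    by (rule inv_equality) (simp_all add: hall_simps)
  show "inv\<^bsub>hall_group E\<^esub> (0, 0, 1, 0) = (0, 0, 1, 0)"
    by (rule inv_equality) (simp_all add: hall_simps)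
  show "inv\<^bsub>hall_group E\<^esub> (1, 0, 0, 0) = (- 1, 0, 0, 0)"
    by (rule inv_equality) (simp_all add: hall_simps)
qed

lemma word_value_hall:
  assumes "w \<in> words_over {..<3}"
  shows "word_value (hall_group E) hall_generators w =
    (position w (length w), word_f w, word_g w, trunc E (word_z w))"
  using assms
proof (induction w)
  case Nil
  then show ?case by (simp add: hall_one word_f_def word_g_def word_z_def)
next
  case (Cons l w)
  then have IH: "word_value (hall_group E) hall_generators w =
    (position w (length w), word_f w, word_g w, trunc E (word_z w))" by (simp add: words_over_Cons)
  obtain x b where l: "l = (x, b)" by (cases l)
  have "x = 0 \<or> x = 1 \<or> x = 2" using Cons.prems by (auto simp: words_over_Cons l)
  then show ?case
    by (elim disjE; cases b; simp add: l IH hall_mult hall_generators_nth hall_inv_generators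
      word_f_Cons word_g_Cons word_z_Cons t_exponent_def trunc_add add.commute)
qed

lemma coeff_if_T: "coeff (if P then T e else 0) d = of_nat (of_bool (P \<and> e = d))"
  by (simp add: coeff_T of_bool_def)

lemma bit_of_nat_eq_0_iff: "(of_nat n :: bit) = 0 \<longleftrightarrow> even n"
proof -
  have "(of_nat n :: bit) = of_bool (odd n)" by (induction n) auto
  then show ?thesis by simp
qed

lemma coeff_sum_T:
  "coeff (\<Sum>i<a. \<Sum>j<b i. if P i j then T (h i j) else 0) d =
     of_nat (\<Sum>i<a. \<Sum>j<b i. of_bool (P i j \<and> h i j = d))"
  by (simp only: lookup_sum coeff_if_T of_nat_sum)

text \<open>
  The coefficient at an exponent is the parity of the number of summands with that exponent,
  and only exponents that occur need to be checked.
\<close>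

lemma trunc_sum_T_eq_0_iff:
  fixes a :: nat and b :: "nat \<Rightarrow> nat"
  shows "trunc E (\<Sum>i<a. \<Sum>j<b i. if P i j then T (h i j) else 0) = 0 \<longleftrightarrow>
    (\<forall>i<a. \<forall>j<b i. P i j \<longrightarrow> h i j \<in> int ` E \<or>
       even (\<Sum>i'<a. \<Sum>j'<b i'. of_bool (P i' j' \<and> h i' j' = h i j) :: nat))" (is "?L \<longleftrightarrow> ?R")
proof -
  define N where "N d = (\<Sum>i<a. \<Sum>j<b i. of_bool (P i j \<and> h i j = d) :: nat)" for d
  define x where "x = (\<Sum>i<a. \<Sum>j<b i. if P i j then T (h i j) else 0)"
  have coeff: "coeff x d = of_nat (N d)" for d
    unfolding x_def N_def coeff_sum_T ..
  have "trunc E x = 0 \<longleftrightarrow> (\<forall>d. d \<notin> int ` E \<longrightarrow> even (N d))"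
    by (simp add: poly_mapping_eq_iff fun_eq_iff coeff_trunc coeff bit_of_nat_eq_0_iff)
  also have "\<dots> \<longleftrightarrow> (\<forall>i<a. \<forall>j<b i. P i j \<longrightarrow> h i j \<in> int ` E \<or> even (N (h i j)))"
  proof
    assume R: "\<forall>i<a. \<forall>j<b i. P i j \<longrightarrow> h i j \<in> int ` E \<or> even (N (h i j))"
    have "even (N d)" if "d \<notin> int ` E" for d
    proof (cases "\<exists>i<a. \<exists>j<b i. P i j \<and> h i j = d")
      case True
      then show ?thesis using R that by blast
    next
      case False
      then have "N d = 0" unfolding N_def by (intro sum.neutral ballI) auto
      then show ?thesis by simp
    qed
    then show "\<forall>d. d \<notin> int ` E \<longrightarrow> even (N d)" by blast
  qed blast
  finally show ?thesis unfolding N_def x_def .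
qed

lemma sum_T_eq_0_iff:
  fixes a :: nat
  shows "(\<Sum>i<a. if P i then T (h i) else 0) = 0 \<longleftrightarrow>
    (\<forall>i<a. P i \<longrightarrow> even (\<Sum>i'<a. of_bool (P i' \<and> h i' = h i) :: nat))"
proof -
  have "trunc {} x = x" for x by (rule poly_mapping_eqI) (simp add: coeff_trunc)
  then show ?thesis
    using trunc_sum_T_eq_0_iff[where E = "{}" and a = a and b = "\<lambda>_. 1" and
        P = "\<lambda>i j. P i" and h = "\<lambda>i j. h i"]
    by (simp del: of_bool_eq_0_iff)
qed

text \<open>
  Positions are handled as differences of two natural numbers. The letters \<open>t\<close> and its inverse
  have the codes 5 and 4.
\<close>

definition ups :: "nat \<Rightarrow> nat \<Rightarrow> nat" where
  "ups c n = (\<Sum>i<n. of_bool (lnth c i = 5))"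

definition downs :: "nat \<Rightarrow> nat \<Rightarrow> nat" where
  "downs c n = (\<Sum>i<n. of_bool (lnth c i = 4))"

definition pair_count :: "nat \<Rightarrow> nat \<Rightarrow> nat \<Rightarrow> nat" where
  "pair_count c m n = (\<Sum>m'<llen c. \<Sum>n'<m'. of_bool ((lnth c n' < 2 \<and> lnth c m' div 2 = 1) \<and>
     ups c m' + downs c n' + downs c m + ups c n = ups c m + downs c n + downs c m' + ups c n'))"

definition letter_count :: "nat \<Rightarrow> nat \<Rightarrow> nat \<Rightarrow> nat" where
  "letter_count c x n = (\<Sum>n'<llen c. of_bool (lnth c n' div 2 = x \<and>
     ups c n' + downs c n = ups c n + downs c n'))"

text \<open>
  The word problem on codes: the exponent sum of \<open>t\<close> is 0, and the entries \<open>f\<close>, \<open>g\<close> and \<open>z\<close>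
  vanish, the last one modulo the exponents in \<open>E\<close>. The inequality guards the truncated
  subtraction.
\<close>

definition trivial_code :: "nat set \<Rightarrow> nat \<Rightarrow> bool" where
  "trivial_code E c \<longleftrightarrow> (\<forall>i<llen c. lnth c i < 6) \<and> ups c (llen c) = downs c (llen c) \<and>
     (\<forall>x<2. \<forall>n<llen c. lnth c n div 2 = x \<longrightarrow> even (letter_count c x n)) \<and>
     (\<forall>m<llen c. \<forall>n<m. lnth c n div 2 = 0 \<and> lnth c m div 2 = 1 \<longrightarrow>
        (downs c m + ups c n \<le> ups c m + downs c n \<and>
         ups c m + downs c n - (downs c m + ups c n) \<in> E) \<or> even (pair_count c m n))"

lemma computable_div2:
  assumes "computable k A" shows "computable k (\<lambda>xs. A xs div 2)"
proof -
  have eq: "a div 2 = (\<Sum>i<a. of_bool (2 * Suc i \<le> a))" for a :: nat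
  proof -
    have "(\<Sum>i<a. of_bool (2 * Suc i \<le> a)) = card {i. i < a \<and> 2 * Suc i \<le> a}"
      by (simp add: of_bool_def sum.If_cases Int_def)
    also have "{i. i < a \<and> 2 * Suc i \<le> a} = {..<a div 2}" by auto
    finally show ?thesis by simp
  qed
  have "computable 1 (\<lambda>xs. xs ! 0 div 2)"
    unfolding eq by (intro computable_intros computable_pred_intros; simp)
  from computable_subst1[OF this assms] show ?thesis .
qed

lemma computable_ups:
  assumes "computable k A" "computable k B" shows "computable k (\<lambda>xs. ups (A xs) (B xs))"
proof -
  have "computable 2 (\<lambda>xs. ups (xs ! 0) (xs ! 1))" unfolding ups_def
    by (intro computable_intros computable_pred_intros computable_code_intros; simp)
  from computable_subst2[OF this assms] show ?thesis .
qed

lemma computable_downs: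
  assumes "computable k A" "computable k B" shows "computable k (\<lambda>xs. downs (A xs) (B xs))"
proof -
  have "computable 2 (\<lambda>xs. downs (xs ! 0) (xs ! 1))" unfolding downs_def
    by (intro computable_intros computable_pred_intros computable_code_intros; simp)
  from computable_subst2[OF this assms] show ?thesis .
qed

lemma computable_pair_count:
  assumes "computable k A" "computable k B" "computable k C"
  shows "computable k (\<lambda>xs. pair_count (A xs) (B xs) (C xs))"
proof -
  have "computable 3 (\<lambda>xs. pair_count (xs ! 0) (xs ! 1) (xs ! 2))" unfolding pair_count_def
    by (intro computable_intros computable_pred_intros computable_code_intros
        computable_ups computable_downs computable_div2; simp)
  from computable_subst3[OF this assms] show ?thesis .
qed

lemma computable_letter_count:
  assumes "computable k A" "computable k B" "computable k C"
  shows "computable k (\<lambda>xs. letter_count (A xs) (B xs) (C xs))"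
proof -
  have "computable 3 (\<lambda>xs. letter_count (xs ! 0) (xs ! 1) (xs ! 2))" unfolding letter_count_def
    by (intro computable_intros computable_pred_intros computable_code_intros
        computable_ups computable_downs computable_div2; simp)
  from computable_subst3[OF this assms] show ?thesis .
qed

lemma decidable_trivial_code:
  assumes "decidable E" shows "decidable {c. trivial_code E c}"
  unfolding decidable_iff_computable_pred trivial_code_def mem_Collect_eq
  by (intro computable_intros computable_pred_intros computable_code_intros computable_pred_mem[OF assms]
      computable_ups computable_downs computable_div2 computable_pair_count computable_letter_count; simp)

definition letter_code :: "nat \<times> bool \<Rightarrow> nat" where
  "letter_code = (\<lambda>(x, b). 2 * x + of_bool b)"

lemma letter_code_div2: "letter_code l div 2 = fst l"
  by (cases l) (simp add: letter_code_def)

lemma word_code_letter: "word_code w = list_encode (map letter_code w)"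
  by (simp add: word_code_def letter_code_def)

lemma letter_code_surj: "letter_code (c div 2, odd c) = c"
  by (simp add: letter_code_def)

lemma position_code:
  assumes "n \<le> length w"
  shows "position w n = int (ups (word_code w) n) - int (downs (word_code w) n)"
  using assms
proof (induction n)
  case (Suc n)
  then have "n < length w" by simp
  then have "lnth (word_code w) n = letter_code (w ! n)" by (simp add: word_code_letter)
  then have "position w (Suc n) = position w n + t_exponent (w ! n)"
    "ups (word_code w) (Suc n) = ups (word_code w) n + of_bool (letter_code (w ! n) = 5)"
    "downs (word_code w) (Suc n) = downs (word_code w) n + of_bool (letter_code (w ! n) = 4)"
    by (simp_all add: position_def ups_def downs_def)
  moreover have "t_exponent l = int (of_bool (letter_code l = 5)) - int (of_bool (letter_code l = 4))" for l
    by (cases l) (auto simp: t_exponent_def letter_code_def of_bool_def split: if_splits; presburger)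
  ultimately show ?case using Suc by simp
qed (simp add: ups_def downs_def)

lemma word_trivial_iff:
  assumes w: "w \<in> words_over {..<3}"
  shows "word_value (hall_group E) hall_generators w = \<one>\<^bsub>hall_group E\<^esub> \<longleftrightarrow> trivial_code E (word_code w)"
proof -
  define c where "c = word_code w"
  have len: "llen c = length w" by (simp add: c_def word_code_letter)
  have lnth: "lnth c i = letter_code (w ! i)" if "i < length w" for i
    using that by (simp add: c_def word_code_letter)
  have div2: "lnth c i div 2 = fst (w ! i)" if "i < length w" for i
    using lnth[OF that] by (simp add: letter_code_div2)
  have pos: "position w n = int (ups c n) - int (downs c n)" if "n \<le> length w" for n
    unfolding c_def by (rule position_code[OF that])
  have "lnth c i < 6" if "i < length w" for i
  proof -
    have "w ! i \<in> set w" using that by simp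
    then have "fst (w ! i) < 3" using w by (auto simp: words_over_def)
    then show ?thesis using div2[OF that] by simp
  qed
  then have letters: "\<forall>i<llen c. lnth c i < 6" by (simp add: len)
  have k: "position w (length w) = 0 \<longleftrightarrow> ups c (llen c) = downs c (llen c)"
    using pos[of "length w"] by (auto simp: len)
  have count: "letter_count c x n = (\<Sum>n'<length w. of_bool (fst (w ! n') = x \<and> position w n' = position w n))"
    if "n < length w" for x n
    unfolding letter_count_def len
    by (intro sum.cong HOL.refl arg_cong[where f = of_bool]) (use that pos div2 in auto)
  have f: "word_f w = 0 \<longleftrightarrow> (\<forall>n<llen c. lnth c n div 2 = 0 \<longrightarrow> even (letter_count c 0 n))"
    unfolding word_f_def sum_T_eq_0_iff len by (auto simp: count div2)
  have g: "word_g w = 0 \<longleftrightarrow> (\<forall>n<llen c. lnth c n div 2 = 1 \<longrightarrow> even (letter_count c 1 n))"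
    unfolding word_g_def sum_T_eq_0_iff len by (auto simp: count div2)
  have pcount: "pair_count c m n = (\<Sum>m'<length w. \<Sum>n'<m'. of_bool ((fst (w ! n') = 0 \<and> fst (w ! m') = 1) \<and>
      position w m' - position w n' = position w m - position w n))"
    if "m < length w" "n < m" for m n
    unfolding pair_count_def len
  proof (intro sum.cong HOL.refl arg_cong[where f = of_bool])
    fix m' n' assume "m' \<in> {..<length w}" "n' \<in> {..<m'}"
    then have mn: "m' < length w" "n' < length w" "m < length w" "n < length w" using that by auto
    have "lnth c n' < 2 \<longleftrightarrow> lnth c n' div 2 = 0" by auto
    then have "lnth c n' < 2 \<longleftrightarrow> fst (w ! n') = 0" using mn by (simp add: div2)
    then show "((lnth c n' < 2 \<and> lnth c m' div 2 = 1) \<and>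
        ups c m' + downs c n' + downs c m + ups c n = ups c m + downs c n + downs c m' + ups c n') =
      ((fst (w ! n') = 0 \<and> fst (w ! m') = 1) \<and> position w m' - position w n' = position w m - position w n)"
      using mn div2[of m'] by (auto simp: pos)
  qed
  have E: "position w m - position w n \<in> int ` E \<longleftrightarrow> downs c m + ups c n \<le> ups c m + downs c n \<and>
         ups c m + downs c n - (downs c m + ups c n) \<in> E" if "m < length w" "n < m" for m n
  proof -
    have "position w m - position w n = int (ups c m + downs c n) - int (downs c m + ups c n)"
      using that by (simp add: pos)
    moreover have "int a - int b \<in> int ` E \<longleftrightarrow> b \<le> a \<and> a - b \<in> E" for a b :: nat
    proof
      assume "int a - int b \<in> int ` E"
      then obtain e where "e \<in> E" "int a - int b = int e" by blast
      moreover from this have "a = b + e" by linarith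
      ultimately show "b \<le> a \<and> a - b \<in> E" by simp
    next
      assume "b \<le> a \<and> a - b \<in> E"
      then have "int a - int b = int (a - b)" "a - b \<in> E" by simp_all
      then show "int a - int b \<in> int ` E" by blast
    qed
    ultimately show ?thesis by metis
  qed
  have z: "trunc E (word_z w) = 0 \<longleftrightarrow> (\<forall>m<llen c. \<forall>n<m. lnth c n div 2 = 0 \<and> lnth c m div 2 = 1 \<longrightarrow>
        (downs c m + ups c n \<le> ups c m + downs c n \<and>
         ups c m + downs c n - (downs c m + ups c n) \<in> E) \<or> even (pair_count c m n))"
    unfolding word_z_def trunc_sum_T_eq_0_iff len
    by (intro all_cong) (simp add: pcount E div2)
  show ?thesis
    unfolding word_value_hall[OF w] hall_one prod.inject k f g z trivial_code_def c_def[symmetric]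
    using letters by (auto simp: less_2_cases_iff)
qed

lemma solvable_word_problem_hall:
  assumes "decidable E" shows "solvable_word_problem (hall_group E) hall_generators"
proof -
  have len: "length hall_generators = 3" by (simp add: hall_generators_def)
  have "{word_code w | w. w \<in> words_over {..<length hall_generators} \<and>
      word_value (hall_group E) hall_generators w = \<one>\<^bsub>hall_group E\<^esub>} = {c. trivial_code E c}"
  proof (intro subset_antisym subsetI)
    fix c assume "c \<in> {c. trivial_code E c}"
    then have c: "trivial_code E c" by simp
    define w where "w = map (\<lambda>c. (c div 2, odd c)) (list_decode c)"
    have "word_code w = list_encode (map (\<lambda>c. letter_code (c div 2, odd c)) (list_decode c))"
      by (simp add: word_code_letter w_def comp_def)
    then have wc: "word_code w = c" unfolding letter_code_surj by simp
    have letter: "x < 6" if x: "x \<in> set (list_decode c)" for x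
    proof -
      obtain i where "i < length (list_decode c)" "x = list_decode c ! i" using x by (auto simp: in_set_conv_nth)
      moreover have "\<forall>i<length (list_decode c). lnth c i < 6"
        using c unfolding trivial_code_def llen_def by blast
      ultimately show ?thesis using lnth_encode[of i "list_decode c"] by auto
    qed
    have "x div 2 < 3" if "x \<in> set (list_decode c)" for x
      using letter[OF that] by (simp add: div_less_iff_less_mult)
    then have w: "w \<in> words_over {..<length hall_generators}"
      unfolding len by (auto simp: words_over_def w_def)
    then have "word_value (hall_group E) hall_generators w = \<one>\<^bsub>hall_group E\<^esub>"
      using word_trivial_iff[of w E] c unfolding len wc by blast
    with w wc show "c \<in> {word_code w | w. w \<in> words_over {..<length hall_generators} \<and>
      word_value (hall_group E) hall_generators w = \<one>\<^bsub>hall_group E\<^esub>}" by blast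
  next
    fix c assume "c \<in> {word_code w | w. w \<in> words_over {..<length hall_generators} \<and>
      word_value (hall_group E) hall_generators w = \<one>\<^bsub>hall_group E\<^esub>}"
    then show "c \<in> {c. trivial_code E c}" unfolding len by (auto simp: word_trivial_iff)
  qed
  then show ?thesis using decidable_trivial_code[OF assms] by (simp add: solvable_word_problem_def)
qed


section \<open>The conjugacy problem\<close>

definition t_power :: "nat \<Rightarrow> bool \<Rightarrow> gword" where
  "t_power n b = replicate n (2, b)"

definition shifted_a :: "nat \<Rightarrow> gword" where
  "shifted_a n = t_power n False @ (0, True) # t_power n True"

text \<open>
  For each \<open>i\<close>, the words \<open>source_word i\<close>, with value \<open>(0, t^(2^(i+1)) - 1, 0, 0)\<close>, and
  \<open>source_word i @ central_word i\<close> are the pair whose conjugacy encodes whether \<open>i\<close> is in the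
  domain of \<open>D\<close>.
\<close>

definition source_word :: "nat \<Rightarrow> gword" where
  "source_word i = (0, True) # shifted_a (2 ^ Suc i)"

text \<open>
  The commutator of \<open>(0, t^(2^i), 0, 0)\<close> and \<open>b\<close>, which are both involutions; its value is the
  central monomial with exponent \<open>2^i\<close>.
\<close>

definition central_word :: "nat \<Rightarrow> gword" where
  "central_word i = shifted_a (2 ^ i) @ (1, True) # shifted_a (2 ^ i) @ [(1, True)]"

lemma t_power_over: "t_power n b \<in> words_over {..<3}"
  by (auto simp: t_power_def words_over_def)

lemma shifted_a_over: "shifted_a n \<in> words_over {..<3}"
  by (simp add: shifted_a_def words_over_append words_over_Cons t_power_over)

lemma source_word_over: "source_word i \<in> words_over {..<3}"
  by (simp add: source_word_def words_over_Cons shifted_a_over)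

lemma central_word_over: "central_word i \<in> words_over {..<3}"
  by (simp add: central_word_def words_over_append words_over_Cons shifted_a_over words_over_Nil)

lemma word_value_hall_append:
  assumes "u \<in> words_over {..<3}" "v \<in> words_over {..<3}"
  shows "word_value (hall_group E) hall_generators (u @ v) =
    word_value (hall_group E) hall_generators u \<otimes>\<^bsub>hall_group E\<^esub> word_value (hall_group E) hall_generators v"
proof -
  have "length hall_generators = 3" "set hall_generators \<subseteq> carrier (hall_group E)"
    by (simp_all add: hall_generators_def hall_carrier)
  then show ?thesis using group.word_value_append[OF group_hall, of hall_generators E u v] assms by simp
qed

lemma word_value_t_power:
  "word_value (hall_group E) hall_generators (t_power n b) = ((if b then int n else - int n), 0, 0, 0)"
  by (induction n) (auto simp: t_power_def hall_simps hall_generators_nth hall_inv_generators)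

lemma word_value_shifted_a:
  "word_value (hall_group E) hall_generators (shifted_a n) = (0, T (int n), 0, 0)"
  by (simp add: shifted_a_def word_value_hall_append words_over_Cons t_power_over word_value_t_power
      hall_generators_nth hall_mult)

lemma word_value_source:
  "word_value (hall_group E) hall_generators (source_word i) = (0, T (2 ^ Suc i) - 1, 0, 0)"
  by (simp add: source_word_def word_value_shifted_a hall_generators_nth hall_mult laurent_minus)

lemma word_value_central:
  "word_value (hall_group E) hall_generators (central_word i) = (0, 0, 0, trunc E (T (2 ^ i)))"
  by (simp add: central_word_def word_value_hall_append words_over_append words_over_Cons words_over_Nil
      shifted_a_over word_value_shifted_a hall_generators_nth hall_simps)

text \<open>
  Since \<open>k = 0\<close> and \<open>g = 0\<close>, the conjugates with unchanged \<open>f\<close> differ by the multiples of \<open>f\<close>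
  in the central entry.
\<close>

lemma conjugate_source_central:
  "conjugate_in (hall_group (exponents D)) (word_value (hall_group (exponents D)) hall_generators (source_word i))
     (word_value (hall_group (exponents D)) hall_generators (source_word i @ central_word i)) \<longleftrightarrow>
   (\<exists>m. prod_encode (i, m) \<in> D)"
proof -
  let ?E = "exponents D" and ?f = "T (2 ^ Suc i) - 1"
  have v: "word_value (hall_group ?E) hall_generators (source_word i @ central_word i) =
      (0, ?f, 0, trunc ?E (T (2 ^ i)))"
    by (simp add: word_value_hall_append source_word_over central_word_over word_value_source
        word_value_central hall_mult del: power_Suc)
  have supp: "trunc ?E x + y \<in> supported_on ?E \<longleftrightarrow> x + y \<in> supported_on ?E" for x y
    by (simp add: trunc_add flip: trunc_eq_0_iff)
  have "conjugate_in (hall_group ?E) (0, ?f, 0, 0) (0, ?f, 0, trunc ?E (T (2 ^ i))) \<longleftrightarrow>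
      (\<exists>j m'. ?f * T j = ?f \<and> T (2 ^ i) + ?f * m' \<in> supported_on ?E)"
    by (simp add: hall_conjugate_iff supp del: power_Suc)
  also have "\<dots> \<longleftrightarrow> (\<exists>m'. T (2 ^ i) + ?f * m' \<in> supported_on ?E)"
    by (metis T_0 mult.right_neutral)
  also have "\<dots> \<longleftrightarrow> (\<exists>s\<in>supported_on ?E. ?f dvd T (2 ^ i) - s)"
  proof
    assume "\<exists>m'. T (2 ^ i) + ?f * m' \<in> supported_on ?E"
    then obtain m' where m: "T (2 ^ i) + ?f * m' \<in> supported_on ?E" by blast
    have "?f dvd T (2 ^ i) - (T (2 ^ i) + ?f * m')" by (simp del: power_Suc)
    with m show "\<exists>s\<in>supported_on ?E. ?f dvd T (2 ^ i) - s" by blast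
  next
    assume "\<exists>s\<in>supported_on ?E. ?f dvd T (2 ^ i) - s"
    then obtain s m' where s: "s \<in> supported_on ?E" "T (2 ^ i) - s = ?f * m'" by (metis dvdE)
    then have "T (2 ^ i) + ?f * (- m') = s" by (simp add: algebra_simps del: power_Suc)
    then show "\<exists>m'. T (2 ^ i) + ?f * m' \<in> supported_on ?E" using s(1) by metis
  qed
  finally show ?thesis unfolding v word_value_source monomial_mem_iff .
qed

definition repeat_code :: "nat \<Rightarrow> nat \<Rightarrow> nat \<Rightarrow> nat" where
  "repeat_code x n c = rec_nat c (\<lambda>_ y. Suc (prod_encode (x, y))) n"

lemma repeat_code: "repeat_code x n (list_encode xs) = list_encode (replicate n x @ xs)"
  by (induction n) (auto simp: repeat_code_def)

definition shifted_a_code :: "nat \<Rightarrow> nat \<Rightarrow> nat" where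
  "shifted_a_code n c = repeat_code 4 n (Suc (prod_encode (1, repeat_code 5 n c)))"

lemma shifted_a_code:
  "shifted_a_code n (word_code w) = word_code (shifted_a n @ w)"
proof -
  have "shifted_a_code n (word_code w) =
      repeat_code 4 n (list_encode (1 # replicate n 5 @ map letter_code w))"
    by (simp add: shifted_a_code_def word_code_letter repeat_code)
  also have "\<dots> = word_code (shifted_a n @ w)"
    unfolding repeat_code
    by (simp add: shifted_a_def t_power_def word_code_letter letter_code_def map_replicate)
  finally show ?thesis .
qed

lemma word_code_Cons: "word_code ((x, b) # w) = Suc (prod_encode (2 * x + of_bool b, word_code w))"
  by (simp add: word_code_def)

lemma word_code_Nil: "word_code [] = 0"
  by (simp add: word_code_def)

lemma computable_shifted_a_code:
  assumes "computable k A" "computable k B" shows "computable k (\<lambda>xs. shifted_a_code (A xs) (B xs))"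
proof -
  have "computable 2 (\<lambda>xs. shifted_a_code (xs ! 0) (xs ! 1))"
    unfolding shifted_a_code_def repeat_code_def
    by (intro computable_intros computable_code_intros; simp)
  from computable_subst2[OF this assms] show ?thesis .
qed

text \<open>
  The map from \<open>i\<close> to the codes of the two words is computable and reduces the domain of \<open>D\<close>
  to the conjugacy problem.
\<close>

lemma unsolvable_conjugacy_problem_hall:
  assumes "\<not> decidable {i. \<exists>m. prod_encode (i, m) \<in> D}"
  shows "\<not> solvable_conjugacy_problem (hall_group (exponents D)) hall_generators"
proof
  let ?G = "hall_group (exponents D)"
  let ?C = "{prod_encode (word_code u, word_code v) | u v.
       u \<in> words_over {..<length hall_generators} \<and> v \<in> words_over {..<length hall_generators} \<and>
       conjugate_in ?G (word_value ?G hall_generators u) (word_value ?G hall_generators v)}"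
  assume "solvable_conjugacy_problem ?G hall_generators"
  then have C: "decidable ?C" unfolding solvable_conjugacy_problem_def .
  have len: "length hall_generators = 3" by (simp add: hall_generators_def)
  have inj: "word_code u = word_code v \<longleftrightarrow> u = v" for u v
  proof -
    have "inj letter_code"
      by (rule inj_on_inverseI[where g = "\<lambda>c. (c div 2, odd c)"]) (auto simp: letter_code_def)
    then show ?thesis by (simp add: word_code_letter list_encode_eq inj_map_eq_map)
  qed
  have mem: "prod_encode (word_code u, word_code v) \<in> ?C \<longleftrightarrow>
      conjugate_in ?G (word_value ?G hall_generators u) (word_value ?G hall_generators v)"
    if "u \<in> words_over {..<3}" "v \<in> words_over {..<3}" for u v
    using that unfolding len by (auto simp: inj)
  have source: "word_code (source_word i) = Suc (prod_encode (1, shifted_a_code (2 ^ Suc i) 0))" for i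
    using shifted_a_code[of "2 ^ Suc i" "[]"] by (simp add: source_word_def word_code_Cons word_code_Nil)
  have central: "word_code (central_word i) = shifted_a_code (2 ^ i)
      (Suc (prod_encode (3, shifted_a_code (2 ^ i) (Suc (prod_encode (3, 0))))))" for i
    using shifted_a_code[of "2 ^ i" "(1, True) # shifted_a (2 ^ i) @ [(1, True)]"]
      shifted_a_code[of "2 ^ i" "[(1, True)]"]
    by (simp add: central_word_def word_code_Cons word_code_Nil)
  have target: "word_code (source_word i @ central_word i) =
      Suc (prod_encode (1, shifted_a_code (2 ^ Suc i) (word_code (central_word i))))" for i
    using shifted_a_code[of "2 ^ Suc i" "central_word i"] by (simp add: source_word_def word_code_Cons)
  have reduction: "prod_encode (word_code (source_word i), word_code (source_word i @ central_word i)) \<in> ?C \<longleftrightarrow>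
      (\<exists>m. prod_encode (i, m) \<in> D)" for i
    unfolding conjugate_source_central[symmetric]
    by (rule mem) (simp_all add: source_word_over central_word_over words_over_append)
  have "computable_pred 1 (\<lambda>xs. prod_encode (word_code (source_word (xs ! 0)),
      word_code (source_word (xs ! 0) @ central_word (xs ! 0))) \<in> ?C)"
    unfolding source target central
    by (intro computable_pred_mem[OF C] computable_intros computable_code_intros computable_shifted_a_code; simp)
  then have "computable_pred 1 (\<lambda>xs. \<exists>m. prod_encode (xs ! 0, m) \<in> D)"
    unfolding reduction .
  then have "decidable {i. \<exists>m. prod_encode (i, m) \<in> D}"
    unfolding decidable_iff_computable_pred mem_Collect_eq .
  then show False using assms by blast
qed

theorem theorem1:
  shows "\<exists>(G :: nat monoid) gs.
    group G \<and> finitely_generated G \<and> recursively_presented G \<and> conjugacy_separable G \<and>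
    solvable G \<and> derived_length G = 3 \<and>
    generating_list G gs \<and> solvable_word_problem G gs \<and> \<not> solvable_conjugacy_problem G gs"
proof -
  obtain D where D: "decidable D"
    "\<forall>i m m'. prod_encode (i, m) \<in> D \<longrightarrow> prod_encode (i, m') \<in> D \<longrightarrow> m = m'"
    "\<not> decidable {i. \<exists>m. prod_encode (i, m) \<in> D}"
    using exists_undecidable_domain by blast
  let ?G = "hall_group (exponents D)"
  \<comment> \<open>The monomial with exponent 3 therefore survives in the second derived subgroup.\<close>
  have "3 \<notin> exponents D"
  proof
    assume "3 \<in> exponents D"
    then obtain i m :: nat where *: "3 = 2 ^ i * (4 * m + 1)"
      unfolding exponents_def by auto
    have "odd (2 ^ i * (4 * m + 1))" unfolding *[symmetric] by simp
    then have "i = 0" by (cases i) simp_all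
    with * have "3 = 4 * m + 1" by simp
    then show False by presburger
  qed
  from hall_derived[OF this] have solvable: "solvable ?G" "derived_length ?G = 3" .
  have cs: "conjugacy_separable ?G"
    by (rule conjugacy_separable_hall) (rule supported_on_closed[OF D(2)])
  have wp: "solvable_word_problem ?G hall_generators"
    by (rule solvable_word_problem_hall[OF decidable_exponents[OF D(1)]])
  have cp: "\<not> solvable_conjugacy_problem ?G hall_generators"
    by (rule unsolvable_conjugacy_problem_hall[OF D(3)])
  interpret group ?G by (rule group_hall)
  obtain H :: "nat monoid" and hs where H: "group H" "generating_list H hs"
    "solvable_word_problem H hs" "\<not> solvable_conjugacy_problem H hs" "conjugacy_separable H"
    "solvable H" "derived_length H = 3"
    using isomorphic_nat_group[OF generating_list_hall] solvable cs wp cp by metis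
  moreover have "finitely_generated H"
    using H(2) unfolding finitely_generated_def generating_list_def by blast
  moreover have "recursively_presented H"
    using group.recursively_presented_if_solvable_word_problem[OF H(1-3)] .
  ultimately show ?thesis by blast
qed

end
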